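(* Let $\Gamma$ be a countable Abelian group of (orientation-preserving) $C^{1+bv}$ diffeomorphisms of the circle $\mathrm{S}^1$ whose action on $\mathrm{S}^1$ is free. Assume that every element of $\Gamma$ has absolutely continuous derivative. Then there exists a (continuous) path $(g_t)_{t\in[0,1[}$ of $C^{1+bv}$ circle diffeomorphisms starting at $g_0=\mathrm{id}$ such that, for each $f\in\Gamma$, the conjugates $g_t f g_t^{-1}$ converge to the rotation $R_{\rho(f)}$ in the $C^{1+bv}$ sense as $t\to 1$.
   Context: All diffeomorphisms are orientation preserving. $\mathrm{S}^1=\mathbb{R}/\mathbb{Z}$, $\rho(f)\in\mathbb{R}/\mathbb{Z}$ is the rotation number of $f$, and $R_\rho(x)=x+\rho$. A $C^{1+bv}$ diffeomorphism is a $C^1$ diffeomorphism $f$ such that $\log(Df)$ has finite total variation; $\mathrm{var}$ denotes total variation on $\mathrm{S}^1$. The action of $\Gamma$ is free if no nontrivial element of $\Gamma$ has a fixed point. Circle diffeomorphisms $f_t$ converge to a rotation $R_\rho$ in the $C^{1+bv}$ sense if $f_t\to R_\rho$ uniformly, $Df_t\to 1$ uniformly, and $\mathrm{var}(\log(Df_t))\to 0$. More generally, $f_t$ converges to a $C^{1+bv}$ diffeomorphism $g$ in the $C^{1+bv}$ sense if $f_t\to g$ in the $C^1$ topology and $\mathrm{var}(\log D(g^{-1}f_t))\to 0$ and $\mathrm{var}(\log D(f_t g^{-1}))\to 0$. The path $t\mapsto g_t$ is continuous with respect to $C^{1+bv}$ convergence. *)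

theory Defs
  imports "HOL-Analysis.Analysis"
begin

section \<open>The circle \<open>\<real> / \<int>\<close>\<close>

quotient_type circle = real / "\<lambda>x y :: real. x - y \<in> \<int>"
  morphisms rep_circle circle_of
proof (rule equivpI)
  show "reflp (\<lambda>x y :: real. x - y \<in> \<int>)"
    by (simp add: reflp_def)
  show "symp (\<lambda>x y :: real. x - y \<in> \<int>)"
    by (rule sympI) (use Ints_minus in fastforce)
  show "transp (\<lambda>x y :: real. x - y \<in> \<int>)"
  proof (rule transpI)
    fix x y z :: real
    assume "x - y \<in> \<int>" "y - z \<in> \<int>"
    then have "(x - y) + (y - z) \<in> \<int>" by (rule Ints_add)
    then show "x - z \<in> \<int>" by simp
  qed
qed

lemma circle_of_eq_iff: "circle_of x = circle_of y \<longleftrightarrow> x - y \<in> \<int>"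
  by (rule circle.abs_eq_iff)

instantiation circle :: ab_group_add
begin

lift_definition zero_circle :: circle is "0 :: real" .

lift_definition plus_circle :: "circle \<Rightarrow> circle \<Rightarrow> circle" is "(+)"
proof -
  fix a b c d :: real
  assume "a - b \<in> \<int>" "c - d \<in> \<int>"
  then have "(a - b) + (c - d) \<in> \<int>" by (rule Ints_add)
  then show "a + c - (b + d) \<in> \<int>" by (simp add: algebra_simps)
qed

lift_definition uminus_circle :: "circle \<Rightarrow> circle" is "uminus"
proof -
  fix a b :: real
  assume "a - b \<in> \<int>"
  then have "- (a - b) \<in> \<int>" by (rule Ints_minus)
  then show "- a - - b \<in> \<int>" by simp
qed

lift_definition minus_circle :: "circle \<Rightarrow> circle \<Rightarrow> circle" is "(-)"
proof -
  fix a b c d :: real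
  assume "a - b \<in> \<int>" "c - d \<in> \<int>"
  then have "(a - b) - (c - d) \<in> \<int>" by (rule Ints_diff)
  then show "a - c - (b - d) \<in> \<int>" by (simp add: algebra_simps)
qed

instance
  by standard (transfer; simp)+

end

lemma dist_nearest_int_shift:
  fixes x y :: real
  assumes "x - y \<in> \<int>"
  shows "\<bar>x - of_int (round x)\<bar> = \<bar>y - of_int (round y)\<bar>"
proof -
  obtain n where "x - y = of_int n"
    using assms by (rule Ints_cases)
  then have x: "x = y + of_int n" by simp
  have "round x = round y + n"
    unfolding x round_def by linarith
  with x show ?thesis by simp
qed

text \<open>The metric is the quotient one: the distance from \<open>x - y\<close> to the nearest integer.\<close>

instantiation circle :: metric_space
begin

lift_definition dist_circle :: "circle \<Rightarrow> circle \<Rightarrow> real"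
  is "\<lambda>x y. \<bar>(x - y) - of_int (round (x - y))\<bar>"
proof -
  fix a b c d :: real
  assume "a - b \<in> \<int>" "c - d \<in> \<int>"
  then have "(a - b) - (c - d) \<in> \<int>" by (rule Ints_diff)
  then have "(a - c) - (b - d) \<in> \<int>" by (simp add: algebra_simps)
  then show "\<bar>a - c - of_int (round (a - c))\<bar> = \<bar>b - d - of_int (round (b - d))\<bar>"
    by (rule dist_nearest_int_shift)
qed

definition uniformity_circle :: "(circle \<times> circle) filter" where
  "uniformity_circle = (INF e\<in>{0<..}. principal {(x, y). dist x y < e})"

definition open_circle :: "circle set \<Rightarrow> bool" where
  "open_circle U \<longleftrightarrow> (\<forall>x\<in>U. eventually (\<lambda>(x', y). x' = x \<longrightarrow> y \<in> U) uniformity)"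

instance
proof
  show "(uniformity :: (circle \<times> circle) filter)
      = (INF e\<in>{0<..}. principal {(x, y). dist x y < e})"
    by (rule uniformity_circle_def)
  show "open U \<longleftrightarrow> (\<forall>x\<in>U. eventually (\<lambda>(x', y). x' = x \<longrightarrow> y \<in> U) uniformity)"
    for U :: "circle set"
    by (rule open_circle_def)
  show "dist x y = 0 \<longleftrightarrow> x = y" for x y :: circle
  proof transfer
    fix x y :: real
    show "\<bar>x - y - of_int (round (x - y))\<bar> = 0 \<longleftrightarrow> x - y \<in> \<int>"
    proof
      assume "\<bar>x - y - of_int (round (x - y))\<bar> = 0"
      then have "x - y = of_int (round (x - y))" by simp
      then show "x - y \<in> \<int>" by (metis Ints_of_int)
    qed (auto elim!: Ints_cases)
  qed
  show "dist x y \<le> dist x z + dist y z" for x y z :: circle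
  proof transfer
    fix x y z :: real
    have "\<bar>x - y - of_int (round (x - y))\<bar>
        \<le> \<bar>x - y - of_int (round (x - z) - round (y - z))\<bar>"
      by (rule round_diff_minimal)
    also have "\<dots> \<le> \<bar>x - z - of_int (round (x - z))\<bar> + \<bar>y - z - of_int (round (y - z))\<bar>"
      by simp
    finally show "\<bar>x - y - of_int (round (x - y))\<bar>
        \<le> \<bar>x - z - of_int (round (x - z))\<bar> + \<bar>y - z - of_int (round (y - z))\<bar>" .
  qed
qed

end

definition rotation :: "circle \<Rightarrow> circle \<Rightarrow> circle" where
  "rotation \<rho> x = x + \<rho>"


section \<open>Circle diffeomorphisms\<close>

definition circle_lift :: "(real \<Rightarrow> real) \<Rightarrow> (circle \<Rightarrow> circle) \<Rightarrow> bool" where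
  "circle_lift F f \<longleftrightarrow>
    continuous_on UNIV F \<and> (\<forall>x. circle_of (F x) = f (circle_of x))"

definition circle_C1 :: "(circle \<Rightarrow> circle) \<Rightarrow> bool" where
  "circle_C1 f \<longleftrightarrow> (\<exists>F. circle_lift F f \<and> F C1_differentiable_on UNIV)"

definition orientation_preserving :: "(circle \<Rightarrow> circle) \<Rightarrow> bool" where
  "orientation_preserving f \<longleftrightarrow> (\<exists>F. circle_lift F f \<and> strict_mono F)"

definition circle_C1_diffeo :: "(circle \<Rightarrow> circle) \<Rightarrow> bool" where
  "circle_C1_diffeo f \<longleftrightarrow>
    bij f \<and> circle_C1 f \<and> circle_C1 (inv f) \<and> orientation_preserving f"

lemma circle_lift_unique:
  assumes "circle_lift F f" "circle_lift G f"
  obtains n :: int where "\<And>x. F x = G x + of_int n"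
proof -
  have int: "F x - G x \<in> \<int>" for x
    using assms by (simp add: circle_lift_def circle_of_eq_iff[symmetric])
  have "continuous_on UNIV (\<lambda>x. F x - G x)"
    using assms by (auto simp: circle_lift_def intro: continuous_intros)
  moreover have "1 \<le> norm ((F y - G y) - (F x - G x))" if "F y - G y \<noteq> F x - G x" for x y
    using int[of x] int[of y] that Ints_nonzero_abs_ge1 by (auto intro!: Ints_nonzero_abs_ge1)
  ultimately have "(\<lambda>x. F x - G x) constant_on UNIV"
    by (intro continuous_discrete_range_constant) (auto intro!: exI[of _ 1])
  then obtain c where c: "\<And>x. F x - G x = c"
    by (auto simp: constant_on_def)
  then obtain n where "c = of_int n"
    using int[of 0] by (metis Ints_cases)
  with c have "F x = G x + of_int n" for x
    by (metis diff_add_cancel add.commute)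
  then show thesis by (rule that)
qed

lemma circle_lift_shift:
  assumes "circle_lift F f"
  shows "circle_lift (\<lambda>x. F (x + of_int m)) f"
proof -
  have "circle_of (x + of_int m) = circle_of x" for x
    by (simp add: circle_of_eq_iff)
  moreover have "continuous_on UNIV (\<lambda>x. F (x + of_int m))"
    using assms by (auto simp: circle_lift_def intro!: continuous_on_compose2[of UNIV F] continuous_intros)
  ultimately show ?thesis
    using assms by (simp add: circle_lift_def)
qed

definition circle_deriv :: "(circle \<Rightarrow> circle) \<Rightarrow> circle \<Rightarrow> real" where
  "circle_deriv f p =
    (THE D. \<exists>F x. circle_lift F f \<and> circle_of x = p \<and> (F has_real_derivative D) (at x))"

lemma circle_deriv_eq:
  assumes "circle_lift F f" "(F has_real_derivative D) (at x)"
  shows "circle_deriv f (circle_of x) = D"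
  unfolding circle_deriv_def
proof (rule the_equality)
  show "\<exists>F' x'. circle_lift F' f \<and> circle_of x' = circle_of x \<and> (F' has_real_derivative D) (at x')"
    using assms by blast
next
  fix E
  assume "\<exists>G y. circle_lift G f \<and> circle_of y = circle_of x \<and> (G has_real_derivative E) (at y)"
  then obtain G y where G: "circle_lift G f" "circle_of y = circle_of x"
    "(G has_real_derivative E) (at y)" by blast
  obtain m where "y - x = of_int m"
    using G(2) by (metis circle_of_eq_iff Ints_cases)
  then have y: "y = x + of_int m" by simp
  obtain n where n: "\<And>x. G (x + of_int m) = F x + of_int n"
    using circle_lift_unique[OF circle_lift_shift[OF G(1), of m] assms(1)] by blast
  have "((\<lambda>x. G (x + of_int m)) has_real_derivative E) (at x)"
    using G(3) unfolding y by (simp add: DERIV_shift)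
  then have "((\<lambda>x. F x + of_int n) has_real_derivative E) (at x)"
    by (simp add: n)
  moreover have "((\<lambda>x. F x + of_int n) has_real_derivative D) (at x)"
    using assms(2) by (auto intro!: derivative_eq_intros)
  ultimately show "E = D" by (rule DERIV_unique)
qed

text \<open>The translation number \<open>\<tau>\<close> of a lift depends on the lift only up to an integer.\<close>

definition rotation_number :: "(circle \<Rightarrow> circle) \<Rightarrow> circle" where
  "rotation_number f =
    (THE \<rho>. \<exists>F \<tau>. circle_lift F f \<and> (\<forall>x. (\<lambda>n. (F ^^ n) x / real n) \<longlonglongrightarrow> \<tau>)
      \<and> \<rho> = circle_of \<tau>)"


section \<open>Total variation and absolute continuity\<close>

definition total_variation :: "(real \<Rightarrow> real) \<Rightarrow> real \<Rightarrow> real \<Rightarrow> ennreal" where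
  "total_variation h a b =
    (SUP (n, x) \<in> {(n :: nat, x :: nat \<Rightarrow> real).
        a \<le> x 0 \<and> x n \<le> b \<and> (\<forall>i<n. x i \<le> x (Suc i))}.
      \<Sum>i<n. ennreal \<bar>h (x (Suc i)) - h (x i)\<bar>)"

definition absolutely_continuous_on_interval ::
    "(real \<Rightarrow> real) \<Rightarrow> real \<Rightarrow> real \<Rightarrow> bool" where
  "absolutely_continuous_on_interval h a b \<longleftrightarrow>
    (\<forall>\<epsilon>>0. \<exists>\<delta>>0. \<forall>(n :: nat) (u :: nat \<Rightarrow> real) (v :: nat \<Rightarrow> real).
      (\<forall>i<n. a \<le> u i \<and> u i \<le> v i \<and> v i \<le> b) \<and>
      disjoint_family_on (\<lambda>i. {u i<..<v i}) {..<n} \<and>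
      (\<Sum>i<n. v i - u i) < \<delta>
      \<longrightarrow> (\<Sum>i<n. \<bar>h (v i) - h (u i)\<bar>) < \<epsilon>)"

text \<open>On the circle both notions are read off on the fundamental domain \<open>[0, 1]\<close>;
  including the endpoint \<open>1\<close> accounts for the arc that closes up the circle.\<close>

definition circle_var :: "(circle \<Rightarrow> real) \<Rightarrow> ennreal" where
  "circle_var \<phi> = total_variation (\<lambda>x. \<phi> (circle_of x)) 0 1"

definition circle_absolutely_continuous :: "(circle \<Rightarrow> real) \<Rightarrow> bool" where
  "circle_absolutely_continuous \<phi> \<longleftrightarrow>
    absolutely_continuous_on_interval (\<lambda>x. \<phi> (circle_of x)) 0 1"


section \<open>\<open>C\<^sup>1\<^sup>+\<^sup>b\<^sup>v\<close> diffeomorphisms and convergence\<close>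

definition log_deriv :: "(circle \<Rightarrow> circle) \<Rightarrow> circle \<Rightarrow> real" where
  "log_deriv f p = ln (circle_deriv f p)"

definition C1bv_diffeo :: "(circle \<Rightarrow> circle) \<Rightarrow> bool" where
  "C1bv_diffeo f \<longleftrightarrow> circle_C1_diffeo f \<and> circle_var (log_deriv f) < \<infinity>"

definition C1bv_tendsto_rotation ::
    "('a \<Rightarrow> circle \<Rightarrow> circle) \<Rightarrow> circle \<Rightarrow> 'a filter \<Rightarrow> bool" where
  "C1bv_tendsto_rotation f \<rho> T \<longleftrightarrow>
    uniform_limit UNIV f (rotation \<rho>) T \<and>
    uniform_limit UNIV (\<lambda>t. circle_deriv (f t)) (\<lambda>_. 1) T \<and>
    ((\<lambda>t. circle_var (log_deriv (f t))) \<longlongrightarrow> 0) T"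

definition C1bv_tendsto ::
    "('a \<Rightarrow> circle \<Rightarrow> circle) \<Rightarrow> (circle \<Rightarrow> circle) \<Rightarrow> 'a filter \<Rightarrow> bool" where
  "C1bv_tendsto f g T \<longleftrightarrow>
    uniform_limit UNIV f g T \<and>
    uniform_limit UNIV (\<lambda>t. circle_deriv (f t)) (circle_deriv g) T \<and>
    ((\<lambda>t. circle_var (log_deriv (inv g \<circ> f t))) \<longlongrightarrow> 0) T \<and>
    ((\<lambda>t. circle_var (log_deriv (f t \<circ> inv g))) \<longlongrightarrow> 0) T"

definition C1bv_path :: "(real \<Rightarrow> circle \<Rightarrow> circle) \<Rightarrow> real set \<Rightarrow> bool" where
  "C1bv_path g S \<longleftrightarrow>
    (\<forall>t\<in>S. C1bv_diffeo (g t)) \<and> (\<forall>s\<in>S. C1bv_tendsto g (g s) (at s within S))"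


section \<open>Groups of circle diffeomorphisms\<close>

definition C1bv_group :: "(circle \<Rightarrow> circle) set \<Rightarrow> bool" where
  "C1bv_group \<Gamma> \<longleftrightarrow>
    (\<forall>f\<in>\<Gamma>. C1bv_diffeo f) \<and> id \<in> \<Gamma> \<and>
    (\<forall>f\<in>\<Gamma>. \<forall>h\<in>\<Gamma>. f \<circ> h \<in> \<Gamma>) \<and> (\<forall>f\<in>\<Gamma>. inv f \<in> \<Gamma>)"

definition acts_freely :: "(circle \<Rightarrow> circle) set \<Rightarrow> bool" where
  "acts_freely \<Gamma> \<longleftrightarrow> (\<forall>f\<in>\<Gamma>. f \<noteq> id \<longrightarrow> (\<forall>p. f p \<noteq> p))"

end

theory Submission
  imports Defs
begin

text \<open>The logarithmic derivative turns conjugation into the affine action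
  \<open>u \<mapsto> u \<circ> f + log Df\<close> of \<open>\<Gamma>\<close> on functions modulo constants, which is isometric for the total
  variation: conjugating by \<open>g\<close> with \<open>log Dg = u\<close> yields a diffeomorphism whose logarithmic derivative
  has variation \<open>var (u \<circ> f + log Df - u)\<close>. So one needs a path of almost fixed points.
  Averaging \<open>log D(f\<^sup>i)\<close> over \<open>0 \<le> i < n\<close> makes \<open>u\<close> almost fixed by \<open>f\<close> as soon as
  \<open>var (log Df\<^sup>n) / n\<close> tends to zero, and, \<open>\<Gamma>\<close> being Abelian, it does not spoil the almost invariance
  already achieved under other elements; interpolating linearly between countably many such averages
  gives the path.

  By freeness, an element \<open>f\<close> is either of finite order or without periodic points. In the latter
  case the absolutely continuous function \<open>log Df\<close> is approximated in variation by \<open>C\<^sup>1\<close> functions,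
  and \<open>var (log Df\<^sup>n) / n \<rightarrow> 0\<close> becomes the statement that the averages \<open>n\<^sup>-\<^sup>1 \<Sum>\<^sub>i (\<psi> \<circ> f\<^sup>i) \<cdot> Df\<^sup>i\<close> of a
  continuous density \<open>\<psi>\<close> of mean zero tend to zero in \<open>L\<^sup>1\<close>. This holds because modulo coboundaries
  \<open>\<psi>\<close> is equivalent to a density of norm at most \<open>(1 - c) \<parallel>\<psi>\<parallel>\<close>: the images of one closest-return
  arc cover the circle with bounded multiplicity, bounded distortion and (by Denjoy's argument) small
  length, so fixed fractions of the positive and of the negative part of \<open>\<psi>\<close> can be transported
  onto this single arc, where they cancel.\<close>

section \<open>Total variation\<close>

text \<open>By duality, the convergence of the averages of mean-zero densities in L^1 expresses
  ergodicity: the L^1 closure of the coboundaries consists of the densities annihilated by all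
  invariant bounded functions. Lebesgue measure is only quasi-invariant under \<open>f\<close>, so
  Denjoy's bounded distortion must stand in for invariance. The contraction factor depends on the
  variation V of log Df alone; it can therefore be applied again to each average. A second obstacle
  is that composition with diffeomorphisms near the identity is not continuous in variation for
  general functions of bounded variation, whereas it is for C^1 functions. Hence C^1 approximation
  occurs twice: for log Df, to turn variation into an L^1 norm, and for the almost fixed points,
  before they are integrated to diffeomorphisms. The approximation of absolutely continuous
  functions works with difference quotients only: on a grid where a bounded convex energy of the
  slopes is nearly maximal, refinement raises the energy little, and this forces the finer slopes to
  stay close to the coarse ones.\<close>

lemma total_variation_upper:
  assumes "a \<le> x 0" "x n \<le> b" "\<And>i. i < n \<Longrightarrow> x i \<le> x (Suc i)"
  shows "(\<Sum>i<n. ennreal \<bar>h (x (Suc i)) - h (x i)\<bar>) \<le> total_variation h a b"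
  unfolding total_variation_def
  by (rule SUP_upper2[of "(n, x)"]) (use assms in auto)

lemma total_variation_leI:
  assumes "\<And>(n::nat) (x::nat \<Rightarrow> real). a \<le> x 0 \<Longrightarrow> x n \<le> b \<Longrightarrow> (\<And>i. i < n \<Longrightarrow> x i \<le> x (Suc i)) \<Longrightarrow>
    (\<Sum>i<n. ennreal \<bar>h (x (Suc i)) - h (x i)\<bar>) \<le> B"
  shows "total_variation h a b \<le> B"
  unfolding total_variation_def by (rule SUP_least) (use assms in auto)

lemma total_variation_leI_real:
  assumes "\<And>(n::nat) (x::nat \<Rightarrow> real). a \<le> x 0 \<Longrightarrow> x n \<le> b \<Longrightarrow> (\<And>i. i < n \<Longrightarrow> x i \<le> x (Suc i)) \<Longrightarrow>
    (\<Sum>i<n. \<bar>h (x (Suc i)) - h (x i)\<bar>) \<le> B"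
  shows "total_variation h a b \<le> ennreal B"
  by (rule total_variation_leI) (subst sum_ennreal, auto intro!: ennreal_leI assms)

lemma monotone_chain:
  fixes x :: "nat \<Rightarrow> real"
  assumes "\<And>i. i < n \<Longrightarrow> x i \<le> x (Suc i)" "i \<le> j" "j \<le> n"
  shows "x i \<le> x j"
  using assms(2,3)
proof (induction j)
  case (Suc j)
  then show ?case using assms(1)[of j] by (cases "i = Suc j") force+
qed simp

lemma total_variation_add:
  "total_variation (\<lambda>x. h x + k x) a b \<le> total_variation h a b + total_variation k a b"
proof (rule total_variation_leI)
  fix n :: nat and x :: "nat \<Rightarrow> real"
  assume x: "a \<le> x 0" "x n \<le> b" "\<And>i. i < n \<Longrightarrow> x i \<le> x (Suc i)"
  have "(\<Sum>i<n. ennreal \<bar>h (x (Suc i)) + k (x (Suc i)) - (h (x i) + k (x i))\<bar>)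
    \<le> (\<Sum>i<n. ennreal \<bar>h (x (Suc i)) - h (x i)\<bar> + ennreal \<bar>k (x (Suc i)) - k (x i)\<bar>)"
    by (intro sum_mono) (auto simp: ennreal_plus[symmetric] simp del: ennreal_plus intro!: ennreal_leI)
  also have "\<dots> \<le> total_variation h a b + total_variation k a b"
    unfolding sum.distrib by (intro add_mono total_variation_upper x)
  finally show "(\<Sum>i<n. ennreal \<bar>h (x (Suc i)) + k (x (Suc i)) - (h (x i) + k (x i))\<bar>)
    \<le> total_variation h a b + total_variation k a b" .
qed

lemma total_variation_zero [simp]: "total_variation (\<lambda>x. c) a b = 0"
  using total_variation_leI[of a b "\<lambda>x. c" 0] by simp

lemma total_variation_sum:
  "finite I \<Longrightarrow> total_variation (\<lambda>x. \<Sum>i\<in>I. h i x) a b \<le> (\<Sum>i\<in>I. total_variation (h i) a b)"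
  by (induction I rule: finite_induct) (auto intro: order.trans[OF total_variation_add] add_mono)

lemma total_variation_scale:
  "total_variation (\<lambda>x. c * h x) a b \<le> ennreal \<bar>c\<bar> * total_variation h a b"
proof (rule total_variation_leI)
  fix n :: nat and x :: "nat \<Rightarrow> real"
  assume x: "a \<le> x 0" "x n \<le> b" "\<And>i. i < n \<Longrightarrow> x i \<le> x (Suc i)"
  have "(\<Sum>i<n. ennreal \<bar>c * h (x (Suc i)) - c * h (x i)\<bar>)
     = ennreal \<bar>c\<bar> * (\<Sum>i<n. ennreal \<bar>h (x (Suc i)) - h (x i)\<bar>)"
    unfolding sum_distrib_left
    by (intro sum.cong) (auto simp: ennreal_mult[symmetric] abs_mult[symmetric] algebra_simps)
  also have "\<dots> \<le> ennreal \<bar>c\<bar> * total_variation h a b"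
    by (intro mult_left_mono total_variation_upper x) auto
  finally show "(\<Sum>i<n. ennreal \<bar>c * h (x (Suc i)) - c * h (x i)\<bar>) \<le> ennreal \<bar>c\<bar> * total_variation h a b" .
qed

lemma total_variation_minus [simp]:
  "total_variation (\<lambda>x. - h x) a b = total_variation h a b"
  by (simp add: total_variation_def abs_minus_commute)

lemma total_variation_add_const [simp]:
  "total_variation (\<lambda>x. h x + c) a b = total_variation h a b"
  by (simp add: total_variation_def)

lemma total_variation_diff_const [simp]:
  "total_variation (\<lambda>x. h x - c) a b = total_variation h a b"
  by (simp add: total_variation_def)

lemma total_variation_const_add [simp]:
  "total_variation (\<lambda>x. c + h x) a b = total_variation h a b"
  by (simp add: total_variation_def)

lemma total_variation_diff:
  "total_variation (\<lambda>x. h x - k x) a b \<le> total_variation h a b + total_variation k a b"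
  using total_variation_add[of h "\<lambda>x. - k x" a b] by simp

lemma total_variation_comp:
  assumes "mono F"
  shows "total_variation (\<lambda>x. h (F x)) a b \<le> total_variation h (F a) (F b)"
proof (rule total_variation_leI)
  fix n :: nat and x :: "nat \<Rightarrow> real"
  assume x: "a \<le> x 0" "x n \<le> b" "\<And>i. i < n \<Longrightarrow> x i \<le> x (Suc i)"
  show "(\<Sum>i<n. ennreal \<bar>h (F (x (Suc i))) - h (F (x i))\<bar>) \<le> total_variation h (F a) (F b)"
    by (rule total_variation_upper[where x = "\<lambda>i. F (x i)"]) (use x assms in \<open>auto simp: mono_def\<close>)
qed

lemma total_variation_concat_le:
  assumes "a \<le> b" "b \<le> c"
  shows "total_variation h a c \<le> total_variation h a b + total_variation h b c"
proof (rule total_variation_leI)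
  fix n :: nat and x :: "nat \<Rightarrow> real"
  assume x: "a \<le> x 0" "x n \<le> c" "\<And>i. i < n \<Longrightarrow> x i \<le> x (Suc i)"
  \<comment> \<open>Cutting the chain at \<open>b\<close> yields chains in \<open>[a, b]\<close> and
    \<open>[b, c]\<close>; a step that straddles \<open>b\<close> is split there by the triangle
    inequality.\<close>
  define y where "y i = min (x i) b" for i
  define z where "z i = max (x i) b" for i
  have "\<bar>h (x (Suc i)) - h (x i)\<bar> \<le> \<bar>h (y (Suc i)) - h (y i)\<bar> + \<bar>h (z (Suc i)) - h (z i)\<bar>"
    if "i < n" for i
    using x(3)[OF that] by (auto simp: y_def z_def min_def max_def)
  then have "(\<Sum>i<n. ennreal \<bar>h (x (Suc i)) - h (x i)\<bar>)
      \<le> (\<Sum>i<n. ennreal \<bar>h (y (Suc i)) - h (y i)\<bar> + ennreal \<bar>h (z (Suc i)) - h (z i)\<bar>)"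
    by (intro sum_mono) (auto simp: ennreal_plus[symmetric] simp del: ennreal_plus intro!: ennreal_leI)
  also have "\<dots> \<le> total_variation h a b + total_variation h b c"
    unfolding sum.distrib
  proof (intro add_mono total_variation_upper)
    show "y i \<le> y (Suc i)" "z i \<le> z (Suc i)" if "i < n" for i
      using x(3)[OF that] by (auto simp: y_def z_def)
  qed (use x assms in \<open>auto simp: y_def z_def\<close>)
  finally show "(\<Sum>i<n. ennreal \<bar>h (x (Suc i)) - h (x i)\<bar>)
      \<le> total_variation h a b + total_variation h b c" .
qed

lemma total_variation_superadd:
  assumes "a \<le> b" "b \<le> c"
  shows "total_variation h a b + total_variation h b c \<le> total_variation h a c"
proof -
  let ?A = "\<lambda>a b. {(n :: nat, x :: nat \<Rightarrow> real). a \<le> x 0 \<and> x n \<le> b \<and> (\<forall>i<n. x i \<le> x (Suc i))}"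
  let ?s = "\<lambda>(n, x). \<Sum>i<n. ennreal \<bar>h (x (Suc i)) - h (x i)\<bar>"
  have pair: "?s (n, y) + ?s (m, z) \<le> total_variation h a c"
    if "(n, y) \<in> ?A a b" "(m, z) \<in> ?A b c" for n y m z
  proof -
    have y: "a \<le> y 0" "y n \<le> b" "\<forall>i<n. y i \<le> y (Suc i)"
      and z: "b \<le> z 0" "z m \<le> c" "\<forall>i<m. z i \<le> z (Suc i)"
      using that by auto
    \<comment> \<open>Concatenation of both chains. The additional step at index \<open>n\<close>,
      from \<open>y n\<close> to \<open>z 0\<close>, is monotone because \<open>b\<close> separates
      the two, and its increment is discarded.\<close>
    define w where "w i = (if i \<le> n then y i else z (i - Suc n))" for i
    have "(\<Sum>i<n. ennreal \<bar>h (y (Suc i)) - h (y i)\<bar>) + (\<Sum>i<m. ennreal \<bar>h (z (Suc i)) - h (z i)\<bar>)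
      \<le> (\<Sum>i<n. ennreal \<bar>h (w (Suc i)) - h (w i)\<bar>) + (\<Sum>i<m. ennreal \<bar>h (w (Suc (Suc n + i))) - h (w (Suc n + i))\<bar>)"
      by (auto simp: w_def intro!: add_mono)
    also have "(\<Sum>i<m. ennreal \<bar>h (w (Suc (Suc n + i))) - h (w (Suc n + i))\<bar>)
       = (\<Sum>i\<in>{Suc n..<Suc n + m}. ennreal \<bar>h (w (Suc i)) - h (w i)\<bar>)"
      by (rule sum.reindex_bij_witness[of _ "\<lambda>i. i - Suc n" "\<lambda>i. Suc n + i"]) auto
    also have "(\<Sum>i<n. ennreal \<bar>h (w (Suc i)) - h (w i)\<bar>) + \<dots>
       = (\<Sum>i\<in>{..<n} \<union> {Suc n..<Suc n + m}. ennreal \<bar>h (w (Suc i)) - h (w i)\<bar>)"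
      by (rule sum.union_disjoint[symmetric]) auto
    also have "\<dots> \<le> (\<Sum>i<Suc n + m. ennreal \<bar>h (w (Suc i)) - h (w i)\<bar>)"
      by (rule sum_mono2) auto
    also have "\<dots> \<le> total_variation h a c"
    proof (rule total_variation_upper)
      show "w i \<le> w (Suc i)" if "i < Suc n + m" for i
      proof -
        consider "i < n" | "i = n" | "i > n" by linarith
        then show ?thesis
        proof cases
          case 3
          then obtain j where "i = Suc n + j" by (metis add_Suc less_imp_Suc_add)
          then show ?thesis using that z by (auto simp: w_def)
        qed (use y z assms in \<open>auto simp: w_def\<close>)
      qed
    qed (use y z in \<open>auto simp: w_def\<close>)
    finally show ?thesis by (simp only: prod.case)
  qed
  have ne: "?A u v \<noteq> {}" if "u \<le> v" for u v
    using that by (auto intro!: exI[of _ "\<lambda>_. u"])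
  have "(SUP p\<in>?A a b. ?s p) + ?s q \<le> total_variation h a c" if "q \<in> ?A b c" for q
    unfolding ennreal_SUP_add_left[OF ne[OF assms(1)], symmetric]
    by (rule SUP_least) (use pair that in blast)
  then show ?thesis
    unfolding total_variation_def[of h a b] total_variation_def[of h b c]
    unfolding ennreal_SUP_add_right[OF ne[OF assms(2)]]
    by (intro SUP_least)
qed

lemma total_variation_concat:
  assumes "a \<le> b" "b \<le> c"
  shows "total_variation h a c = total_variation h a b + total_variation h b c"
  by (intro antisym total_variation_concat_le total_variation_superadd assms)

section \<open>Variation over one period\<close>

lemma total_variation_shift:
  assumes "\<And>x. h (x + c) = h x"
  shows "total_variation h (a + c) (b + c) = total_variation h a b"
proof (rule antisym)
  have 1: "(\<lambda>x. h (x + c)) = h" "(\<lambda>x. h (x - c)) = h"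
    using assms by (auto simp: fun_eq_iff) (metis diff_add_cancel)
  show "total_variation h a b \<le> total_variation h (a + c) (b + c)"
    using total_variation_comp[of "\<lambda>x. x + c" h a b] 1 by (simp add: mono_def)
  show "total_variation h (a + c) (b + c) \<le> total_variation h a b"
    using total_variation_comp[of "\<lambda>x. x - c" h "a + c" "b + c"] 1 by (simp add: mono_def)
qed

lemma periodic_int:
  assumes "\<And>x :: real. h (x + 1) = h x"
  shows "h (x + of_int k) = h x"
proof (induction k rule: int_induct[of _ 0])
  case (step1 i) then show ?case using assms[of "x + of_int i"] by (simp add: algebra_simps)
next
  case (step2 i) then show ?case using assms[of "x + of_int (i - 1)"] by (simp add: algebra_simps)
qed simp

text \<open>An integer shift brings \<open>a\<close> into \<open>[0, 1)\<close>; cutting at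
  \<open>1\<close> and moving the part beyond \<open>1\<close> back by one period reassembles
  \<open>[0, 1]\<close>.\<close>

lemma total_variation_period:
  assumes per: "\<And>x. h (x + 1) = h x"
  shows "total_variation h a (a + 1) = total_variation h 0 1"
proof -
  define b where "b = frac a"
  have b: "0 \<le> b" "b < 1" "a = b + of_int \<lfloor>a\<rfloor>" by (auto simp: b_def frac_lt_1) (simp add: frac_def)
  have "total_variation h a (a + 1) = total_variation h (b + of_int \<lfloor>a\<rfloor>) ((b + 1) + of_int \<lfloor>a\<rfloor>)"
    using b(3) by (metis add.assoc add.commute)
  also have "\<dots> = total_variation h b (b + 1)"
    by (rule total_variation_shift) (rule periodic_int[where h = h, OF per])
  also have "\<dots> = total_variation h b 1 + total_variation h (0 + 1) (b + 1)"
    using b by (subst total_variation_concat[of _ 1]) auto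
  also have "\<dots> = total_variation h b 1 + total_variation h 0 b"
    by (subst total_variation_shift[where h = h and c = 1, OF per]) simp
  also have "\<dots> = total_variation h 0 1"
    using b by (subst total_variation_concat[of 0 b 1]) (auto simp: add.commute)
  finally show ?thesis .
qed

lemma total_variation_C1:
  assumes "\<And>x. (h has_real_derivative h' x) (at x)" "continuous_on UNIV h'" "a \<le> b"
  shows "total_variation h a b \<le> ennreal (integral {a..b} (\<lambda>x. \<bar>h' x\<bar>))"
proof (rule total_variation_leI_real)
  fix n :: nat and x :: "nat \<Rightarrow> real"
  assume x: "a \<le> x 0" "x n \<le> b" "\<And>i. i < n \<Longrightarrow> x i \<le> x (Suc i)"
  have int: "(\<lambda>x. \<bar>h' x\<bar>) integrable_on {u..v}" "h' integrable_on {u..v}" for u v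
    using assms(2) by (auto intro!: integrable_continuous_interval continuous_intros continuous_on_subset[OF assms(2)])
  have step: "\<bar>h v - h u\<bar> \<le> integral {u..v} (\<lambda>x. \<bar>h' x\<bar>)" if "u \<le> v" for u v
  proof -
    have "(h' has_integral h v - h u) {u..v}"
      by (rule fundamental_theorem_of_calculus[OF that])
        (metis assms(1) has_field_derivative_at_within has_real_derivative_iff_has_vector_derivative)
    then have "h v - h u = integral {u..v} h'" by (simp add: integral_unique)
    also have "\<bar>\<dots>\<bar> \<le> integral {u..v} (\<lambda>x. \<bar>h' x\<bar>)"
      using integral_norm_bound_integral[OF int(2) int(1), of u v] by auto
    finally show ?thesis .
  qed
  have "(\<Sum>i<m. \<bar>h (x (Suc i)) - h (x i)\<bar>) \<le> integral {x 0..x m} (\<lambda>x. \<bar>h' x\<bar>)" if "m \<le> n" for m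
    using that
  proof (induction m)
    case (Suc m)
    have "x 0 \<le> x m" using monotone_chain[where x = x and n = n and i = 0 and j = m, OF x(3)] Suc by auto
    then have "integral {x 0..x (Suc m)} (\<lambda>x. \<bar>h' x\<bar>)
      = integral {x 0..x m} (\<lambda>x. \<bar>h' x\<bar>) + integral {x m..x (Suc m)} (\<lambda>x. \<bar>h' x\<bar>)"
      using x(3)[of m] Suc by (subst Henstock_Kurzweil_Integration.integral_combine[OF _ _ int(1)]) auto
    then show ?case using Suc step[OF x(3)[of m]] by auto
  qed auto
  then have "(\<Sum>i<n. \<bar>h (x (Suc i)) - h (x i)\<bar>) \<le> integral {x 0..x n} (\<lambda>x. \<bar>h' x\<bar>)" by simp
  also have "\<dots> \<le> integral {a..b} (\<lambda>x. \<bar>h' x\<bar>)"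
    by (rule integral_subset_le) (use x int in auto)
  finally show "(\<Sum>i<n. \<bar>h (x (Suc i)) - h (x i)\<bar>) \<le> integral {a..b} (\<lambda>x. \<bar>h' x\<bar>)" .
qed

text \<open>Induction that removes the interval with the largest left endpoint \<open>u m\<close>.
  Since it is nondegenerate, every other interval ends at or before \<open>u m\<close>, and the
  variation splits there.\<close>

lemma sum_disjoint_intervals_le_total_variation:
  assumes "finite J" "\<And>j. j \<in> J \<Longrightarrow> a \<le> u j \<and> u j < v j \<and> v j \<le> b"
    "\<And>i j. i \<in> J \<Longrightarrow> j \<in> J \<Longrightarrow> i \<noteq> j \<Longrightarrow> v i \<le> u j \<or> v j \<le> u i"
  shows "(\<Sum>j\<in>J. ennreal \<bar>h (v j) - h (u j)\<bar>) \<le> total_variation h a (b :: real)"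
  using assms
proof (induction "card J" arbitrary: J b)
  case (Suc n)
  have ne: "J \<noteq> {}" using Suc(2) by auto
  have "Max (u ` J) \<in> u ` J" using ne Suc(3) by (intro Max_in) auto
  then obtain m where "m \<in> J" "u m = Max (u ` J)" by auto
  then have m: "m \<in> J" "\<And>j. j \<in> J \<Longrightarrow> u j \<le> u m" using Suc(3) by auto
  have "(\<Sum>j\<in>J - {m}. ennreal \<bar>h (v j) - h (u j)\<bar>) \<le> total_variation h a (u m)"
  proof (rule Suc(1))
    show "n = card (J - {m})" using Suc(2,3) m(1) by simp
    show "a \<le> u j \<and> u j < v j \<and> v j \<le> u m" if "j \<in> J - {m}" for j
      using Suc(4)[of j] Suc(5)[of j m] m that Suc(4)[of m] by fastforce
  qed (use Suc in auto)
  moreover have "ennreal \<bar>h (v m) - h (u m)\<bar> \<le> total_variation h (u m) b"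
    using total_variation_upper[of "u m" "\<lambda>i. if i = 0 then u m else v m" 1 b h] Suc(4)[OF m(1)] by auto
  ultimately have "(\<Sum>j\<in>J. ennreal \<bar>h (v j) - h (u j)\<bar>) \<le> total_variation h a (u m) + total_variation h (u m) b"
    unfolding sum.remove[OF Suc(3) m(1)] by (subst add.commute) (rule add_mono)
  also have "\<dots> \<le> total_variation h a b"
    by (rule total_variation_superadd) (use Suc(4)[OF m(1)] in auto)
  finally show ?case .
qed simp

text \<open>The hypothesis says that the intervals \<open>[u j, v j]\<close> have disjoint interiors on the circle;
  translating each of them so that it starts in \<open>[0, 1)\<close> makes them disjoint in \<open>[0, 2]\<close>.\<close>

lemma sum_disjoint_arcs_le:
  fixes h :: "real \<Rightarrow> real" and u v :: "'i \<Rightarrow> real"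
  assumes inc: "\<And>x y. \<bar>h (x + 1) - h (y + 1)\<bar> = \<bar>h x - h y\<bar>"
  assumes fin: "finite J" and uv: "\<And>j. j \<in> J \<Longrightarrow> u j \<le> v j \<and> v j \<le> u j + 1"
    and disj: "\<And>i j k. i \<in> J \<Longrightarrow> j \<in> J \<Longrightarrow> i \<noteq> j \<Longrightarrow> v i + of_int k \<le> u j \<or> v j \<le> u i + of_int k"
  shows "(\<Sum>j\<in>J. ennreal \<bar>h (v j) - h (u j)\<bar>) \<le> total_variation h 0 2"
proof -
  \<comment> \<open>Only increments are assumed invariant, so that the estimate covers periodic
    functions as well as the identity, whose increments are lengths.\<close>
  have inck: "\<bar>h (x + of_int k) - h (y + of_int k)\<bar> = \<bar>h x - h y\<bar>" for x y k
  proof (induction k rule: int_induct[of _ 0])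
    case (step1 i) then show ?case using inc[of "x + of_int i" "y + of_int i"] by (simp add: algebra_simps)
  next
    case (step2 i) then show ?case using inc[of "x + of_int (i - 1)" "y + of_int (i - 1)"] by (simp add: algebra_simps)
  qed simp
  \<comment> \<open>Degenerate intervals contribute zero; they are removed because the version on
    the line requires \<open>u j < v j\<close>.\<close>
  define J' where "J' = {j\<in>J. u j < v j}"
  define s where "s j = - \<lfloor>u j\<rfloor>" for j
  have "(\<Sum>j\<in>J. ennreal \<bar>h (v j) - h (u j)\<bar>) = (\<Sum>j\<in>J'. ennreal \<bar>h (v j) - h (u j)\<bar>)"
  proof (rule sum.mono_neutral_right)
    show "\<forall>i\<in>J - J'. ennreal \<bar>h (v i) - h (u i)\<bar> = 0"
    proof
      fix i assume "i \<in> J - J'"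
      then have "v i = u i" using uv[of i] by (auto simp: J'_def)
      then show "ennreal \<bar>h (v i) - h (u i)\<bar> = 0" by simp
    qed
  qed (use fin in \<open>auto simp: J'_def\<close>)
  also have "\<dots> = (\<Sum>j\<in>J'. ennreal \<bar>h (v j + of_int (s j)) - h (u j + of_int (s j))\<bar>)"
    by (simp only: inck)
  also have "\<dots> \<le> total_variation h 0 2"
  proof (rule sum_disjoint_intervals_le_total_variation)
    show "finite J'" using fin by (auto simp: J'_def)
    show "0 \<le> u j + of_int (s j) \<and> u j + of_int (s j) < v j + of_int (s j) \<and> v j + of_int (s j) \<le> 2" if "j \<in> J'" for j
      using uv[of j] that unfolding J'_def s_def by (auto simp: le_floor_iff) linarith
    fix i j assume "i \<in> J'" "j \<in> J'" "i \<noteq> j"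
    then show "v i + of_int (s i) \<le> u j + of_int (s j) \<or> v j + of_int (s j) \<le> u i + of_int (s i)"
      using disj[of i j "s i - s j"] by (auto simp: J'_def algebra_simps)
  qed
  finally show ?thesis .
qed

section \<open>Lifts of circle diffeomorphisms\<close>

text \<open>Lifts to the line of orientation-preserving C^1 circle diffeomorphisms. Using
  \<open>deriv F\<close> makes the derivative a function of \<open>F\<close>; its positivity and
  degree one together give invertibility.\<close>

definition diffeo_lift :: "(real \<Rightarrow> real) \<Rightarrow> bool" where
  "diffeo_lift F \<longleftrightarrow> (\<forall>x. (F has_real_derivative deriv F x) (at x)) \<and> continuous_on UNIV (deriv F) \<and>
    (\<forall>x. 0 < deriv F x) \<and> (\<forall>x. F (x + 1) = F x + 1)"

lemma diffeo_liftI: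
  assumes "\<And>x. (F has_real_derivative F' x) (at x)" "continuous_on UNIV F'" "\<And>x. 0 < F' x"
    "\<And>x. F (x + 1) = F x + 1"
  shows "diffeo_lift F" "deriv F = F'"
proof -
  show *: "deriv F = F'" using DERIV_imp_deriv[OF assms(1)] by auto
  show "diffeo_lift F" using assms unfolding diffeo_lift_def * by auto
qed

lemma diffeo_lift_id: "diffeo_lift (\<lambda>x. x)" "diffeo_lift id"
  using diffeo_liftI(1)[of "\<lambda>x. x" "\<lambda>_. 1"] by (auto simp: id_def)

context
  fixes F assumes F: "diffeo_lift F"
begin

lemma diffeo_lift_DERIV: "(F has_real_derivative deriv F x) (at x)"
  and diffeo_lift_pos: "0 < deriv F x"
  and diffeo_lift_cont_deriv: "continuous_on UNIV (deriv F)"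
  and diffeo_lift_add1: "F (x + 1) = F x + 1"
  using F by (auto simp: diffeo_lift_def)

lemma diffeo_lift_nz: "deriv F x \<noteq> 0"
  using diffeo_lift_pos[of x] by simp

lemma diffeo_lift_cont: "continuous_on UNIV F"
  by (meson DERIV_continuous_on diffeo_lift_DERIV has_field_derivative_at_within)

lemma diffeo_lift_strict_mono: "strict_mono F"
  unfolding strict_mono_def
  by (metis DERIV_pos_imp_increasing diffeo_lift_DERIV diffeo_lift_pos)

lemma diffeo_lift_less_iff [simp]: "F x < F y \<longleftrightarrow> x < y"
  and diffeo_lift_le_iff [simp]: "F x \<le> F y \<longleftrightarrow> x \<le> y"
  and diffeo_lift_eq_iff [simp]: "F x = F y \<longleftrightarrow> x = y"
  using diffeo_lift_strict_mono by (auto simp: strict_mono_less strict_mono_less_eq strict_mono_eq)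

lemma diffeo_lift_mono: "mono F"
  using diffeo_lift_strict_mono strict_mono_mono by blast

lemma diffeo_lift_deriv_add1: "deriv F (x + 1) = deriv F x"
proof -
  have "((\<lambda>x. F (x + 1)) has_real_derivative deriv F (x + 1)) (at x)"
    using diffeo_lift_DERIV[of "x + 1"] by (simp add: DERIV_shift)
  moreover have "((\<lambda>x. F (x + 1)) has_real_derivative deriv F x) (at x)"
    unfolding diffeo_lift_add1 by (auto intro!: derivative_eq_intros diffeo_lift_DERIV)
  ultimately show ?thesis by (rule DERIV_unique)
qed

lemma diffeo_lift_add_int: "F (x + of_int k) = F x + of_int k"
  using periodic_int[of "\<lambda>x. F x - x" x k] diffeo_lift_add1 by (simp add: algebra_simps)

lemma diffeo_lift_bij: "bij F"
proof (rule bijI)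
  show "inj F" by (auto simp: inj_def)
  show "surj F"
  proof -
    have "\<exists>x. F x = y" for y
    proof -
      define k where "k = \<lfloor>y - F 0\<rfloor>"
      have "F (of_int k) \<le> y" "y \<le> F (of_int k + 1)"
        using diffeo_lift_add_int[of 0 k] diffeo_lift_add1[of "of_int k"] unfolding k_def by (auto; linarith)+
      then show ?thesis
        using IVT'[of F "of_int k" y "of_int k + 1"] continuous_on_subset[OF diffeo_lift_cont] by auto
    qed
    then show ?thesis by (metis surjI someI)
  qed
qed

lemma diffeo_lift_inv_apply [simp]: "F (inv F x) = x" "inv F (F x) = x"
  using diffeo_lift_bij by (auto simp: bij_is_surj surj_f_inv_f bij_is_inj)

end

lemma diffeo_lift_inv:
  assumes F: "diffeo_lift F"
  shows "diffeo_lift (inv F)" "deriv (inv F) = (\<lambda>x. 1 / deriv F (inv F x))"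
proof -
  note [simp] = diffeo_lift_inv_apply[OF F] diffeo_lift_pos[OF F]
  have cont: "isCont (inv F) x" for x
    using isCont_inverse_function[of 1 "inv F x" "inv F" F] F diffeo_lift_cont[OF F]
    by (auto simp: continuous_on_eq_continuous_at)
  then have cont': "continuous_on UNIV (inv F)" by (simp add: continuous_at_imp_continuous_on)
  have "(inv F has_real_derivative inverse (deriv F (inv F x))) (at x)" for x
    by (rule DERIV_inverse_function[where f = F and a = "x - 1" and b = "x + 1"])
      (use diffeo_lift_DERIV[OF F] cont in \<open>auto simp: diffeo_lift_nz[OF F]\<close>)
  then have D: "(inv F has_real_derivative 1 / deriv F (inv F x)) (at x)" for x
    by (simp add: field_simps)
  have C: "continuous_on UNIV (\<lambda>x. 1 / deriv F (inv F x))"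
    by (intro continuous_intros continuous_on_compose2[OF diffeo_lift_cont_deriv[OF F] cont'])
      (auto simp: diffeo_lift_nz[OF F])
  have A: "inv F (x + 1) = inv F x + 1" for x
    by (subst diffeo_lift_eq_iff[OF F, symmetric]) (simp add: diffeo_lift_add1[OF F])
  show "diffeo_lift (inv F)" "deriv (inv F) = (\<lambda>x. 1 / deriv F (inv F x))"
    using diffeo_liftI[of "inv F", OF D C _ A] by auto
qed

lemma diffeo_lift_comp:
  assumes F: "diffeo_lift F" and G: "diffeo_lift G"
  shows "diffeo_lift (\<lambda>x. F (G x))" "deriv (\<lambda>x. F (G x)) = (\<lambda>x. deriv F (G x) * deriv G x)"
proof -
  have D: "((\<lambda>x. F (G x)) has_real_derivative deriv F (G x) * deriv G x) (at x)" for x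
    by (rule DERIV_chain2[OF diffeo_lift_DERIV[OF F] diffeo_lift_DERIV[OF G]])
  have C: "continuous_on UNIV (\<lambda>x. deriv F (G x) * deriv G x)"
    by (intro continuous_intros diffeo_lift_cont_deriv[OF G]
        continuous_on_compose2[OF diffeo_lift_cont_deriv[OF F] diffeo_lift_cont[OF G]]) auto
  show "diffeo_lift (\<lambda>x. F (G x))" "deriv (\<lambda>x. F (G x)) = (\<lambda>x. deriv F (G x) * deriv G x)"
    using diffeo_liftI[OF D C] diffeo_lift_pos[OF F] diffeo_lift_pos[OF G]
    by (auto simp: diffeo_lift_add1[OF F] diffeo_lift_add1[OF G])
qed

lemma diffeo_lift_funpow: "diffeo_lift F \<Longrightarrow> diffeo_lift (F ^^ n)"
  by (induction n) (auto simp: diffeo_lift_id o_def intro: diffeo_lift_comp)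

lemma diffeo_lift_add_const:
  assumes F: "diffeo_lift F"
  shows "diffeo_lift (\<lambda>x. F x + c)" "deriv (\<lambda>x. F x + c) = deriv F"
proof -
  have D: "((\<lambda>x. F x + c) has_real_derivative deriv F x) (at x)" for x
    using diffeo_lift_DERIV[OF F] by (auto intro!: derivative_eq_intros)
  show "diffeo_lift (\<lambda>x. F x + c)" "deriv (\<lambda>x. F x + c) = deriv F"
    using diffeo_liftI[of "\<lambda>x. F x + c", OF D diffeo_lift_cont_deriv[OF F] diffeo_lift_pos[OF F]]
    by (simp_all add: diffeo_lift_add1[OF F])
qed

lemma deriv_funpow_Suc:
  assumes F: "diffeo_lift F"
  shows "deriv (F ^^ Suc n) x = deriv F ((F ^^ n) x) * deriv (F ^^ n) x"
    "deriv (F ^^ Suc n) x = deriv (F ^^ n) (F x) * deriv F x"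
  using fun_cong[OF diffeo_lift_comp(2)[OF F diffeo_lift_funpow[OF F, of n]], of x]
    fun_cong[OF diffeo_lift_comp(2)[OF diffeo_lift_funpow[OF F, of n] F], of x]
  by (simp_all add: o_def funpow_swap1[symmetric] funpow_Suc_right del: funpow.simps)

lemma deriv_funpow_add:
  assumes F: "diffeo_lift F"
  shows "deriv (F ^^ (m + n)) x = deriv (F ^^ m) ((F ^^ n) x) * deriv (F ^^ n) x"
  using fun_cong[OF diffeo_lift_comp(2)[OF diffeo_lift_funpow[OF F, of m] diffeo_lift_funpow[OF F, of n]], of x]
  by (simp add: funpow_add o_def)

lemma ln_deriv_funpow:
  assumes F: "diffeo_lift F"
  shows "ln (deriv (F ^^ n) x) = (\<Sum>i<n. ln (deriv F ((F ^^ i) x)))"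
proof (induction n)
  case 0
  then show ?case by (simp add: id_def)
next
  case (Suc n)
  then show ?case
    using diffeo_lift_nz[OF F] diffeo_lift_nz[OF diffeo_lift_funpow[OF F, of n]]
    by (simp only: deriv_funpow_Suc(1)[OF F]) (simp add: ln_mult)
qed

text \<open>A monotone map of degree one sends \<open>[k, k + 1]\<close> onto
  \<open>[F 0 + k, F 0 + k + 1]\<close>. Applied to iterates, the bound is uniform in the number of
  iterations.\<close>

lemma diffeo_lift_dist_le:
  assumes F: "diffeo_lift F"
  shows "\<bar>F x - x - F 0\<bar> \<le> 1"
proof -
  have "F (of_int \<lfloor>x\<rfloor>) \<le> F x" "F x \<le> F (of_int \<lfloor>x\<rfloor> + 1)"
    using F by auto
  then show ?thesis
    using diffeo_lift_add_int[OF F, of 0 "\<lfloor>x\<rfloor>"] diffeo_lift_add1[OF F, of "of_int \<lfloor>x\<rfloor>"]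
    by simp linarith
qed

section \<open>Translation numbers\<close>

definition translation_number :: "(real \<Rightarrow> real) \<Rightarrow> real" where
  "translation_number F = lim (\<lambda>n. (F ^^ n) 0 / real n)"

text \<open>The orbit of \<open>0\<close> is additive up to an error of one per step, so
  \<open>a (n * m)\<close> and \<open>real n * a m\<close> differ by at most \<open>n\<close>.
  Comparing the quotients at \<open>m\<close> and \<open>n\<close> with the one at
  \<open>n * m\<close> gives a Cauchy sequence.\<close>

lemma tendsto_translation_number_0:
  assumes F: "diffeo_lift F"
  shows "(\<lambda>n. (F ^^ n) 0 / real n) \<longlonglongrightarrow> translation_number F"
proof -
  define a where "a n = (F ^^ n) 0" for n
  have near: "\<bar>(F ^^ n) x - x - a n\<bar> \<le> 1" for n x
    using diffeo_lift_dist_le[OF diffeo_lift_funpow[OF F, of n], of x] by (simp add: a_def)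
  have mult: "\<bar>a (n * m) - real n * a m\<bar> \<le> real n" for n m
  proof (induction n)
    case (Suc n)
    have "a (Suc n * m) = (F ^^ m) (a (n * m))" by (simp add: a_def funpow_add)
    then show ?case using Suc near[of m "a (n * m)"] by (simp add: algebra_simps abs_le_iff)
  qed (simp add: a_def)
  have div: "\<bar>a (n * m) / real (n * m) - a m / real m\<bar> \<le> 1 / real m" if "n > 0" "m > 0" for n m
  proof -
    have "a (n * m) / real (n * m) - a m / real m = (a (n * m) - real n * a m) / real (n * m)"
      using that by (simp add: field_simps)
    also have "\<bar>\<dots>\<bar> \<le> real n / real (n * m)"
      unfolding abs_divide using mult[of n m] that by (intro frac_le) auto
    finally show ?thesis using that by simp
  qed
  have pair: "\<bar>a m / real m - a n / real n\<bar> \<le> 1 / real m + 1 / real n" if "n > 0" "m > 0" for n m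
    using div[of n m] div[of m n] that by (simp add: mult.commute abs_le_iff)
  have "Cauchy (\<lambda>n. a n / real n)"
  proof (rule metric_CauchyI)
    fix e :: real assume e: "e > 0"
    obtain M :: nat where M: "2 / e < real M" using reals_Archimedean2 by blast
    then have M0: "real M > 0" using e by (meson divide_pos_pos less_trans zero_less_numeral)
    have *: "1 / real m < e / 2" if "m \<ge> M" for m
      using M M0 e that by (simp add: field_simps) (smt (verit) mult_left_mono of_nat_mono)
    have "dist (a m / real m) (a n / real n) < e" if "m \<ge> M" "n \<ge> M" for m n
      using pair[of n m] *[OF that(1)] *[OF that(2)] M0 that by (auto simp: dist_real_def)
    then show "\<exists>M. \<forall>m\<ge>M. \<forall>n\<ge>M. dist (a m / real m) (a n / real n) < e" by blast
  qed
  then show ?thesis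
    unfolding translation_number_def a_def[symmetric] by (simp add: Cauchy_convergent_iff convergent_LIMSEQ_iff)
qed

text \<open>Bounded perturbations of the orbit disappear after division by \<open>n\<close>; this
  yields independence of the starting point and the behaviour under inversion and
  conjugation.\<close>

lemma tendsto_translation_numberI:
  assumes F: "diffeo_lift F" and "\<And>n. \<bar>s n - (F ^^ n) 0\<bar> \<le> C"
  shows "(\<lambda>n. s n / real n) \<longlonglongrightarrow> translation_number F"
proof -
  have "(\<lambda>n. (s n - (F ^^ n) 0) / real n) \<longlonglongrightarrow> 0"
  proof (rule tendsto_rabs_zero_cancel, rule tendsto_sandwich[of "\<lambda>_. 0" _ _ "\<lambda>n. C / real n"])
    show "(\<lambda>n. C / real n) \<longlonglongrightarrow> 0" by (rule lim_const_over_n)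
  qed (use assms(2) in \<open>auto simp: divide_right_mono\<close>)
  from tendsto_add[OF this tendsto_translation_number_0[OF F]] show ?thesis
    by (simp add: diff_divide_distrib)
qed

lemma tendsto_translation_number:
  assumes F: "diffeo_lift F"
  shows "(\<lambda>n. (F ^^ n) x / real n) \<longlonglongrightarrow> translation_number F"
proof (rule tendsto_translation_numberI[OF F])
  show "\<bar>(F ^^ n) x - (F ^^ n) 0\<bar> \<le> 1 + \<bar>x\<bar>" for n
    using diffeo_lift_dist_le[OF diffeo_lift_funpow[OF F, of n], of x] by linarith
qed

lemma translation_number_unique:
  "(\<lambda>n. (F ^^ n) 0 / real n) \<longlonglongrightarrow> t \<Longrightarrow> translation_number F = t"
  unfolding translation_number_def by (rule limI)

lemma translation_number_ge:
  assumes F: "diffeo_lift F" and q: "\<And>n. y + real n * c \<le> (F ^^ (n * q)) y"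
  shows "c \<le> real q * translation_number F"
proof (cases "q = 0")
  case True
  then have "real n * c \<le> 0" for n using q[of n] by simp
  from this[of 1] True show ?thesis by simp
next
  case False
  have "(\<lambda>n. (F ^^ (n * q)) y / real (n * q)) \<longlonglongrightarrow> translation_number F"
    using LIMSEQ_subseq_LIMSEQ[OF tendsto_translation_number[OF F, of y], of "\<lambda>n. n * q"] False
    by (simp add: strict_mono_def o_def)
  then have lim: "(\<lambda>n. real q * ((F ^^ (n * q)) y / real (n * q))) \<longlonglongrightarrow> real q * translation_number F"
    by (rule tendsto_mult_left)
  have "(\<lambda>n. y / real n + c) \<longlonglongrightarrow> 0 + c" by (intro tendsto_intros lim_const_over_n)
  then have "0 + c \<le> real q * translation_number F"
  proof (rule LIMSEQ_le[OF _ lim], intro exI[of _ 1] allI impI)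
    fix n :: nat assume "1 \<le> n"
    then have "y / real n + c = (y + real n * c) / real n" by (simp add: field_simps)
    also have "\<dots> \<le> (F ^^ (n * q)) y / real n" using q[of n] by (simp add: divide_right_mono)
    finally show "y / real n + c \<le> real q * ((F ^^ (n * q)) y / real (n * q))"
      using False by (simp add: mult.commute)
  qed
  then show ?thesis by simp
qed

lemma translation_number_le:
  assumes F: "diffeo_lift F" and q: "\<And>n. (F ^^ (n * q)) y \<le> y + real n * c"
  shows "real q * translation_number F \<le> c"
proof (cases "q = 0")
  case True
  then have "0 \<le> real n * c" for n using q[of n] by simp
  from this[of 1] True show ?thesis by simp
next
  case False
  have "(\<lambda>n. (F ^^ (n * q)) y / real (n * q)) \<longlonglongrightarrow> translation_number F"
    using LIMSEQ_subseq_LIMSEQ[OF tendsto_translation_number[OF F, of y], of "\<lambda>n. n * q"] False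
    by (simp add: strict_mono_def o_def)
  then have lim: "(\<lambda>n. real q * ((F ^^ (n * q)) y / real (n * q))) \<longlonglongrightarrow> real q * translation_number F"
    by (rule tendsto_mult_left)
  have "(\<lambda>n. y / real n + c) \<longlonglongrightarrow> 0 + c" by (intro tendsto_intros lim_const_over_n)
  then have "real q * translation_number F \<le> 0 + c"
  proof (rule LIMSEQ_le[OF lim], intro exI[of _ 1] allI impI)
    fix n :: nat assume "1 \<le> n"
    then have "y / real n + c = (y + real n * c) / real n" by (simp add: field_simps)
    moreover have "(F ^^ (n * q)) y / real n \<le> \<dots>" using q[of n] by (simp add: divide_right_mono)
    ultimately show "real q * ((F ^^ (n * q)) y / real (n * q)) \<le> y / real n + c"
      using False by (simp add: mult.commute)
  qed
  then show ?thesis by simp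
qed

lemma translation_number_ge_uniform:
  assumes F: "diffeo_lift F" and q: "\<And>y. y + c \<le> (F ^^ q) y"
  shows "c \<le> real q * translation_number F"
proof (rule translation_number_ge[OF F])
  show "0 + real n * c \<le> (F ^^ (n * q)) 0" for n
  proof (induction n)
    case (Suc n)
    then show ?case using q[of "(F ^^ (n * q)) 0"] by (simp add: funpow_add algebra_simps)
  qed simp
qed

lemma translation_number_le_uniform:
  assumes F: "diffeo_lift F" and q: "\<And>y. (F ^^ q) y \<le> y + c"
  shows "real q * translation_number F \<le> c"
proof (rule translation_number_le[OF F])
  show "(F ^^ (n * q)) 0 \<le> 0 + real n * c" for n
  proof (induction n)
    case (Suc n)
    then show ?case using q[of "(F ^^ (n * q)) 0"] by (simp add: funpow_add algebra_simps)
  qed simp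
qed

text \<open>If \<open>F ^^ q\<close> moved a single \<open>y\<close> by at most \<open>p\<close>,
  then monotonicity and commutation with integer translations would repeat this bound along all
  multiples of \<open>q\<close> and cap the translation number.\<close>

lemma less_translation_number:
  assumes F: "diffeo_lift F" and "of_int p < real q * translation_number F"
  shows "y + of_int p < (F ^^ q) y"
proof (rule ccontr)
  assume le: "\<not> y + of_int p < (F ^^ q) y"
  have "real q * translation_number F \<le> of_int p"
  proof (rule translation_number_le[OF F])
    show "(F ^^ (n * q)) y \<le> y + real n * of_int p" for n
    proof (induction n)
      case (Suc n)
      have "(F ^^ (Suc n * q)) y \<le> (F ^^ q) (y + of_int (int n * p))"
        using Suc by (simp add: funpow_add diffeo_lift_funpow[OF F])
      also have "\<dots> = (F ^^ q) y + of_int (int n * p)" by (rule diffeo_lift_add_int[OF diffeo_lift_funpow[OF F]])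
      finally show ?case using le by (simp add: algebra_simps)
    qed simp
  qed
  then show False using assms by simp
qed

lemma translation_number_less:
  assumes F: "diffeo_lift F" and "real q * translation_number F < of_int p"
  shows "(F ^^ q) y < y + of_int p"
proof (rule ccontr)
  assume le: "\<not> (F ^^ q) y < y + of_int p"
  have "of_int p \<le> real q * translation_number F"
  proof (rule translation_number_ge[OF F])
    show "y + real n * of_int p \<le> (F ^^ (n * q)) y" for n
    proof (induction n)
      case (Suc n)
      have "(F ^^ q) y + of_int (int n * p) = (F ^^ q) (y + of_int (int n * p))" by (rule diffeo_lift_add_int[OF diffeo_lift_funpow[OF F], symmetric])
      also have "\<dots> \<le> (F ^^ (Suc n * q)) y"
        using Suc by (simp add: funpow_add diffeo_lift_funpow[OF F])
      finally show ?case using le by (simp add: algebra_simps)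
    qed simp
  qed
  then show False using assms by simp
qed

text \<open>The displacement \<open>D\<close> of \<open>F ^^ q\<close> is continuous and periodic
  and omits \<open>p\<close>. By connectedness it stays on one side of \<open>p\<close>, by
  compactness with a positive gap, and the gap survives in the translation number.\<close>

lemma translation_number_irrational:
  assumes F: "diffeo_lift F" and q: "q > 0" and nofix: "\<And>y. (F ^^ q) y \<noteq> y + of_int p"
  shows "real q * translation_number F \<noteq> of_int p"
proof -
  define D where "D y = (F ^^ q) y - y" for y
  have cont: "continuous_on UNIV D" unfolding D_def
    by (intro continuous_intros diffeo_lift_cont diffeo_lift_funpow F)
  have per: "D (y + 1) = D y" for y
    by (simp add: D_def diffeo_lift_add1[OF diffeo_lift_funpow[OF F]])
  have red: "D y = D (frac y)" for y
    using periodic_int[of D "frac y" "\<lfloor>y\<rfloor>", OF per] by (simp add: frac_def)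
  have cont': "continuous_on S D" for S using cont continuous_on_subset by blast
  obtain a where a: "\<And>y. y \<in> {0..1} \<Longrightarrow> D a \<le> D y"
    using continuous_attains_inf[OF _ _ cont', of "{0..1}"] by fastforce
  obtain b where b: "\<And>y. y \<in> {0..1} \<Longrightarrow> D y \<le> D b"
    using continuous_attains_sup[OF _ _ cont', of "{0..1}"] by fastforce
  have a: "D a \<le> D y" and b: "D y \<le> D b" for y
    using red[of y] a[of "frac y"] b[of "frac y"] by (simp_all add: frac_lt_1 less_imp_le)
  have ne: "D y \<noteq> of_int p" for y using nofix[of y] by (auto simp: D_def)
  have "D a > of_int p \<or> D b < of_int p"
  proof (rule ccontr)
    assume "\<not> ?thesis"
    then have "D a \<le> of_int p" "of_int p \<le> D b" by auto
    moreover have "connected (range D)" by (rule connected_continuous_image[OF cont connected_UNIV])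
    ultimately have "of_int p \<in> range D" by (meson connectedD_interval rangeI)
    then show False using ne by (metis rangeE)
  qed
  moreover have "real q * translation_number F \<ge> D a"
    by (rule translation_number_ge_uniform[OF F]) (use a in \<open>auto simp: D_def algebra_simps\<close>)
  moreover have "real q * translation_number F \<le> D b"
    by (rule translation_number_le_uniform[OF F]) (use b in \<open>auto simp: D_def algebra_simps\<close>)
  ultimately show ?thesis by auto
qed

section \<open>Translation numbers of inverses and conjugates\<close>

lemma inv_funpow_cancel:
  assumes F: "diffeo_lift F"
  shows "(F ^^ n) ((inv F ^^ n) x) = x" "(inv F ^^ n) ((F ^^ n) x) = x"
  by (induction n arbitrary: x) (simp_all add: funpow_swap1 diffeo_lift_inv_apply[OF F])

lemma translation_number_inv:
  assumes F: "diffeo_lift F"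
  shows "translation_number (inv F) = - translation_number F"
proof (rule translation_number_unique)
  have "(\<lambda>n. (- (inv F ^^ n) 0) / real n) \<longlonglongrightarrow> translation_number F"
  proof (rule tendsto_translation_numberI[OF F])
    show "\<bar>- (inv F ^^ n) 0 - (F ^^ n) 0\<bar> \<le> 1" for n
      using diffeo_lift_dist_le[OF diffeo_lift_funpow[OF F, of n], of "(inv F ^^ n) 0"]
      by (simp add: inv_funpow_cancel[OF F])
  qed
  from tendsto_minus[OF this] show "(\<lambda>n. (inv F ^^ n) 0 / real n) \<longlonglongrightarrow> - translation_number F"
    by simp
qed

lemma funpow_conj:
  assumes "\<And>x. K (H x) = (x::'a)"
  shows "((\<lambda>x. H (F (K x))) ^^ n) (H y) = H ((F ^^ n) y)"
  by (induction n) (simp_all add: assms)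

lemma translation_number_conj:
  assumes F: "diffeo_lift F" and H: "diffeo_lift H"
  shows "translation_number (\<lambda>x. H (F (inv H x))) = translation_number F"
proof (rule translation_number_unique, rule tendsto_translation_numberI[OF F])
  fix n
  define z where "z = inv H 0"
  have "((\<lambda>x. H (F (inv H x))) ^^ n) 0 = H ((F ^^ n) z)"
    using funpow_conj[where K = "inv H" and H = H and F = F and n = n and y = z] by (simp add: z_def diffeo_lift_inv_apply[OF H])
  then show "\<bar>((\<lambda>x. H (F (inv H x))) ^^ n) 0 - (F ^^ n) 0\<bar> \<le> 2 + \<bar>z\<bar> + \<bar>H 0\<bar>"
    using diffeo_lift_dist_le[OF H, of "(F ^^ n) z"]
      diffeo_lift_dist_le[OF diffeo_lift_funpow[OF F, of n], of z] by linarith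
qed

section \<open>Circle diffeomorphisms and their lifts\<close>

lemma circle_of_cases: obtains x where "p = circle_of x"
proof -
  have "\<exists>x. p = circle_of x"
    by (rule circle.abs_induct) auto
  then show thesis using that by blast
qed

lemma circle_of_add_int [simp]: "circle_of (x + of_int k) = circle_of x" "circle_of (x + 1) = circle_of x"
  by (simp_all add: circle_of_eq_iff)

lemma circle_lift_comp:
  "circle_lift F f \<Longrightarrow> circle_lift G g \<Longrightarrow> circle_lift (\<lambda>x. F (G x)) (f \<circ> g)"
  by (auto simp: circle_lift_def intro: continuous_on_compose2)

lemma circle_lift_id: "circle_lift (\<lambda>x. x) id"
  by (auto simp: circle_lift_def)

lemma circle_lift_funpow: "circle_lift F f \<Longrightarrow> circle_lift (F ^^ n) (f ^^ n)"
  by (induction n) (auto simp: circle_lift_id[unfolded id_def] id_def o_def dest: circle_lift_comp[of F f])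

lemma circle_map_exists:
  assumes F: "diffeo_lift F"
  shows "\<exists>f. circle_lift F f"
proof (intro exI)
  show "circle_lift F (\<lambda>p. circle_of (F (rep_circle p)))"
    unfolding circle_lift_def
  proof (intro conjI allI diffeo_lift_cont[OF F])
    fix x
    have "circle_of (rep_circle (circle_of x)) = circle_of x"
      by (rule Quotient_abs_rep[OF Quotient_circle])
    then obtain k where "rep_circle (circle_of x) = x + of_int k"
      unfolding circle_of_eq_iff by (metis Ints_cases diff_add_cancel add.commute)
    then show "circle_of (F x) = circle_of (F (rep_circle (circle_of x)))"
      by (simp add: diffeo_lift_add_int[OF F])
  qed
qed

lemma circle_lift_map_unique:
  "circle_lift F f \<Longrightarrow> circle_lift F g \<Longrightarrow> f = g"
  unfolding circle_lift_def by (metis circle_of_cases ext)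

text \<open>The inverse lift descends to a circle map \<open>g\<close>; both composites of
  \<open>f\<close> and \<open>g\<close> are lifted by the identity, hence equal it.\<close>

lemma circle_lift_inverse:
  assumes F: "diffeo_lift F" and f: "circle_lift F f"
  shows "bij f" "circle_lift (inv F) (inv f)"
proof -
  obtain g where g: "circle_lift (inv F) g"
    using circle_map_exists[OF diffeo_lift_inv(1)[OF F]] by blast
  have 1: "f \<circ> g = id" "g \<circ> f = id"
    using circle_lift_comp[OF f g] circle_lift_comp[OF g f] circle_lift_id
    by (auto simp: diffeo_lift_inv_apply[OF F] intro: circle_lift_map_unique)
  then show "bij f" by (metis o_bij)
  moreover have "inv f = g" using 1 by (metis inv_unique_comp)
  ultimately show "circle_lift (inv F) (inv f)" using g by simp
qed

lemma C1_differentiable_diffeo_lift: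
  assumes "diffeo_lift F" shows "F C1_differentiable_on UNIV"
  unfolding C1_differentiable_on_def
  using diffeo_lift_DERIV[OF assms] diffeo_lift_cont_deriv[OF assms]
  by (auto simp: has_real_derivative_iff_has_vector_derivative)

lemma circle_C1_diffeoI:
  assumes F: "diffeo_lift F" and f: "circle_lift F f"
  shows "circle_C1_diffeo f"
  unfolding circle_C1_diffeo_def circle_C1_def orientation_preserving_def
  using circle_lift_inverse[OF F f] f C1_differentiable_diffeo_lift[OF F]
    C1_differentiable_diffeo_lift[OF diffeo_lift_inv(1)[OF F]] diffeo_lift_strict_mono[OF F]
  by blast

text \<open>A C^1 lift differs from a monotone one by an integer and is thus monotone. Injectivity
  of \<open>f\<close> forces degree one, and the chain rule with a C^1 lift of the inverse keeps the
  derivative from vanishing.\<close>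

lemma circle_C1_diffeoE:
  assumes "circle_C1_diffeo f"
  obtains F where "diffeo_lift F" "circle_lift F f"
proof -
  obtain F where F: "circle_lift F f" "F C1_differentiable_on UNIV" and bij: "bij f"
    using assms by (auto simp: circle_C1_diffeo_def circle_C1_def)
  obtain G where G: "circle_lift G (inv f)" "G C1_differentiable_on UNIV"
    using assms by (auto simp: circle_C1_diffeo_def circle_C1_def)
  obtain M where M: "circle_lift M f" "strict_mono M"
    using assms by (auto simp: circle_C1_diffeo_def orientation_preserving_def)
  obtain n where n: "\<And>x. F x = M x + of_int n"
    using circle_lift_unique[OF F(1) M(1)] by blast
  have mono: "strict_mono F" using M(2) by (auto simp: strict_mono_def n)
  obtain F' where F': "\<And>x. (F has_real_derivative F' x) (at x)" "continuous_on UNIV F'"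
    using F(2) unfolding C1_differentiable_on_def
    by (auto simp: has_real_derivative_iff_has_vector_derivative)
  obtain G' where G': "\<And>x. (G has_real_derivative G' x) (at x)"
    using G(2) unfolding C1_differentiable_on_def
    by (auto simp: has_real_derivative_iff_has_vector_derivative)
  have per: "F (x + 1) = F x + 1" for x
  proof -
    obtain k where k: "\<And>x. F (x + 1) = F x + of_int k"
      using circle_lift_unique[OF circle_lift_shift[OF F(1), of 1] F(1)] by auto
    have pos: "k > 0" using strict_monoD[OF mono, of 0 1] k[of 0] by simp
    have "\<not> k > 1"
    proof
      assume "k > 1"
      then have k1: "(1::real) < of_int k" by simp
      \<comment> \<open>For degree at least two, \<open>F 0 + 1\<close> would be attained strictly
        between \<open>0\<close> and \<open>1\<close>, at a point with the same image under
        \<open>f\<close> as \<open>0\<close>.\<close>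
      have "\<exists>y. 0 \<le> y \<and> y \<le> 1 \<and> F y = F 0 + 1"
        by (rule IVT') (use k[of 0] k1 F(1) in \<open>auto simp: circle_lift_def intro: continuous_on_subset\<close>)
      then obtain y where y: "0 \<le> y" "y \<le> 1" "F y = F 0 + 1" by blast
      have "f (circle_of y) = f (circle_of 0)"
        using F(1) y(3) by (metis circle_lift_def circle_of_add_int(2))
      then have "circle_of y = circle_of 0" using bij by (meson bij_is_inj injD)
      then obtain m where "y = of_int m" by (auto simp: circle_of_eq_iff elim: Ints_cases)
      then have "y = 0 \<or> y = 1" using y by auto
      then show False using y(3) k[of 0] k1 by auto
    qed
    then show ?thesis using pos k[of x] by (simp add: not_less order.antisym)
  qed
  have GF: "circle_lift (\<lambda>x. G (F x)) id"
    using circle_lift_comp[OF G(1) F(1)] bij by (simp add: bij_is_inj)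
  obtain m where m: "\<And>x. G (F x) = x + of_int m"
    using circle_lift_unique[OF GF circle_lift_id] by auto
  have nz: "F' x \<noteq> 0" for x
  proof -
    have "((\<lambda>x. G (F x)) has_real_derivative G' (F x) * F' x) (at x)"
      by (rule DERIV_chain2[OF G' F'(1)])
    moreover have "((\<lambda>x. G (F x)) has_real_derivative 1) (at x)"
      unfolding m by (auto intro!: derivative_eq_intros)
    ultimately have "G' (F x) * F' x = 1" by (rule DERIV_unique)
    then show ?thesis by auto
  qed
  have pos: "F' x > 0" for x
  proof (rule ccontr)
    assume "\<not> F' x > 0"
    then have "F' x < 0" using nz[of x] by simp
    from DERIV_neg_dec_right[OF F'(1) this] obtain d where "d > 0" "\<forall>h>0. h < d \<longrightarrow> F x > F (x + h)"
      by blast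
    then have "F (x + d/2) < F x" by simp
    then show False using strict_monoD[OF mono, of x "x + d/2"] \<open>d > 0\<close> by auto
  qed
  show thesis using diffeo_liftI(1)[OF F' pos per] F(1) that by blast
qed

lemma circle_deriv_lift:
  "diffeo_lift F \<Longrightarrow> circle_lift F f \<Longrightarrow> circle_deriv f (circle_of x) = deriv F x"
  by (rule circle_deriv_eq[OF _ diffeo_lift_DERIV])

abbreviation cvar :: "(real \<Rightarrow> real) \<Rightarrow> ennreal" where
  "cvar h \<equiv> total_variation h 0 1"

lemma circle_var_log_deriv:
  "diffeo_lift F \<Longrightarrow> circle_lift F f \<Longrightarrow> circle_var (log_deriv f) = cvar (\<lambda>x. ln (deriv F x))"
  unfolding circle_var_def log_deriv_def by (simp add: circle_deriv_lift)

text \<open>Two lifts differ by an integer \<open>k\<close> and their n-th iterates by n times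
  \<open>k\<close>, so the translation numbers differ by \<open>k\<close> and agree on the
  circle.\<close>

lemma rotation_number_lift:
  assumes F: "diffeo_lift F" and f: "circle_lift F f"
  shows "rotation_number f = circle_of (translation_number F)"
  unfolding rotation_number_def
proof (rule the_equality)
  show "\<exists>G \<tau>. circle_lift G f \<and> (\<forall>x. (\<lambda>n. (G ^^ n) x / real n) \<longlonglongrightarrow> \<tau>)
    \<and> circle_of (translation_number F) = circle_of \<tau>"
    using f tendsto_translation_number[OF F] by blast
  fix \<rho>
  assume "\<exists>G \<tau>. circle_lift G f \<and> (\<forall>x. (\<lambda>n. (G ^^ n) x / real n) \<longlonglongrightarrow> \<tau>) \<and> \<rho> = circle_of \<tau>"
  then obtain G \<tau> where G: "circle_lift G f" "(\<lambda>n. (G ^^ n) 0 / real n) \<longlonglongrightarrow> \<tau>" "\<rho> = circle_of \<tau>"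
    by blast
  obtain k where k: "\<And>x. G x = F x + of_int k" using circle_lift_unique[OF G(1) f] by blast
  have pow: "(G ^^ n) 0 = (F ^^ n) 0 + real n * of_int k" for n
  proof (induction n)
    case (Suc n)
    then show ?case using diffeo_lift_add_int[OF F, of "(F ^^ n) 0" "int n * k"]
      by (simp add: k algebra_simps)
  qed simp
  have "(\<lambda>n. (F ^^ n) 0 / real n + of_int k) \<longlonglongrightarrow> translation_number F + of_int k"
    by (intro tendsto_intros tendsto_translation_number[OF F])
  moreover have "\<forall>\<^sub>F n in sequentially. (F ^^ n) 0 / real n + of_int k = (G ^^ n) 0 / real n"
    using eventually_gt_at_top[of 0] by eventually_elim (simp add: pow field_simps)
  ultimately have "(\<lambda>n. (G ^^ n) 0 / real n) \<longlonglongrightarrow> translation_number F + of_int k"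
    by (rule Lim_transform_eventually)
  with G(2) have "\<tau> = translation_number F + of_int k" by (rule LIMSEQ_unique)
  then show "\<rho> = circle_of (translation_number F)" using G(3) by simp
qed

lemma dist_circle_of_le: "dist (circle_of x) (circle_of y) \<le> \<bar>x - y\<bar>"
proof -
  have "dist (circle_of x) (circle_of y) = \<bar>(x - y) - of_int (round (x - y))\<bar>"
    by (rule dist_circle.abs_eq)
  also have "\<dots> \<le> \<bar>(x - y) - of_int 0\<bar>" by (rule round_diff_minimal)
  finally show ?thesis by simp
qed

section \<open>Variation of one-periodic functions\<close>

text \<open>A lift carries one period onto one period, which gives one inequality; the other is the
  same inequality for the inverse lift.\<close>

lemma cvar_compose:
  assumes F: "diffeo_lift F" and per: "\<And>x. h (x + 1) = h x"
  shows "cvar (\<lambda>x. h (F x)) = cvar h"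
proof -
  have le: "cvar (\<lambda>x. h (F x)) \<le> cvar h" if F: "diffeo_lift F" and per: "\<And>x. h (x + 1) = h x" for h F
    using total_variation_comp[OF diffeo_lift_mono[OF F], of h 0 1]
      total_variation_period[where h = h and a = "F 0", OF per] diffeo_lift_add1[OF F, of 0] by simp
  show ?thesis
  proof (rule antisym)
    show "cvar (\<lambda>x. h (F x)) \<le> cvar h" by (rule le[OF F]) (rule per)
    have "cvar (\<lambda>x. h (F (inv F x))) \<le> cvar (\<lambda>x. h (F x))"
      by (rule le[OF diffeo_lift_inv(1)[OF F]]) (simp add: diffeo_lift_add1[OF F] per)
    then show "cvar h \<le> cvar (\<lambda>x. h (F x))" by (simp add: diffeo_lift_inv_apply[OF F])
  qed
qed

lemma cvar_ln_deriv_inv: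
  assumes F: "diffeo_lift F"
  shows "cvar (\<lambda>x. ln (deriv (inv F) x)) = cvar (\<lambda>x. ln (deriv F x))"
proof -
  have "(\<lambda>x. ln (deriv (inv F) x)) = (\<lambda>x. - ln (deriv F (inv F x)))"
    unfolding diffeo_lift_inv(2)[OF F] using diffeo_lift_nz[OF F] by (simp add: ln_div)
  then show ?thesis
    using cvar_compose[OF diffeo_lift_inv(1)[OF F], of "\<lambda>x. ln (deriv F x)"]
    by (simp add: diffeo_lift_deriv_add1[OF F])
qed

lemma inv_funpow:
  assumes F: "diffeo_lift F"
  shows "inv F ^^ n = inv (F ^^ n)"
  by (rule sym, rule inv_equality) (auto simp: inv_funpow_cancel[OF F])

section \<open>Closest returns\<close>

text \<open>\<open>q\<close> and \<open>N\<close> are consecutive closest-return times of the rotation by \<open>t\<close>, with the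
  return at time \<open>q\<close> taking place on the right.\<close>

definition closest_return :: "real \<Rightarrow> nat \<Rightarrow> nat \<Rightarrow> int \<Rightarrow> bool" where
  "closest_return t q N p \<longleftrightarrow> 0 < q \<and> q < N \<and> of_int p < real q * t \<and>
    (\<forall>j (k::int). 0 < j \<and> j < N \<longrightarrow> real q * t - of_int p \<le> \<bar>real j * t - of_int k\<bar>) \<and>
    (\<exists>k::int. \<bar>real N * t - of_int k\<bar> < real q * t - of_int p)"

text \<open>\<open>q\<close> is the first time at which the distance \<open>d\<close> to the
  integers falls below all its values up to \<open>q0\<close>, and \<open>N\<close> is the next
  record time. A return on the left becomes one on the right when \<open>t\<close> is replaced by
  \<open>- t\<close>.\<close>

lemma closest_return_exists:
  assumes irr: "\<And>q p. q > 0 \<Longrightarrow> real q * t \<noteq> of_int p"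
  shows "\<exists>q>q0. \<exists>N p. closest_return t q N p \<or> closest_return (- t) q N p"
proof -
  define d where "d j = \<bar>real j * t - of_int (round (real j * t))\<bar>" for j :: nat
  have d_pos: "d j > 0" if "j > 0" for j
    using irr[OF that, of "round (real j * t)"] by (simp add: d_def)
  have d_le: "d j \<le> \<bar>real j * t - of_int k\<bar>" for j k
    unfolding d_def by (rule round_diff_minimal)
  have small: "\<exists>n>0. d n < e" if "e > 0" for e
  proof -
    obtain M :: nat where M: "1 / e < real M" using reals_Archimedean2 by blast
    then have M0: "0 < real M" using that by (meson divide_pos_pos less_trans zero_less_one)
    then have "M > 0" by simp
    then obtain h k where hk: "0 < k" "k \<le> int M" "\<bar>of_int k * t - of_int h\<bar> < 1 / real M"
      using Dirichlet_approx[of M t] by metis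
    have "d (nat k) \<le> \<bar>of_int k * t - of_int h\<bar>" using d_le[of "nat k" h] hk(1) by simp
    also have "\<dots> < 1 / real M" by fact
    also have "\<dots> < e" using M M0 that by (simp add: field_simps)
    finally show ?thesis using hk(1) by (intro exI[of _ "nat k"]) auto
  qed
  \<comment> \<open>The inserted \<open>1\<close> keeps the minimum meaningful for
    \<open>q0 = 0\<close>.\<close>
  define m where "m = Min (insert 1 (d ` {1..q0}))"
  have m: "m > 0" "\<And>j. 0 < j \<Longrightarrow> j \<le> q0 \<Longrightarrow> m \<le> d j"
    unfolding m_def by (subst Min_gr_iff; auto intro!: d_pos) (rule Min_le; auto)
  define q where "q = (LEAST q. q > 0 \<and> d q < m)"
  have q: "q > 0" "d q < m"
    using LeastI_ex[OF small[OF m(1)]] unfolding q_def by auto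
  have q_least: "m \<le> d j" if "0 < j" "j < q" for j
    using not_less_Least[of j "\<lambda>q. q > 0 \<and> d q < m"] that unfolding q_def by auto
  have "q > q0" using m(2)[of q] q by (cases "q \<le> q0") auto
  define N where "N = (LEAST N. N > 0 \<and> d N < d q)"
  have N: "N > 0" "d N < d q"
    using LeastI_ex[OF small[OF d_pos[OF q(1)]]] unfolding N_def by auto
  have N_least: "d q \<le> d j" if "0 < j" "j < N" for j
    using not_less_Least[of j "\<lambda>N. N > 0 \<and> d N < d q"] that unfolding N_def by auto
  have "q < N"
  proof (rule ccontr)
    assume "\<not> q < N"
    then have "N < q" using N(2) by (cases "N = q") auto
    then show False using q_least[of N] N q by auto
  qed
  define p where "p = round (real q * t)"
  have dN: "d N = \<bar>real N * t - of_int (round (real N * t))\<bar>" by (simp add: d_def)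
  have dq: "d q = \<bar>real q * t - of_int p\<bar>" by (simp add: d_def p_def)
  show ?thesis
  proof (cases "real q * t - of_int p > 0")
    case True
    then have 1: "real q * t - of_int p = d q" using dq by simp
    have 2: "d q \<le> \<bar>real j * t - of_int k\<bar>" if "0 < j" "j < N" for j k
      using order.trans[OF N_least[OF that] d_le] .
    have "\<bar>real N * t - of_int (round (real N * t))\<bar> < d q" using N(2) dN by simp
    then have "\<exists>k::int. \<bar>real N * t - of_int k\<bar> < d q" by blast
    then have "closest_return t q N p"
      unfolding closest_return_def 1 using q(1) \<open>q < N\<close> 2 True by (intro conjI) (simp_all only: diff_gt_0_iff_gt simp_thms, blast)
    then show ?thesis using \<open>q > q0\<close> by blast
  next
    case False
    then have neg: "real q * t - of_int p < 0" using d_pos[OF q(1)] dq by auto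
    have 1: "real q * (- t) - of_int (- p) = d q" using neg dq by auto
    have 2: "d q \<le> \<bar>real j * (- t) - of_int k\<bar>" if "0 < j" "j < N" for j k
      using order.trans[OF N_least[OF that] d_le[of j "- k"]] by simp
    have "\<bar>real N * (- t) - of_int (- round (real N * t))\<bar> < d q" using N(2) dN by simp
    then have "closest_return (- t) q N (- p)"
      unfolding closest_return_def 1 using q(1) \<open>q < N\<close> 2 1 d_pos[OF q(1)] by (auto simp del: of_int_minus)
    then show ?thesis using \<open>q > q0\<close> by blast
  qed
qed

text \<open>The side of a closest return cannot be prescribed, but one side occurs for arbitrarily
  large \<open>q\<close>; accordingly the argument below is run for \<open>F\<close> or for its
  inverse.\<close>

lemma closest_returns_infinitely_often:
  assumes irr: "\<And>q p. q > 0 \<Longrightarrow> real q * t \<noteq> of_int p"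
  shows "(\<forall>q0. \<exists>q>q0. \<exists>N p. closest_return t q N p) \<or> (\<forall>q0. \<exists>q>q0. \<exists>N p. closest_return (- t) q N p)"
proof (rule ccontr)
  assume "\<not> ?thesis"
  then obtain a b where "\<forall>q>a. \<forall>N p. \<not> closest_return t q N p" "\<forall>q>b. \<forall>N p. \<not> closest_return (- t) q N p"
    by blast
  then show False using closest_return_exists[of t "max a b", OF irr] by auto
qed

locale irrational_lift =
  fixes F :: "real \<Rightarrow> real" and V :: real
  assumes F: "diffeo_lift F"
    and irr: "\<And>q p. q > 0 \<Longrightarrow> real q * translation_number F \<noteq> of_int p"
    and V0: "V \<ge> 0"
    and V: "cvar (\<lambda>x. ln (deriv F x)) \<le> ennreal V"
begin

abbreviation "\<tau> \<equiv> translation_number F"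

lemmas Fn = diffeo_lift_funpow[OF F]

lemma Fn_add: "(F ^^ i) ((F ^^ j) x) = (F ^^ (i + j)) x"
  by (simp add: funpow_add)

text \<open>Modulo integers, every orbit is ordered like an orbit of the rotation by \<tau>:
  cancelling the smaller iterate reduces the claim to the displacement of one power at one orbit
  point.\<close>

lemma orbit_less:
  assumes "real i * \<tau> + of_int k < real j * \<tau>"
  shows "(F ^^ i) x + of_int k < (F ^^ j) x"
proof (cases "i \<le> j")
  case True
  then obtain n where j: "j = n + i" by (metis le_add_diff_inverse2)
  show ?thesis
    using less_translation_number[OF F, of k n "(F ^^ i) x"] assms by (simp add: j Fn_add algebra_simps)
next
  case False
  then obtain n where i: "i = n + j" by (metis le_add_diff_inverse2 nat_le_linear)
  show ?thesis
    using translation_number_less[OF F, of n "- k" "(F ^^ j) x"] assms by (simp add: i Fn_add algebra_simps)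
qed

lemma orbit_eq:
  assumes "real i * \<tau> + of_int k = real j * \<tau>"
  shows "i = j \<and> k = 0"
proof -
  consider "i < j" | "j < i" | "i = j" by linarith
  then show ?thesis
  proof cases
    case 1
    then have "real (j - i) * \<tau> = of_int k" using assms by (simp add: of_nat_diff algebra_simps)
    then show ?thesis using irr[of "j - i" k] 1 by simp
  next
    case 2
    then have "real (i - j) * \<tau> = of_int (- k)" using assms by (simp add: of_nat_diff algebra_simps)
    then show ?thesis using irr[of "i - j" "- k"] 2 by simp
  qed (use assms in simp)
qed

lemma orbit_le:
  assumes "real i * \<tau> + of_int k \<le> real j * \<tau>"
  shows "(F ^^ i) x + of_int k \<le> (F ^^ j) x"
proof (cases "real i * \<tau> + of_int k = real j * \<tau>")
  case True
  then show ?thesis using orbit_eq by fastforce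
next
  case False
  then show ?thesis using orbit_less[of i k j x] assms by simp
qed

text \<open>The arc between \<open>F ^^ i\<close> of \<open>x\<close> and of its closest return \<open>(F ^^ q) x - p\<close>.\<close>

lemma return_arcs_disjoint:
  assumes cr: "closest_return \<tau> q N p" and ij: "i \<noteq> j" "i < j + N" "j < i + N"
  shows "(F ^^ (i + q)) x - of_int p + of_int k \<le> (F ^^ j) x \<or> (F ^^ (j + q)) x - of_int p \<le> (F ^^ i) x + of_int k"
proof -
  \<comment> \<open>For the rotation, the two points are at least \<delta> apart, since their time
    difference is less than \<open>N\<close>; the common order of orbits transfers this to
    \<open>F\<close>.\<close>
  define \<delta> where "\<delta> = real q * \<tau> - of_int p"
  have "\<delta> \<le> \<bar>real i * \<tau> + of_int k - real j * \<tau>\<bar>"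
  proof (cases "i < j")
    case True
    then have "\<delta> \<le> \<bar>real (j - i) * \<tau> - of_int k\<bar>"
      using cr ij unfolding closest_return_def \<delta>_def by (auto simp del: of_nat_diff)
    then show ?thesis using True by (simp add: of_nat_diff algebra_simps)
  next
    case False
    then have "\<delta> \<le> \<bar>real (i - j) * \<tau> - of_int (- k)\<bar>"
      using cr ij unfolding closest_return_def \<delta>_def by (auto simp del: of_int_minus of_nat_diff)
    then show ?thesis using False by (simp add: of_nat_diff algebra_simps)
  qed
  then consider "real i * \<tau> + of_int k + \<delta> \<le> real j * \<tau>" | "real j * \<tau> + \<delta> \<le> real i * \<tau> + of_int k"
    by linarith
  then show ?thesis
  proof cases
    case 1
    then have "real (i + q) * \<tau> + of_int (k - p) \<le> real j * \<tau>" by (simp add: \<delta>_def algebra_simps)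
    from orbit_le[OF this, of x] show ?thesis by simp
  next
    case 2
    then have "real (j + q) * \<tau> + of_int (- p - k) \<le> real i * \<tau>" by (simp add: \<delta>_def algebra_simps)
    from orbit_le[OF this, of x] show ?thesis by simp
  qed
qed

lemma return_gt:
  assumes cr: "closest_return \<tau> q N p"
  shows "(F ^^ i) x < (F ^^ (i + q)) x - of_int p"
  using cr orbit_less[of i p "i + q" x] by (simp add: closest_return_def algebra_simps)

lemma return_le:
  assumes cr: "closest_return \<tau> q N p"
  shows "(F ^^ (i + q)) x - of_int p \<le> (F ^^ i) x + 1"
proof -
  \<comment> \<open>Time \<open>1\<close> is smaller than \<open>N\<close>, so the closest-return
    distance is bounded by the distance from \<tau> to its integer part.\<close>
  have "real q * \<tau> - of_int p \<le> \<bar>real 1 * \<tau> - of_int \<lfloor>\<tau>\<rfloor>\<bar>"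
    using cr unfolding closest_return_def by (elim conjE allE[of _ 1] allE[of _ "\<lfloor>\<tau>\<rfloor>"]) auto
  also have "\<dots> \<le> 1" by simp linarith
  finally have "real (i + q) * \<tau> + of_int (- p - 1) \<le> real i * \<tau>" by (simp add: algebra_simps)
  from orbit_le[OF this, of x] show ?thesis by simp
qed

lemma sum_return_arcs_le:
  assumes cr: "closest_return \<tau> q N p" and J: "J \<subseteq> {m..<m + N}"
    and ab: "\<And>i. i \<in> J \<Longrightarrow> (F ^^ i) x \<le> a i \<and> a i \<le> b i \<and> b i \<le> (F ^^ (i + q)) x - of_int p"
    and inc: "\<And>x y. \<bar>h (x + 1) - h (y + 1)\<bar> = \<bar>h x - h y\<bar>"
  shows "(\<Sum>j\<in>J. ennreal \<bar>h (b j) - h (a j)\<bar>) \<le> total_variation h 0 2"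
proof (rule sum_disjoint_arcs_le)
  show "\<bar>h (x + 1) - h (y + 1)\<bar> = \<bar>h x - h y\<bar>" for x y by (rule inc)
  show "finite J" using J finite_subset by blast
  show "a j \<le> b j \<and> b j \<le> a j + 1" if "j \<in> J" for j
    using ab[OF that] return_le[OF cr, of j x] by linarith
  fix i j k assume *: "i \<in> J" "j \<in> J" "i \<noteq> j"
  then have "i \<in> {m..<m + N}" "j \<in> {m..<m + N}" using J by blast+
  then have "i < j + N" "j < i + N" by auto
  from return_arcs_disjoint[OF cr *(3) this, of x k] ab[OF *(1)] ab[OF *(2)]
  show "b i + of_int k \<le> a j \<or> b j \<le> a i + of_int k" by linarith
qed

lemma sum_return_lengths_le:
  assumes cr: "closest_return \<tau> q N p" and J: "J \<subseteq> {m..<m + N}"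
  shows "(\<Sum>j\<in>J. (F ^^ (j + q)) x - of_int p - (F ^^ j) x) \<le> 2"
proof -
  have nn: "0 \<le> (F ^^ (j + q)) x - of_int p - (F ^^ j) x" for j
    using return_gt[OF cr, of j x] by simp
  have "ennreal (\<Sum>j\<in>J. (F ^^ (j + q)) x - of_int p - (F ^^ j) x)
      = (\<Sum>j\<in>J. ennreal \<bar>((F ^^ (j + q)) x - of_int p) - (F ^^ j) x\<bar>)"
    by (subst sum_ennreal) (use nn in \<open>auto intro!: sum.cong\<close>)
  also have "\<dots> \<le> total_variation (\<lambda>x. x) 0 2"
    by (rule sum_return_arcs_le[OF cr J]) (use nn in auto)
  also have "\<dots> \<le> ennreal (integral {0..2} (\<lambda>x::real. \<bar>1\<bar>))"
    by (rule total_variation_C1) (auto intro!: derivative_eq_intros)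
  also have "\<dots> = ennreal 2" by simp
  finally show ?thesis by (subst (asm) ennreal_le_iff) auto
qed

section \<open>Bounded distortion and absence of wandering intervals\<close>

lemma ln_deriv_add1: "ln (deriv F (x + 1)) = ln (deriv F x)"
  by (simp add: diffeo_lift_deriv_add1[OF F])

lemma variation_0_2: "total_variation (\<lambda>x. ln (deriv F x)) 0 2 \<le> ennreal (2 * V)"
proof -
  have "total_variation (\<lambda>x. ln (deriv F x)) 0 2 =
      cvar (\<lambda>x. ln (deriv F x)) + total_variation (\<lambda>x. ln (deriv F x)) 1 (1 + 1)"
    by (subst total_variation_concat[of _ 1]) auto
  also have "\<dots> = cvar (\<lambda>x. ln (deriv F x)) + cvar (\<lambda>x. ln (deriv F x))"
    by (subst total_variation_period[where h = "\<lambda>x. ln (deriv F x)", OF ln_deriv_add1]) simp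
  also have "\<dots> \<le> ennreal V + ennreal V" by (intro add_mono V)
  also have "\<dots> = ennreal (2 * V)" using V0 by (subst ennreal_plus[symmetric]) auto
  finally show ?thesis .
qed

text \<open>By the chain rule the difference is a sum of increments of ln DF over the images of the
  interval between \<open>a\<close> and \<open>b\<close>; for \<open>n \<le> N\<close> these lie in
  disjoint return arcs, and ln DF has variation at most \<open>2 * V\<close> on
  \<open>[0, 2]\<close>.\<close>

lemma distortion:
  assumes cr: "closest_return \<tau> q N p" and n: "n \<le> N"
    and ab: "x \<le> a" "a \<le> (F ^^ q) x - of_int p" "x \<le> b" "b \<le> (F ^^ q) x - of_int p"
  shows "\<bar>ln (deriv (F ^^ n) a) - ln (deriv (F ^^ n) b)\<bar> \<le> 2 * V"
proof -
  have *: "\<bar>ln (deriv (F ^^ n) b) - ln (deriv (F ^^ n) a)\<bar> \<le> 2 * V"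
    if ab: "x \<le> a" "a \<le> b" "b \<le> (F ^^ q) x - of_int p" for a b
  proof -
    let ?h = "\<lambda>x. ln (deriv F x)"
    have "(F ^^ i) b \<le> (F ^^ (i + q)) x - of_int p" for i
    proof -
      have "(F ^^ i) b \<le> (F ^^ i) ((F ^^ q) x + of_int (- p))"
        using ab by (simp add: diffeo_lift_le_iff[OF Fn])
      then show ?thesis using diffeo_lift_add_int[OF Fn, of i "(F ^^ q) x" "- p"] by (simp add: Fn_add)
    qed
    then have "(\<Sum>i<n. ennreal \<bar>?h ((F ^^ i) b) - ?h ((F ^^ i) a)\<bar>) \<le> total_variation ?h 0 2"
      using n ab
      by (intro sum_return_arcs_le[OF cr, of _ 0 x]) (auto simp: ln_deriv_add1 diffeo_lift_le_iff[OF Fn])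
    also have "\<dots> \<le> ennreal (2 * V)" by (rule variation_0_2)
    finally have s: "(\<Sum>i<n. \<bar>?h ((F ^^ i) b) - ?h ((F ^^ i) a)\<bar>) \<le> 2 * V"
      using V0 by simp
    have "ln (deriv (F ^^ n) b) - ln (deriv (F ^^ n) a) = (\<Sum>i<n. ?h ((F ^^ i) b) - ?h ((F ^^ i) a))"
      by (simp add: ln_deriv_funpow[OF F] sum_subtractf)
    also have "\<bar>\<dots>\<bar> \<le> (\<Sum>i<n. \<bar>?h ((F ^^ i) b) - ?h ((F ^^ i) a)\<bar>)" by (rule sum_abs)
    finally show ?thesis using s by linarith
  qed
  show ?thesis
    using *[of a b] *[of b a] ab by (cases "a \<le> b") (auto simp: abs_minus_commute)
qed

text \<open>The disjoint images have total length at most \<open>2\<close>, so their lengths form a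
  summable sequence.\<close>

lemma orbit_of_interval_shrinks:
  assumes W: "w0 \<le> w1" "w1 \<le> w0 + 1"
    and disj: "\<And>i j k. i \<noteq> j \<Longrightarrow> (F ^^ i) w1 + of_int k \<le> (F ^^ j) w0 \<or> (F ^^ j) w1 \<le> (F ^^ i) w0 + of_int k"
  shows "(\<lambda>n. (F ^^ n) w1 - (F ^^ n) w0) \<longlonglongrightarrow> 0"
proof -
  have nn: "0 \<le> (F ^^ i) w1 - (F ^^ i) w0" for i
    using W by (simp add: diffeo_lift_le_iff[OF Fn])
  have "(\<Sum>i<n. (F ^^ i) w1 - (F ^^ i) w0) \<le> 2" for n
  proof -
    have "ennreal (\<Sum>i<n. (F ^^ i) w1 - (F ^^ i) w0) = (\<Sum>i<n. ennreal \<bar>(F ^^ i) w1 - (F ^^ i) w0\<bar>)"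
      by (subst sum_ennreal) (use nn in \<open>auto intro!: sum.cong\<close>)
    also have "\<dots> \<le> total_variation (\<lambda>x. x) 0 2"
    proof (rule sum_disjoint_arcs_le)
      show "(F ^^ j) w0 \<le> (F ^^ j) w1 \<and> (F ^^ j) w1 \<le> (F ^^ j) w0 + 1" for j
        using W diffeo_lift_add1[OF Fn, of j w0] by (metis diffeo_lift_le_iff[OF Fn])
    qed (use disj in auto)
    also have "\<dots> \<le> ennreal (integral {0..2} (\<lambda>x::real. \<bar>1\<bar>))"
      by (rule total_variation_C1) (auto intro!: derivative_eq_intros)
    also have "\<dots> = ennreal 2" by simp
    finally show ?thesis by (subst (asm) ennreal_le_iff) auto
  qed
  then have "summable (\<lambda>i. (F ^^ i) w1 - (F ^^ i) w0)"
    by (intro summableI_nonneg_bounded[of _ 2] nn)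
  then show ?thesis by (rule summable_LIMSEQ_zero)
qed

text \<open>Denjoy's argument: bounded distortion of \<open>F ^^ q\<close> on two adjacent return arcs keeps the
  length of \<open>(F ^^ q) ` W\<close> away from zero, although these lengths are summable.\<close>

lemma return_arc_expands:
  assumes cr: "closest_return \<tau> q N p" and W: "w0 < w1" "w1 \<le> w0 + 1"
    and y: "y \<le> w0" "w1 \<le> (F ^^ q) y - of_int p"
  shows "exp (- 4 * V) * (w1 - w0)\<^sup>2 \<le> (F ^^ q) w1 - (F ^^ q) w0"
proof -
  define G where "G x = (F ^^ q) x + of_int (- p)" for x
  have G: "diffeo_lift G" "deriv G = deriv (F ^^ q)"
    unfolding G_def using diffeo_lift_add_const[OF Fn, of q "of_int (- p)"] by simp_all
  have [simp]: "G (inv G x) = x" for x by (rule diffeo_lift_inv_apply(1)[OF G(1)])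
  \<comment> \<open>Going back by the return map produces the arc \<open>[z, y]\<close> adjacent to
    \<open>[y, G y]\<close>. The derivatives at \<zeta> in the first and at \<xi> in the second arc
    are compared through \<open>y\<close>, at a cost of \<open>2 * V\<close> each.\<close>
  define z where "z = inv G y"
  define z0 where "z0 = inv G w0"
  define z1 where "z1 = inv G w1"
  have Gz: "G z = y" "G z0 = w0" "G z1 = w1" by (auto simp: z_def z0_def z1_def)
  have "q \<le> N" using cr by (simp add: closest_return_def)
  have "w0 \<le> G y" using y W by (simp add: G_def)
  have "G z \<le> G z0" "G z0 < G z1" "G z1 \<le> G y" "G z1 \<le> G (z0 + 1)"
    using W y by (simp_all add: Gz diffeo_lift_add1[OF G(1)]) (simp add: G_def)
  then have zz: "z \<le> z0" "z0 < z1" "z1 \<le> y" "z1 \<le> z0 + 1"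
    by (simp_all only: diffeo_lift_le_iff[OF G(1)] diffeo_lift_less_iff[OF G(1)])
  obtain \<xi> where \<xi>: "w0 < \<xi>" "\<xi> < w1" "G w1 - G w0 = (w1 - w0) * deriv G \<xi>"
    using MVT2[OF W(1), of G "deriv G"] diffeo_lift_DERIV[OF G(1)] by blast
  obtain \<zeta> where \<zeta>: "z0 < \<zeta>" "\<zeta> < z1" "G z1 - G z0 = (z1 - z0) * deriv G \<zeta>"
    using MVT2[OF zz(2), of G "deriv G"] diffeo_lift_DERIV[OF G(1)] by blast
  have pos: "deriv G x > 0" for x by (rule diffeo_lift_pos[OF G(1)])
  have "z \<le> y" using zz by linarith
  then have yG: "y \<le> G y" using y W by (simp add: G_def)
  have 1: "\<bar>ln (deriv G \<xi>) - ln (deriv G y)\<bar> \<le> 2 * V"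
    unfolding G(2) by (rule distortion[OF cr \<open>q \<le> N\<close>, of y]) (use \<xi> y yG in \<open>auto simp: G_def\<close>)
  have 2: "\<bar>ln (deriv G y) - ln (deriv G \<zeta>)\<bar> \<le> 2 * V"
    unfolding G(2) by (rule distortion[OF cr \<open>q \<le> N\<close>, of z]) (use \<zeta> zz Gz \<open>z \<le> y\<close> in \<open>auto simp: G_def\<close>)
  \<comment> \<open>The preimage interval has length at most one, so its mean expansion is at least
    \<open>w1 - w0\<close>; this accounts for one factor of the square.\<close>
  have "w1 - w0 \<le> 1 * deriv G \<zeta>"
    using \<zeta>(3) Gz zz pos[of \<zeta>] by (auto intro!: mult_right_mono)
  then have "exp (- 4 * V) * (w1 - w0) \<le> exp (- 4 * V) * deriv G \<zeta>" by simp
  also have "\<dots> = exp (- 4 * V + ln (deriv G \<zeta>))" using pos by (simp only: exp_add exp_ln)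
  also have "\<dots> \<le> exp (ln (deriv G \<xi>))" using 1 2 by (subst exp_le_cancel_iff) linarith
  also have "\<dots> = deriv G \<xi>" using pos by simp
  finally have "exp (- 4 * V) * (w1 - w0) * (w1 - w0) \<le> deriv G \<xi> * (w1 - w0)"
    using W by (intro mult_right_mono) auto
  then show ?thesis using \<xi>(3) by (simp add: G_def power2_eq_square algebra_simps)
qed

text \<open>If arcs of length at least \<kappa> occurred for arbitrarily large \<open>q\<close>,
  some cell of a fixed grid would lie in return arcs for infinitely many \<open>q\<close>. Its
  iterates would be pairwise disjoint and hence shrink, contradicting
  \<open>return_arc_expands\<close>.\<close>

lemma return_arcs_short:
  assumes inf: "\<And>q0. \<exists>q>q0. \<exists>N p. closest_return \<tau> q N p" and "\<kappa> > 0"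
  shows "\<exists>q0. \<forall>q>q0. \<forall>N p y. closest_return \<tau> q N p \<longrightarrow> (F ^^ q) y - of_int p - y < \<kappa>"
proof (rule ccontr)
  assume neg: "\<not> ?thesis"
  \<comment> \<open>The mesh \<open>1 / m\<close> is less than \<open>\<kappa> / 2\<close>, so that
    an arc of length \<kappa> contains a whole cell.\<close>
  obtain m :: nat where m: "2 / \<kappa> < real m" using reals_Archimedean2 by blast
  then have m0: "real m > 0" using \<open>\<kappa> > 0\<close> by (meson divide_pos_pos less_trans zero_less_numeral)
  have m2: "2 < real m * \<kappa>" using m \<open>\<kappa> > 0\<close> by (simp add: field_simps)
  define w where "w a = real a / real m" for a :: nat
  define P where "P a q \<longleftrightarrow> (\<exists>N p y. closest_return \<tau> q N p \<and> y \<le> w a \<and> w (Suc a) \<le> (F ^^ q) y - of_int p)" for a q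
  have ex: "\<exists>q>q0. \<exists>a<m. P a q" for q0
  proof -
    obtain q N p y where q: "q > q0" "closest_return \<tau> q N p" "\<kappa> \<le> (F ^^ q) y - of_int p - y"
      using neg by (meson not_less)
    \<comment> \<open>First grid index at or to the right of \<open>y\<close>; reduction modulo
      \<open>m\<close> moves the cell into \<open>[0, 1]\<close> by the integer
      \<open>k\<close>.\<close>
    define b where "b = \<lceil>real m * y\<rceil>"
    define k where "k = b div int m"
    define a where "a = nat (b mod int m)"
    have "0 < int m" using m0 by simp
    then have a: "a < m" "int a = b - int m * k"
      by (auto simp: a_def k_def nat_less_iff minus_mult_div_eq_mod)
    have ra: "real a = of_int b - real m * of_int k"
      using a(2) by (metis of_int_diff of_int_mult of_int_of_nat_eq)
    have b: "real m * y \<le> of_int b" "of_int b < real m * y + 1"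
      unfolding b_def by linarith+
    have "P a q"
      unfolding P_def
    proof (intro exI conjI)
      show "closest_return \<tau> q N p" by fact
      have "real m * (y - of_int k) \<le> real a" using b ra by (simp add: algebra_simps)
      then show "y + of_int (- k) \<le> w a" using m0 by (simp add: w_def field_simps)
      have "(F ^^ q) (y + of_int (- k)) = (F ^^ q) y + of_int (- k)" by (rule diffeo_lift_add_int[OF Fn])
      moreover have "real m * (y + \<kappa>) \<le> real m * ((F ^^ q) y - of_int p)"
        using q(3) m0 by (intro mult_left_mono) auto
      then have "real (Suc a) \<le> real m * ((F ^^ q) y - of_int p - of_int k)"
        using b ra m2 by (simp add: algebra_simps)
      then have "w (Suc a) \<le> (F ^^ q) y - of_int p - of_int k"
        using m0 by (simp add: w_def field_simps)
      ultimately show "w (Suc a) \<le> (F ^^ q) (y + of_int (- k)) - of_int p"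
        by simp
    qed
    then show ?thesis using q(1) a(1) by blast
  qed
  \<comment> \<open>Pigeonhole: one of the finitely many cells serves infinitely many
    \<open>q\<close>.\<close>
  have "\<exists>a<m. \<forall>q0. \<exists>q>q0. P a q"
  proof (rule ccontr)
    assume "\<not> ?thesis"
    then obtain b where b: "\<And>a q. a < m \<Longrightarrow> q > b a \<Longrightarrow> \<not> P a q" by metis
    obtain q a where "q > Max (b ` {..<m})" "a < m" "P a q" using ex by blast
    moreover have "b a \<le> Max (b ` {..<m})" using \<open>a < m\<close> by simp
    ultimately show False using b[of a q] by simp
  qed
  then obtain a where a: "\<And>q0. \<exists>q>q0. P a q" by blast
  define l where "l = w (Suc a) - w a"
  have l: "l > 0" using m0 by (simp add: l_def w_def diff_divide_distrib[symmetric])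
  have "m \<noteq> 0" using m0 by simp
  then have l1: "l \<le> 1" by (simp add: l_def w_def diff_divide_distrib[symmetric])
  have "(\<lambda>n. (F ^^ n) (w (Suc a)) - (F ^^ n) (w a)) \<longlonglongrightarrow> 0"
  proof (rule orbit_of_interval_shrinks)
    fix i j :: nat and k :: int assume "i \<noteq> j"
    \<comment> \<open>Beyond \<open>i + j\<close>, every such \<open>q\<close> has \<open>N\<close>
      larger than the time difference, so the arcs around the two iterates are disjoint.\<close>
    obtain q N p y where q: "i + j < q" "closest_return \<tau> q N p" "y \<le> w a" "w (Suc a) \<le> (F ^^ q) y - of_int p"
      using a[of "i + j"] unfolding P_def by blast
    have "i < j + N" "j < i + N" using q(1,2) by (auto simp: closest_return_def)
    from return_arcs_disjoint[OF q(2) \<open>i \<noteq> j\<close> this, of y k]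
    have *: "(F ^^ (i + q)) y - of_int p + of_int k \<le> (F ^^ j) y \<or> (F ^^ (j + q)) y - of_int p \<le> (F ^^ i) y + of_int k" .
    have up: "(F ^^ i) (w (Suc a)) \<le> (F ^^ (i + q)) y - of_int p" for i
    proof -
      have "(F ^^ i) (w (Suc a)) \<le> (F ^^ i) ((F ^^ q) y + of_int (- p))"
        using q(4) by (simp add: diffeo_lift_le_iff[OF Fn])
      then show ?thesis using diffeo_lift_add_int[OF Fn, of i "(F ^^ q) y" "- p"] by (simp add: Fn_add)
    qed
    have lo: "(F ^^ i) y \<le> (F ^^ i) (w a)" for i using q(3) by (simp add: diffeo_lift_le_iff[OF Fn])
    show "(F ^^ i) (w (Suc a)) + of_int k \<le> (F ^^ j) (w a) \<or> (F ^^ j) (w (Suc a)) \<le> (F ^^ i) (w a) + of_int k"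
      using * up[of i] up[of j] lo[of i] lo[of j] by linarith
  qed (use l l1 in \<open>auto simp: l_def\<close>)
  moreover have "exp (- 4 * V) * l\<^sup>2 > 0" using l by simp
  ultimately have "\<forall>\<^sub>F n in sequentially. (F ^^ n) (w (Suc a)) - (F ^^ n) (w a) < exp (- 4 * V) * l\<^sup>2"
    by (rule order_tendstoD(2))
  then obtain n0 where n0: "\<And>n. n \<ge> n0 \<Longrightarrow> (F ^^ n) (w (Suc a)) - (F ^^ n) (w a) < exp (- 4 * V) * l\<^sup>2"
    by (auto simp: eventually_sequentially)
  obtain q N p y where "n0 < q" "closest_return \<tau> q N p" "y \<le> w a" "w (Suc a) \<le> (F ^^ q) y - of_int p"
    using a[of n0] unfolding P_def by blast
  then show False
    using return_arc_expands[of q N p "w a" "w (Suc a)" y] n0[of q] l l1 by (auto simp: l_def)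
qed

end

section \<open>The transfer operator on continuous periodic densities\<close>

definition pcont :: "(real \<Rightarrow> real) \<Rightarrow> bool" where
  "pcont \<psi> \<longleftrightarrow> continuous_on UNIV \<psi> \<and> (\<forall>x. \<psi> (x + 1) = \<psi> x)"

definition l1 :: "(real \<Rightarrow> real) \<Rightarrow> real" where
  "l1 \<psi> = integral {0..1} (\<lambda>x. \<bar>\<psi> x\<bar>)"

text \<open>Pull-back of the density \<psi>: if \<psi> is the derivative of \<open>H\<close>, this
  is the derivative of \<open>H\<close> composed with \<open>G\<close>. Hence integral and L^1 norm
  are preserved.\<close>

definition transfer :: "(real \<Rightarrow> real) \<Rightarrow> (real \<Rightarrow> real) \<Rightarrow> real \<Rightarrow> real" where
  "transfer G \<psi> x = \<psi> (G x) * deriv G x"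

lemma pcontD: "pcont \<psi> \<Longrightarrow> continuous_on UNIV \<psi>" "pcont \<psi> \<Longrightarrow> \<psi> (x + 1) = \<psi> x"
  by (auto simp: pcont_def)

lemma pcont_cont: "pcont \<psi> \<Longrightarrow> continuous_on S \<psi>"
  using pcontD(1) continuous_on_subset by blast

lemma pcont_int: "pcont \<psi> \<Longrightarrow> \<psi> (x + of_int k) = \<psi> x"
  by (rule periodic_int) (auto simp: pcont_def)

lemma pcont_intros:
  "pcont (\<lambda>x. c)"
  "pcont f \<Longrightarrow> pcont g \<Longrightarrow> pcont (\<lambda>x. f x + g x)"
  "pcont f \<Longrightarrow> pcont g \<Longrightarrow> pcont (\<lambda>x. f x - g x)"
  "pcont f \<Longrightarrow> pcont g \<Longrightarrow> pcont (\<lambda>x. f x * g x)"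
  "pcont f \<Longrightarrow> pcont (\<lambda>x. - f x)"
  "pcont f \<Longrightarrow> pcont (\<lambda>x. \<bar>f x\<bar>)"
  "pcont f \<Longrightarrow> pcont g \<Longrightarrow> pcont (\<lambda>x. max (f x) (g x))"
  "(\<And>i. i \<in> I \<Longrightarrow> pcont (h i)) \<Longrightarrow> pcont (\<lambda>x. \<Sum>i\<in>I. h i x)"
  unfolding pcont_def by (auto intro!: continuous_intros sum.cong)

lemma pcont_transfer:
  assumes "diffeo_lift G" "pcont \<psi>" shows "pcont (transfer G \<psi>)"
  unfolding pcont_def
proof (intro conjI allI)
  show "continuous_on UNIV (transfer G \<psi>)"
    unfolding transfer_def[abs_def]
    by (intro continuous_on_mult diffeo_lift_cont_deriv assms
        continuous_on_compose2[OF pcontD(1)[OF assms(2)] diffeo_lift_cont[OF assms(1)]]) auto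
qed (simp add: transfer_def diffeo_lift_add1[OF assms(1)] diffeo_lift_deriv_add1[OF assms(1)] pcontD(2)[OF assms(2)])

lemma pcont_integrable: "pcont \<psi> \<Longrightarrow> \<psi> integrable_on {a..b}"
  by (intro integrable_continuous_interval pcont_cont)

lemma l1_nonneg: "pcont \<psi> \<Longrightarrow> 0 \<le> l1 \<psi>"
  unfolding l1_def by (intro integral_nonneg pcont_integrable pcont_intros) auto

lemma l1_add: "pcont f \<Longrightarrow> pcont g \<Longrightarrow> l1 (\<lambda>x. f x + g x) \<le> l1 f + l1 g"
  unfolding l1_def
  by (subst Henstock_Kurzweil_Integration.integral_add[symmetric])
    (auto intro!: integral_le pcont_integrable pcont_intros)

lemma l1_scale: "l1 (\<lambda>x. c * f x) = \<bar>c\<bar> * l1 f"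
  unfolding l1_def abs_mult by simp

lemma l1_minus: "l1 (\<lambda>x. - f x) = l1 f"
  unfolding l1_def by simp

lemma l1_diff: "pcont f \<Longrightarrow> pcont g \<Longrightarrow> l1 (\<lambda>x. f x - g x) \<le> l1 f + l1 g"
  using l1_add[of f "\<lambda>x. - g x"] by (simp add: pcont_intros l1_minus)

lemma l1_sum:
  "finite I \<Longrightarrow> (\<And>i. i \<in> I \<Longrightarrow> pcont (h i)) \<Longrightarrow> l1 (\<lambda>x. \<Sum>i\<in>I. h i x) \<le> (\<Sum>i\<in>I. l1 (h i))"
proof (induction I rule: finite_induct)
  case empty
  then show ?case by (simp add: l1_def)
next
  case (insert i I)
  have "l1 (\<lambda>x. h i x + (\<Sum>i\<in>I. h i x)) \<le> l1 (h i) + l1 (\<lambda>x. \<Sum>i\<in>I. h i x)"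
    by (intro l1_add pcont_intros insert) (use insert in auto)
  also have "\<dots> \<le> l1 (h i) + (\<Sum>i\<in>I. l1 (h i))"
    by (intro add_left_mono insert.IH) (use insert in auto)
  finally show ?case using insert by simp
qed

lemma antiderivative_exists:
  fixes h :: "real \<Rightarrow> real"
  assumes "continuous_on UNIV h"
  shows "\<exists>H. \<forall>x. (H has_real_derivative h x) (at x)"
  using einterval_antiderivative[of "-\<infinity>" "\<infinity>" h] assms
  by (auto simp: continuous_on_eq_continuous_at has_real_derivative_iff_has_vector_derivative)

lemma integral_antiderivative:
  assumes "\<And>x. (H has_real_derivative h x) (at x)" "a \<le> b"
  shows "(h has_integral (H b - H a)) {a..b}"
  by (rule fundamental_theorem_of_calculus[OF assms(2)])
     (metis assms(1) has_field_derivative_at_within has_real_derivative_iff_has_vector_derivative)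

lemma antiderivative_period:
  assumes "\<And>x. (H has_real_derivative h x) (at x)" "\<And>x. h (x + 1) = h x"
  shows "H (x + 1) - H x = H (y + 1) - H (y::real)"
proof -
  have "((\<lambda>x. H (x + 1) - H x) has_real_derivative h (x + 1) - h x) (at x)" for x
    using assms(1)[of "x + 1"] by (intro DERIV_diff assms(1)) (simp add: DERIV_shift)
  then have "\<forall>x. ((\<lambda>x. H (x + 1) - H x) has_real_derivative 0) (at x)" using assms(2) by simp
  from DERIV_isconst_all[OF this, of x y] show ?thesis .
qed

lemma integral_transfer:
  assumes G: "diffeo_lift G" and \<psi>: "pcont \<psi>"
  shows "integral {0..1} (transfer G \<psi>) = integral {0..1} \<psi>"
proof -
  obtain H where H: "\<And>x. (H has_real_derivative \<psi> x) (at x)"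
    using antiderivative_exists[OF pcontD(1)[OF \<psi>]] by blast
  have "((\<lambda>x. H (G x)) has_real_derivative transfer G \<psi> x) (at x)" for x
    unfolding transfer_def by (rule DERIV_chain2[OF H diffeo_lift_DERIV[OF G]])
  from integral_unique[OF integral_antiderivative[OF this, of 0 1]]
  have "integral {0..1} (transfer G \<psi>) = H (G 0 + 1) - H (G 0)"
    using diffeo_lift_add1[OF G, of 0] by simp
  also have "\<dots> = H (0 + 1) - H 0" by (rule antiderivative_period[OF H pcontD(2)[OF \<psi>]])
  also have "\<dots> = integral {0..1} \<psi>"
    using integral_unique[OF integral_antiderivative[OF H, of 0 1]] by simp
  finally show ?thesis .
qed

lemma l1_transfer:
  assumes "diffeo_lift G" "pcont \<psi>"
  shows "l1 (transfer G \<psi>) = l1 \<psi>"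
proof -
  have "(\<lambda>x. \<bar>transfer G \<psi> x\<bar>) = transfer G (\<lambda>x. \<bar>\<psi> x\<bar>)"
    using diffeo_lift_pos[OF assms(1)] by (auto simp: transfer_def abs_mult less_imp_le)
  then show ?thesis
    unfolding l1_def using integral_transfer[OF assms(1) pcont_intros(6)[OF assms(2)]] by simp
qed

lemma transfer_transfer:
  assumes "diffeo_lift F" "diffeo_lift G"
  shows "transfer F (transfer G \<psi>) = transfer (\<lambda>x. G (F x)) \<psi>"
  by (auto simp: transfer_def diffeo_lift_comp(2)[OF assms(2,1)])

lemma transfer_id: "transfer (\<lambda>x. x) \<psi> = \<psi>" "transfer id \<psi> = \<psi>"
  by (auto simp: transfer_def id_def)

section \<open>Birkhoff sums of the transfer operator and periodic bumps\<close>

definition birkhoff :: "(real \<Rightarrow> real) \<Rightarrow> nat \<Rightarrow> (real \<Rightarrow> real) \<Rightarrow> real \<Rightarrow> real" where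
  "birkhoff F n \<psi> x = (\<Sum>i<n. transfer (F ^^ i) \<psi> x)"

lemma pcont_birkhoff: "diffeo_lift F \<Longrightarrow> pcont \<psi> \<Longrightarrow> pcont (birkhoff F n \<psi>)"
  unfolding birkhoff_def[abs_def] by (intro pcont_intros pcont_transfer diffeo_lift_funpow)

lemma integral_birkhoff:
  assumes "diffeo_lift F" "pcont \<psi>"
  shows "integral {0..1} (birkhoff F n \<psi>) = real n * integral {0..1} \<psi>"
  unfolding birkhoff_def[abs_def]
  by (subst integral_sum)
    (auto simp: integral_transfer diffeo_lift_funpow assms intro!: pcont_integrable pcont_transfer)

lemma birkhoff_linear:
  "birkhoff F n (\<lambda>x. f x + g x) x = birkhoff F n f x + birkhoff F n g x"
  "birkhoff F n (\<lambda>x. f x - g x) x = birkhoff F n f x - birkhoff F n g x"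
  "birkhoff F n (\<lambda>x. c * f x) x = c * birkhoff F n f x"
  by (simp_all add: birkhoff_def transfer_def sum.distrib sum_subtractf sum_distrib_left algebra_simps)

lemma birkhoff_sum:
  "birkhoff F n (\<lambda>x. \<Sum>i\<in>I. h i x) x = (\<Sum>i\<in>I. birkhoff F n (h i) x)"
  unfolding birkhoff_def transfer_def by (subst sum.swap) (simp add: sum_distrib_right)

lemma l1_birkhoff_le:
  assumes "diffeo_lift F" "pcont \<psi>"
  shows "l1 (birkhoff F n \<psi>) \<le> real n * l1 \<psi>"
proof -
  have "l1 (birkhoff F n \<psi>) \<le> (\<Sum>i<n. l1 (transfer (F ^^ i) \<psi>))"
    unfolding birkhoff_def[abs_def] by (intro l1_sum pcont_transfer diffeo_lift_funpow assms) auto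
  then show ?thesis by (simp add: l1_transfer diffeo_lift_funpow assms)
qed

text \<open>The two sums run over index ranges shifted by \<open>i\<close>, so all but
  \<open>i\<close> terms at either end cancel, each of norm \<open>l1 \<psi>\<close>. Being
  independent of \<open>n\<close>, the bound is negligible after division by
  \<open>n\<close>.\<close>

lemma l1_birkhoff_coboundary:
  assumes F: "diffeo_lift F" and \<psi>: "pcont \<psi>"
  shows "l1 (\<lambda>x. birkhoff F n \<psi> x - birkhoff F n (transfer (F ^^ i) \<psi>) x) \<le> 2 * real i * l1 \<psi>"
proof -
  have shift: "birkhoff F (n + i) \<psi> x = birkhoff F n \<psi> x + birkhoff F i (transfer (F ^^ n) \<psi>) x" for n i x
  proof -
    have "transfer (F ^^ j) (transfer (F ^^ n) \<psi>) = transfer (F ^^ (n + j)) \<psi>" for j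
      unfolding transfer_transfer[OF diffeo_lift_funpow[OF F] diffeo_lift_funpow[OF F]] funpow_add
      by (simp add: o_def)
    then show ?thesis by (induction i) (simp_all add: birkhoff_def)
  qed
  have "birkhoff F n \<psi> x - birkhoff F n (transfer (F ^^ i) \<psi>) x
     = birkhoff F i \<psi> x - birkhoff F i (transfer (F ^^ n) \<psi>) x" for x
    using shift[of n i x] shift[of i n x] by (simp add: add.commute)
  then have "l1 (\<lambda>x. birkhoff F n \<psi> x - birkhoff F n (transfer (F ^^ i) \<psi>) x)
     = l1 (\<lambda>x. birkhoff F i \<psi> x - birkhoff F i (transfer (F ^^ n) \<psi>) x)" by simp
  also have "\<dots> \<le> l1 (birkhoff F i \<psi>) + l1 (birkhoff F i (transfer (F ^^ n) \<psi>))"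
    by (intro l1_diff pcont_birkhoff pcont_transfer diffeo_lift_funpow F \<psi>)
  also have "\<dots> \<le> real i * l1 \<psi> + real i * l1 (transfer (F ^^ n) \<psi>)"
    by (intro add_mono l1_birkhoff_le pcont_transfer diffeo_lift_funpow F \<psi>)
  also have "\<dots> = 2 * real i * l1 \<psi>" by (simp add: l1_transfer diffeo_lift_funpow F \<psi>)
  finally show ?thesis .
qed

text \<open>A trapezoid in the distance to the midpoint of \<open>[a, b]\<close>; measuring this
  distance modulo integers, by \<open>d\<close>, makes it periodic.\<close>

lemma periodic_bump:
  fixes a b \<eta> :: real
  assumes "\<eta> > 0"
  obtains \<omega> where "pcont \<omega>" "\<And>x. 0 \<le> \<omega> x" "\<And>x. \<omega> x \<le> 1"
    "\<And>x. \<omega> x \<noteq> 0 \<Longrightarrow> \<exists>k::int. a < x + of_int k \<and> x + of_int k < b"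
    "\<And>x. a + \<eta> \<le> x \<Longrightarrow> x \<le> b - \<eta> \<Longrightarrow> \<omega> x = 1"
proof -
  define d where "d x = \<bar>x - of_int (round x)\<bar>" for x :: real
  have d_le: "d x \<le> \<bar>x - of_int k\<bar>" for x k unfolding d_def by (rule round_diff_minimal)
  have lip: "d x \<le> d y + \<bar>x - y\<bar>" for x y
    using d_le[of x "round y"] unfolding d_def by linarith
  have "1-lipschitz_on UNIV d"
  proof (rule lipschitz_onI)
    show "dist (d x) (d y) \<le> 1 * dist x y" for x y
      using lip[of x y] lip[of y x] by (simp add: dist_real_def abs_minus_commute abs_le_iff)
  qed simp
  then have cont: "continuous_on UNIV d" by (rule lipschitz_on_continuous_on)
  have per: "d (x + 1) = d x" for x
    using d_le[of "x + 1" "round x + 1"] d_le[of x "round (x + 1) - 1"]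
    unfolding d_def by (intro antisym) (auto simp: algebra_simps)
  define c where "c = (a + b) / 2"
  define \<omega> where "\<omega> x = min 1 (max 0 (((b - a) / 2 - d (x - c)) / \<eta>))" for x
  show ?thesis
  proof (rule that[of \<omega>])
    show "pcont \<omega>" unfolding pcont_def \<omega>_def
    proof (intro conjI allI)
      show "continuous_on UNIV (\<lambda>x. min 1 (max 0 (((b - a) / 2 - d (x - c)) / \<eta>)))"
        by (intro continuous_intros continuous_on_compose2[OF cont]) (use assms in auto)
      show "min 1 (max 0 (((b - a) / 2 - d (x + 1 - c)) / \<eta>)) = min 1 (max 0 (((b - a) / 2 - d (x - c)) / \<eta>))" for x
        using per[of "x - c"] by (simp add: algebra_simps)
    qed
    show "0 \<le> \<omega> x" "\<omega> x \<le> 1" for x by (auto simp: \<omega>_def)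
    show "\<exists>k::int. a < x + of_int k \<and> x + of_int k < b" if "\<omega> x \<noteq> 0" for x
    proof (intro exI)
      have "((b - a) / 2 - d (x - c)) / \<eta> > 0" using that unfolding \<omega>_def by linarith
      then have "d (x - c) < (b - a) / 2" using assms by (simp add: zero_less_divide_iff)
      then show "a < x + of_int (- round (x - c)) \<and> x + of_int (- round (x - c)) < b"
        unfolding d_def c_def by (simp add: field_simps) linarith
    qed
    show "\<omega> x = 1" if "a + \<eta> \<le> x" "x \<le> b - \<eta>" for x
    proof -
      have "d (x - c) \<le> \<bar>x - c\<bar>" using d_le[of "x - c" 0] by simp
      also have "\<dots> \<le> (b - a) / 2 - \<eta>" using that unfolding c_def by (simp add: abs_le_iff field_simps)
      finally have "1 \<le> ((b - a) / 2 - d (x - c)) / \<eta>" using assms by (simp add: field_simps)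
      then show ?thesis by (simp add: \<omega>_def)
    qed
  qed
qed

lemma pcont_uniform:
  assumes \<psi>: "pcont \<psi>" and e: "e > 0"
  obtains d where "d > 0" "\<And>x y. \<bar>x - y\<bar> < d \<Longrightarrow> \<bar>\<psi> x - \<psi> y\<bar> < e"
proof -
  have "uniformly_continuous_on {-1..2} \<psi>"
    by (intro compact_uniformly_continuous pcont_cont \<psi>) auto
  then obtain d where d: "d > 0" "\<And>x y. x \<in> {-1..2} \<Longrightarrow> y \<in> {-1..2} \<Longrightarrow> dist y x < d \<Longrightarrow> dist (\<psi> y) (\<psi> x) < e"
    using e unfolding uniformly_continuous_on_def by metis
  show thesis
  proof (rule that[of "min d 1"])
    show "\<bar>\<psi> x - \<psi> y\<bar> < e" if "\<bar>x - y\<bar> < min d 1" for x y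
    proof -
      \<comment> \<open>A common integer translation moves \<open>x\<close> into
        \<open>[0, 1)\<close>, and \<open>y\<close>, at distance below one, then stays in
        \<open>[-1, 2]\<close>.\<close>
      define k where "k = - \<lfloor>x\<rfloor>"
      have "0 \<le> x + of_int k" "x + of_int k < 1" unfolding k_def of_int_minus by linarith+
      then have "dist (\<psi> (x + of_int k)) (\<psi> (y + of_int k)) < e"
        using that by (intro d(2)) (auto simp: dist_real_def)
      then show ?thesis by (simp add: pcont_int[OF \<psi>] dist_real_def)
    qed
  qed (use d in auto)
qed

section \<open>Contraction of the averaged transfer operator\<close>

lemma has_integral_step:
  fixes a b c :: real
  assumes "a \<le> b"
  shows "((\<lambda>x. if x \<in> {a..b} then c else 0) has_integral c * (b - a)) UNIV"
  unfolding has_integral_restrict_UNIV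
  using has_integral_const_real[of c a b] assms by (simp add: mult.commute)

lemma sum_at_most_one_le:
  fixes f :: "'i \<Rightarrow> real"
  assumes "finite I" "0 \<le> B" "\<And>i. i \<in> I \<Longrightarrow> f i \<le> B"
    and "\<And>i j. i \<in> I \<Longrightarrow> j \<in> I \<Longrightarrow> f i \<noteq> 0 \<Longrightarrow> f j \<noteq> 0 \<Longrightarrow> i = j"
  shows "sum f I \<le> B"
proof (cases "\<exists>i\<in>I. f i \<noteq> 0")
  case True
  then obtain i where i: "i \<in> I" "f i \<noteq> 0" by blast
  have "sum f I = sum f {i}"
    by (rule sum.mono_neutral_right) (use assms i in auto)
  then show ?thesis using assms(3)[OF i(1)] by simp
next
  case False
  then show ?thesis using assms(2) by (simp add: sum.neutral)
qed

lemma sum_lessThan_split: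
  fixes f :: "nat \<Rightarrow> real"
  shows "(\<Sum>i<m + n. f i) = (\<Sum>i<m. f i) + (\<Sum>i\<in>{m..<m + n}. f i)"
  using sum.atLeastLessThan_concat[of 0 m "m + n" f] by (simp add: lessThan_atLeast0)

context irrational_lift
begin

text \<open>Among the integer translates of the first \<open>N + q\<close> orbit points at or left
  of \<open>x\<close>, take the rightmost. Another such orbit point follows no later than the end of
  its return arc, so \<open>x\<close> lies on this arc.\<close>

lemma return_arcs_cover:
  assumes cr: "closest_return \<tau> q N p"
  shows "\<exists>i<N + q. \<exists>k::int. (F ^^ i) x0 + of_int k \<le> x \<and> x < (F ^^ (i + q)) x0 - of_int p + of_int k"
proof -
  define k where "k i = \<lfloor>x - (F ^^ i) x0\<rfloor>" for i
  define f where "f i = (F ^^ i) x0 + of_int (k i)" for i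
  have f_le: "f i \<le> x" for i unfolding f_def k_def by linarith
  have maxk: "m \<le> k i" if "(F ^^ i) x0 + of_int m \<le> x" for i m
    unfolding k_def using that by (simp add: le_floor_iff)
  have q: "0 < q" "q < N" using cr by (auto simp: closest_return_def)
  have "Max (f ` {..<N + q}) \<in> f ` {..<N + q}" using q by (intro Max_in) auto
  then obtain i where i: "i < N + q" "f i = Max (f ` {..<N + q})" by auto
  have top: "f j \<le> f i" if "j < N + q" for j unfolding i(2) using that by (intro Max_ge) auto
  define \<delta> where "\<delta> = real q * \<tau> - of_int p"
  have \<delta>: "\<delta> > 0" using cr by (auto simp: closest_return_def \<delta>_def)
  \<comment> \<open>For \<open>i < N\<close> the index \<open>i + q\<close> will do. Otherwise
    \<open>i - N\<close> or \<open>i - N + q\<close> is taken, according to the side of the still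
    closer return at time \<open>N\<close>.\<close>
  have "\<exists>j<N + q. \<exists>m::int. real i * \<tau> < real j * \<tau> + of_int m \<and> real j * \<tau> + of_int m \<le> real (i + q) * \<tau> - of_int p"
  proof (cases "i < N")
    case True
    then show ?thesis using \<delta> unfolding \<delta>_def by (intro exI[of _ "i + q"] conjI exI[of _ "- p"]) (auto simp: algebra_simps)
  next
    case False
    obtain m where m: "\<bar>real N * \<tau> - of_int m\<bar> < \<delta>" using cr by (auto simp: closest_return_def \<delta>_def)
    have "real N * \<tau> \<noteq> of_int m" using irr[of N m] q by auto
    then consider "real N * \<tau> < of_int m" | "real N * \<tau> > of_int m" by linarith
    then show ?thesis
    proof cases
      case 1
      show ?thesis
        using False i(1) q m 1
        by (intro exI[of _ "i - N"] conjI exI[of _ m]) (auto simp: of_nat_diff algebra_simps \<delta>_def abs_if split: if_splits)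
    next
      case 2
      show ?thesis
        using False i(1) q m 2
        by (intro exI[of _ "i - N + q"] conjI exI[of _ "m - p"]) (auto simp: of_nat_diff algebra_simps \<delta>_def abs_if split: if_splits)
    qed
  qed
  then obtain j m where j: "j < N + q" "real i * \<tau> + of_int (- m) < real j * \<tau>"
    "real j * \<tau> + of_int (m + p) \<le> real (i + q) * \<tau>" by (auto simp: algebra_simps)
  have up: "(F ^^ i) x0 + of_int (- m) < (F ^^ j) x0" using orbit_less[OF j(2)] .
  have lo: "(F ^^ j) x0 + of_int (m + p) \<le> (F ^^ (i + q)) x0" using orbit_le[OF j(3)] .
  have "x < (F ^^ j) x0 + of_int (m + k i)"
  proof (rule ccontr)
    assume "\<not> ?thesis"
    then have "m + k i \<le> k j" by (intro maxk) simp
    then have "(F ^^ j) x0 + of_int (m + k i) \<le> f j" unfolding f_def by (simp del: of_int_add)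
    then have "f i < f j" using up unfolding f_def by simp
    then show False using top[OF j(1)] by simp
  qed
  also have "\<dots> \<le> (F ^^ (i + q)) x0 - of_int p + of_int (k i)" using lo by simp
  finally show ?thesis using i(1) f_le[of i] unfolding f_def by blast
qed

text \<open>The covering uses arcs with indices up to \<open>N + q\<close>, beyond \<open>N\<close>;
  composing two stretches of at most \<open>N\<close> iterates doubles the constant.\<close>

lemma distortion_long:
  assumes cr: "closest_return \<tau> q N p" and n: "n \<le> N + N"
    and ab: "x \<le> a" "a \<le> (F ^^ q) x - of_int p" "x \<le> b" "b \<le> (F ^^ q) x - of_int p"
  shows "\<bar>ln (deriv (F ^^ n) a) - ln (deriv (F ^^ n) b)\<bar> \<le> 4 * V"
proof (cases "n \<le> N")
  case True
  then show ?thesis using distortion[OF cr True ab] V0 by linarith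
next
  case False
  then obtain m where m: "n = m + N" "m \<le> N" using n by (metis add.commute add_le_cancel_left le_add_diff_inverse nat_le_linear)
  have ln_split: "ln (deriv (F ^^ n) y) = ln (deriv (F ^^ m) ((F ^^ N) y)) + ln (deriv (F ^^ N) y)" for y
    using diffeo_lift_nz[OF Fn] by (simp add: m(1) deriv_funpow_add[OF F] ln_mult)
  have up: "(F ^^ N) y \<le> (F ^^ q) ((F ^^ N) x) - of_int p" if "y \<le> (F ^^ q) x - of_int p" for y
  proof -
    have "(F ^^ N) y \<le> (F ^^ N) ((F ^^ q) x + of_int (- p))"
      using that by (simp add: diffeo_lift_le_iff[OF Fn])
    then show ?thesis
      using diffeo_lift_add_int[OF Fn, of N "(F ^^ q) x" "- p"] by (simp add: Fn_add add.commute)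
  qed
  have "\<bar>ln (deriv (F ^^ m) ((F ^^ N) a)) - ln (deriv (F ^^ m) ((F ^^ N) b))\<bar> \<le> 2 * V"
    using ab by (intro distortion[OF cr m(2), of "(F ^^ N) x"] up) (auto simp: diffeo_lift_le_iff[OF Fn])
  moreover have "\<bar>ln (deriv (F ^^ N) a) - ln (deriv (F ^^ N) b)\<bar> \<le> 2 * V"
    using distortion[OF cr order.refl ab] .
  ultimately show ?thesis unfolding ln_split by linarith
qed

lemma sum_return_lengths_le_4:
  assumes cr: "closest_return \<tau> q N p"
  shows "(\<Sum>j<N + q. (F ^^ (j + q)) x - of_int p - (F ^^ j) x) \<le> 4"
proof -
  have q: "q < N" using cr by (auto simp: closest_return_def)
  have "(\<Sum>j<N + q. (F ^^ (j + q)) x - of_int p - (F ^^ j) x)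
     = (\<Sum>j<N. (F ^^ (j + q)) x - of_int p - (F ^^ j) x) + (\<Sum>j\<in>{N..<N + q}. (F ^^ (j + q)) x - of_int p - (F ^^ j) x)"
    by (rule sum_lessThan_split)
  also have "\<dots> \<le> 2 + 2"
    by (intro add_mono sum_return_lengths_le[OF cr, of _ 0] sum_return_lengths_le[OF cr, of _ N]) (use q in auto)
  finally show ?thesis by simp
qed

text \<open>An upper Riemann sum over the covering arcs, on each of which \<open>g\<close> exceeds
  its value at the left endpoint by at most \<eta>.\<close>

lemma integral_le_return_arcs:
  assumes cr: "closest_return \<tau> q N p"
    and short: "\<And>x. (F ^^ q) x - of_int p - x < \<kappa>"
    and g: "pcont g" "\<And>x. 0 \<le> g x" "\<And>x y. \<bar>x - y\<bar> < \<kappa> \<Longrightarrow> \<bar>g x - g y\<bar> \<le> \<eta>"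
  shows "integral {0..1} g \<le> 3 * (\<Sum>i<N + q. ((F ^^ (i + q)) x0 - of_int p - (F ^^ i) x0) * (g ((F ^^ i) x0) + \<eta>))"
proof -
  define y where "y i = (F ^^ i) x0" for i
  define z where "z i = (F ^^ (i + q)) x0 - of_int p" for i
  define s where "s i = - \<lfloor>y i\<rfloor>" for i
  have yz: "y i < z i" "z i < y i + \<kappa>" "z i \<le> y i + 1" for i
    using return_gt[OF cr, of i x0] short[of "(F ^^ i) x0"] return_le[OF cr, of i x0] by (auto simp: y_def z_def Fn_add add.commute)
  have \<eta>: "\<eta> \<ge> 0" using g(3)[of 0 0] yz[of 0] by simp
  \<comment> \<open>An arc that starts in \<open>[0, 1)\<close> and has length at most one needs
    only the translations -1, 0 and 1 to account for the points of \<open>[0, 1]\<close>; hence the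
    factor \<open>3\<close>.\<close>
  let ?E = "{-1, 0, 1 :: int}"
  let ?st = "\<lambda>i e x. if x \<in> {y i + of_int (s i + e)..z i + of_int (s i + e)} then g (y i) + \<eta> else 0"
  have 1: "((\<lambda>x. \<Sum>i<N + q. \<Sum>e\<in>?E. ?st i e x) has_integral
      (\<Sum>i<N + q. \<Sum>e\<in>?E. (g (y i) + \<eta>) * ((z i + of_int (s i + e)) - (y i + of_int (s i + e))))) UNIV"
    by (intro has_integral_sum has_integral_step finite_lessThan) (use yz in \<open>auto simp: less_imp_le\<close>)
  have 2: "((\<lambda>x. if x \<in> {0..1} then g x else 0) has_integral integral {0..1} g) UNIV"
    unfolding has_integral_restrict_UNIV using pcont_integrable[OF g(1)] by (rule integrable_integral)
  have "integral {0..1} g \<le> (\<Sum>i<N + q. \<Sum>e\<in>?E. (g (y i) + \<eta>) * ((z i + of_int (s i + e)) - (y i + of_int (s i + e))))"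
  proof (rule has_integral_le[OF 2 1])
    fix x :: real
    have nn: "0 \<le> ?st i e x" for i e using g(2) \<eta> by simp
    show "(if x \<in> {0..1} then g x else 0) \<le> (\<Sum>i<N + q. \<Sum>e\<in>?E. ?st i e x)"
    proof (cases "x \<in> {0..1}")
      case False
      then show ?thesis by (simp only: if_False) (intro sum_nonneg nn)
    next
      case True
      obtain i k where ik: "i < N + q" "y i + of_int k \<le> x" "x < z i + of_int k"
        using return_arcs_cover[OF cr, of x0 x] unfolding y_def z_def by blast
      define e where "e = k - s i"
      have ke: "k = s i + e" by (simp add: e_def)
      have fl: "0 \<le> y i + of_int (s i)" "y i + of_int (s i) < 1"
        unfolding s_def of_int_minus by linarith+
      have "of_int e \<le> (1::real)" "of_int e > (-2::real)"
        using ik fl True yz(3)[of i] unfolding ke by auto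
      then have e: "e \<in> ?E" by auto
      have "\<bar>(x - of_int k) - y i\<bar> < \<kappa>" using ik yz(2)[of i] by (simp add: abs_less_iff)
      from g(3)[OF this] have "g x \<le> g (y i) + \<eta>"
        using pcont_int[OF g(1), of x "- k"] by simp
      also have "\<dots> = ?st i e x" using ik unfolding ke by simp
      also have "\<dots> \<le> (\<Sum>e\<in>?E. ?st i e x)"
        by (rule member_le_sum[OF e]) (use nn in auto)
      also have "\<dots> \<le> (\<Sum>i<N + q. \<Sum>e\<in>?E. ?st i e x)"
        by (rule member_le_sum[where f = "\<lambda>i. \<Sum>e\<in>?E. ?st i e x"], use ik(1) in simp)
          (rule sum_nonneg, rule nn, simp)
      finally show ?thesis using True by simp
    qed
  qed
  also have "\<dots> = 3 * (\<Sum>i<N + q. (z i - y i) * (g (y i) + \<eta>))"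
    unfolding sum_distrib_left by (intro sum.cong) (auto simp: algebra_simps)
  finally show ?thesis unfolding y_def z_def .
qed

text \<open>A fixed bump \<open>\<omega>\<close> on the arc from \<open>0\<close> to its closest return, transported along the orbit, fits
  below any slowly varying density \<open>g\<close> while using up a definite fraction of its mass.\<close>

lemma packing:
  assumes cr: "closest_return \<tau> q N p"
    and l: "l = (F ^^ q) 0 - of_int p"
    and short: "\<And>x. (F ^^ q) x - of_int p - x < \<kappa>"
    and \<omega>: "pcont \<omega>" "\<And>x. 0 \<le> \<omega> x" "\<And>x. \<omega> x \<le> 1"
      "\<And>x. \<omega> x \<noteq> 0 \<Longrightarrow> \<exists>k::int. 0 < x + of_int k \<and> x + of_int k < l"
    and g: "pcont g" "\<And>x. 0 \<le> g x" "\<And>x y. \<bar>x - y\<bar> < \<kappa> \<Longrightarrow> \<bar>g x - g y\<bar> \<le> \<eta>"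
    and \<beta>: "0 \<le> \<beta>" "3 * \<beta> + 24 * \<eta> \<le> integral {0..1} g \<or> \<beta> = 0"
  shows "\<exists>a. (\<forall>i. 0 \<le> a i) \<and> (\<Sum>i<N + q. a i) = exp (- 4 * V) / 2 * \<beta> / l \<and>
    (\<forall>x. (\<Sum>i<N + q. a i * transfer (inv (F ^^ i)) \<omega> x) \<le> g x)"
proof -
  define c where "c = exp (- 4 * V) / 2"
  have c: "c > 0" by (simp add: c_def)
  define y where "y i = (F ^^ i) 0" for i
  define z where "z i = (F ^^ (i + q)) 0 - of_int p" for i
  define L where "L i = z i - y i" for i
  \<comment> \<open>A lower bound for \<open>g\<close> on the arc of index \<open>i\<close>.\<close>
  define b where "b i = max 0 (g (y i) - \<eta>)" for i
  have q: "0 < q" "q < N" using cr by (auto simp: closest_return_def)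
  have L: "0 < L i" "L i < \<kappa>" for i
    using return_gt[OF cr, of i 0] short[of "(F ^^ i) 0"] by (auto simp: L_def y_def z_def Fn_add add.commute)
  have l0: "l > 0" using L(1)[of 0] by (simp add: L_def y_def z_def l)
  have \<eta>: "\<eta> \<ge> 0" using g(3)[of 0 0] L[of 0] by simp
  have z_eq: "z i = (F ^^ i) l" for i
    unfolding l z_def using diffeo_lift_add_int[OF Fn, of i "(F ^^ q) 0" "- p"] by (simp add: Fn_add)
  define s where "s = (\<Sum>i<N + q. L i * b i)"
  have b0: "0 \<le> b i" for i by (simp add: b_def)
  have s0: "0 \<le> s" unfolding s_def by (intro sum_nonneg mult_nonneg_nonneg b0 less_imp_le[OF L(1)])
  have \<beta>s: "\<beta> \<le> s"
  proof (cases "\<beta> = 0")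
    case False
    \<comment> \<open>The arcs have total length at most \<open>4\<close>, so replacing
      \<open>g (y i) + \<eta>\<close> by \<open>b i\<close> costs 3 times \<open>2 * \<eta>\<close>
      times 4, the \<open>24 * \<eta>\<close> of the hypothesis.\<close>
    have "integral {0..1} g \<le> 3 * (\<Sum>i<N + q. L i * (g (y i) + \<eta>))"
      unfolding L_def y_def z_def by (rule integral_le_return_arcs[OF cr short g])
    also have "\<dots> \<le> 3 * (\<Sum>i<N + q. L i * b i + 2 * \<eta> * L i)"
    proof -
      have "L i * (g (y i) + \<eta>) \<le> L i * (b i + 2 * \<eta>)" for i
        using L(1)[of i] by (intro mult_left_mono) (auto simp: b_def)
      then show ?thesis by (intro mult_left_mono sum_mono) (auto simp: algebra_simps)
    qed
    also have "\<dots> = 3 * s + 6 * \<eta> * (\<Sum>i<N + q. L i)"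
      by (simp add: s_def sum.distrib sum_distrib_left mult.assoc)
    also have "\<dots> \<le> 3 * s + 6 * \<eta> * 4"
      using sum_return_lengths_le_4[OF cr, of 0] \<eta> unfolding L_def y_def z_def
      by (intro add_left_mono mult_left_mono) auto
    finally show ?thesis using \<beta> False by auto
  qed (use s0 in simp)
  \<comment> \<open>\<open>t\<close> makes the total exactly proportional to \<beta>, so that
    applications to two different densities give equal totals.\<close>
  define t where "t = \<beta> / s"
  have t: "0 \<le> t" "t \<le> 1" "s * t = \<beta>"
    using \<beta>(1) \<beta>s s0 by (auto simp: t_def divide_le_eq_1)
  \<comment> \<open>By bounded distortion the transported bump has height at most
    \<open>exp (4 * V) * l / L i\<close>; the weight lowers this to \<open>b i / 2\<close>.\<close>
  define a where "a i = c * (L i / l) * b i * t" for i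
  have a0: "0 \<le> a i" for i
    unfolding a_def using c L(1)[of i] l0 b0[of i] t by simp
  define w where "w i x = a i * transfer (inv (F ^^ i)) \<omega> x" for i x
  have w0: "0 \<le> w i x" for i x
    unfolding w_def transfer_def using a0 \<omega>(2) diffeo_lift_pos[OF diffeo_lift_inv(1)[OF Fn], of i]
    by (simp add: less_imp_le)
  have w_supp: "\<exists>k::int. y i < x + of_int k \<and> x + of_int k < z i \<and> w i x \<le> b i / 2"
    if nz: "w i x \<noteq> 0" and iN: "i < N + q" for i x
  proof -
    define u where "u = inv (F ^^ i) x"
    have x: "(F ^^ i) u = x" by (simp add: u_def diffeo_lift_inv_apply[OF Fn])
    have "\<omega> u \<noteq> 0" using nz by (auto simp: w_def transfer_def u_def)
    then obtain k where k: "0 < u + of_int k" "u + of_int k < l" using \<omega>(4) by blast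
    have xk: "x + of_int k = (F ^^ i) (u + of_int k)" using diffeo_lift_add_int[OF Fn, of i u k] x by simp
    have 1: "y i < x + of_int k" "x + of_int k < z i"
      unfolding xk y_def z_eq using k by (simp_all add: diffeo_lift_less_iff[OF Fn])
    obtain \<xi> where \<xi>: "0 < \<xi>" "\<xi> < l" "(F ^^ i) l - (F ^^ i) 0 = (l - 0) * deriv (F ^^ i) \<xi>"
      using MVT2[OF l0, of "F ^^ i" "deriv (F ^^ i)"] diffeo_lift_DERIV[OF Fn] by blast
    have pos: "0 < deriv (F ^^ i) v" for v by (rule diffeo_lift_pos[OF Fn])
    have "\<bar>ln (deriv (F ^^ i) \<xi>) - ln (deriv (F ^^ i) (u + of_int k))\<bar> \<le> 4 * V"
      using \<xi> k iN q by (intro distortion_long[OF cr, of i 0]) (auto simp: l)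
    then have "exp (ln (deriv (F ^^ i) \<xi>)) \<le> exp (4 * V + ln (deriv (F ^^ i) (u + of_int k)))"
      by (subst exp_le_cancel_iff) linarith
    then have "deriv (F ^^ i) \<xi> \<le> exp (4 * V) * deriv (F ^^ i) (u + of_int k)"
      using pos by (simp only: exp_add exp_ln)
    moreover have "deriv (F ^^ i) (u + of_int k) = deriv (F ^^ i) u"
      by (rule periodic_int) (rule diffeo_lift_deriv_add1[OF Fn])
    moreover have "L i / l = deriv (F ^^ i) \<xi>"
      using \<xi>(3) l0 by (simp add: L_def z_eq y_def field_simps)
    ultimately have "L i / l \<le> exp (4 * V) * deriv (F ^^ i) u" by simp
    then have "exp (- 4 * V) * (L i / l) \<le> exp (- 4 * V) * (exp (4 * V) * deriv (F ^^ i) u)"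
      by (intro mult_left_mono) auto
    also have "\<dots> = deriv (F ^^ i) u" by (simp add: mult.assoc[symmetric] exp_add[symmetric])
    finally have le: "exp (- 4 * V) * (L i / l) / deriv (F ^^ i) u \<le> 1"
      by (subst divide_le_eq_1_pos[OF pos])
    have "w i x = (exp (- 4 * V) * (L i / l) / deriv (F ^^ i) u) * (\<omega> u * t) * (b i / 2)"
      by (simp add: w_def a_def c_def transfer_def u_def diffeo_lift_inv(2)[OF Fn] ac_simps)
    also have "\<dots> \<le> 1 * (1 * 1) * (b i / 2)"
      by (intro mult_mono le) (use \<omega>(2,3) t b0 L(1)[of i] l0 pos in \<open>auto simp: less_imp_le intro!: mult_le_one\<close>)
    finally show ?thesis using 1 by auto
  qed
  have w_le: "w i x \<le> g x / 2" if iN: "i < N + q" for i x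
  proof (cases "w i x = 0")
    case False
    from w_supp[OF this iN] obtain k :: int where
      k: "y i < x + of_int k" "x + of_int k < z i" "w i x \<le> b i / 2" by blast
    have "\<bar>(x + of_int k) - y i\<bar> < \<kappa>" using k L(2)[of i] unfolding L_def by (simp add: abs_less_iff)
    from g(3)[OF this] have "g (y i) - \<eta> \<le> g x" using pcont_int[OF g(1), of x k] by simp
    then have "b i \<le> g x" using g(2)[of x] by (simp add: b_def)
    then show ?thesis using k(3) by simp
  qed (use g(2) in simp)
  \<comment> \<open>Among \<open>N\<close> consecutive indices the arcs are disjoint, so at most one
    term is nonzero. Two such blocks exhaust the indices, whence the \<open>1 / 2\<close> in the
    weights.\<close>
  have block: "(\<Sum>i\<in>J. w i x) \<le> g x / 2" if J: "J \<subseteq> {m..<m + N}" "J \<subseteq> {..<N + q}" for J m x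
  proof (rule sum_at_most_one_le)
    show "finite J" using J finite_subset by blast
    show "w i x \<le> g x / 2" if "i \<in> J" for i using w_le J that by blast
    fix i j assume ij: "i \<in> J" "j \<in> J" "w i x \<noteq> 0" "w j x \<noteq> 0"
    show "i = j"
    proof (rule ccontr)
      assume "i \<noteq> j"
      obtain k where k: "y i < x + of_int k" "x + of_int k < z i" using w_supp[OF ij(3)] ij(1) J by blast
      obtain k' where k': "y j < x + of_int k'" "x + of_int k' < z j" using w_supp[OF ij(4)] ij(2) J by blast
      have "i \<in> {m..<m + N}" "j \<in> {m..<m + N}" using ij J by blast+
      then have "i < j + N" "j < i + N" by auto
      from return_arcs_disjoint[OF cr \<open>i \<noteq> j\<close> this, of 0 "k' - k"]
      have "z i + of_int (k' - k) \<le> y j \<or> z j \<le> y i + of_int (k' - k)" by (simp add: y_def z_def)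
      then show False using k k' by auto
    qed
  qed (use g(2) in simp)
  have "(\<Sum>i<N + q. w i x) \<le> g x" for x
  proof -
    have "(\<Sum>i<N + q. w i x) = (\<Sum>i<N. w i x) + (\<Sum>i\<in>{N..<N + q}. w i x)"
      by (rule sum_lessThan_split)
    also have "\<dots> \<le> g x / 2 + g x / 2"
      by (intro add_mono block[of _ 0] block[of _ N]) (use q in auto)
    finally show ?thesis by simp
  qed
  moreover have "(\<Sum>i<N + q. a i) = c * \<beta> / l"
  proof -
    have "(\<Sum>i<N + q. a i) = (c * t / l) * s"
      unfolding s_def sum_distrib_left a_def by (intro sum.cong) (auto simp: field_simps)
    then show ?thesis using t(3) by (simp add: mult.assoc mult.commute[of t])
  qed
  ultimately show ?thesis using a0 unfolding c_def[symmetric] w_def by blast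
qed

text \<open>Each part of \<psi> has mass \<open>l1 \<psi> / 2\<close>, and \<beta> is a third of
  this up to errors. With weight \<open>exp (- 4 * V) / 2\<close> and a bump of mass at least
  \<open>l / 2\<close>, the masses removed from both parts add up to a fraction
  \<open>exp (- 4 * V) / 12\<close> of \<open>l1 \<psi>\<close>. The removed difference is a
  coboundary.\<close>

lemma contraction:
  assumes inf: "\<And>q0. \<exists>q>q0. \<exists>N p. closest_return \<tau> q N p"
    and \<psi>: "pcont \<psi>" "integral {0..1} \<psi> = 0" and \<epsilon>: "\<epsilon> > 0"
  shows "\<exists>r C. pcont r \<and> l1 r \<le> (1 - exp (- 4 * V) / 12) * l1 \<psi> + \<epsilon> \<and>
    (\<forall>n. l1 (birkhoff F n (\<lambda>x. \<psi> x - r x)) \<le> C)"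
proof -
  \<comment> \<open>The error \<open>24 * \<eta>\<close>, divided by \<open>3\<close>, is then
    \<epsilon>.\<close>
  define \<eta> where "\<eta> = \<epsilon> / 8"
  have \<eta>: "\<eta> > 0" using \<epsilon> by (simp add: \<eta>_def)
  obtain \<kappa> where \<kappa>: "\<kappa> > 0" "\<And>x y. \<bar>x - y\<bar> < \<kappa> \<Longrightarrow> \<bar>\<psi> x - \<psi> y\<bar> < \<eta>"
    using pcont_uniform[OF \<psi>(1) \<eta>] by metis
  obtain q N p where cr: "closest_return \<tau> q N p" and short: "\<And>x. (F ^^ q) x - of_int p - x < \<kappa>"
    using return_arcs_short[OF inf \<kappa>(1)] inf by metis
  define l where "l = (F ^^ q) 0 - of_int p"
  have l0: "l > 0" using return_gt[OF cr, of 0 0] by (simp add: l_def)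
  have l1: "l \<le> 1" using return_le[OF cr, of 0 0] by (simp add: l_def)
  have "l / 4 > 0" using l0 by simp
  then obtain \<omega> where \<omega>: "pcont \<omega>" "\<And>x. 0 \<le> \<omega> x" "\<And>x. \<omega> x \<le> 1"
    "\<And>x. \<omega> x \<noteq> 0 \<Longrightarrow> \<exists>k::int. 0 < x + of_int k \<and> x + of_int k < l"
    "\<And>x. 0 + l / 4 \<le> x \<Longrightarrow> x \<le> l - l / 4 \<Longrightarrow> \<omega> x = 1"
    using periodic_bump[where a = 0 and b = l] by metis
  have int\<omega>: "l / 2 \<le> integral {0..1} \<omega>"
  proof -
    have "l / 2 = integral {l / 4..l - l / 4} (\<lambda>x. 1 :: real)" using l0 by simp
    also have "\<dots> = integral {l / 4..l - l / 4} \<omega>"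
      by (rule Henstock_Kurzweil_Integration.integral_cong) (use \<omega>(5) in auto)
    also have "\<dots> \<le> integral {0..1} \<omega>"
      by (rule integral_subset_le) (use l0 l1 \<omega> in \<open>auto intro: pcont_integrable\<close>)
    finally show ?thesis .
  qed
  define \<psi>p where "\<psi>p x = max 0 (\<psi> x)" for x
  define \<psi>m where "\<psi>m x = max 0 (- \<psi> x)" for x
  have pp: "pcont \<psi>p" "pcont \<psi>m" unfolding \<psi>p_def[abs_def] \<psi>m_def[abs_def] by (intro pcont_intros \<psi>)+
  have osc: "\<bar>\<psi>p x - \<psi>p y\<bar> \<le> \<eta>" "\<bar>\<psi>m x - \<psi>m y\<bar> \<le> \<eta>" if "\<bar>x - y\<bar> < \<kappa>" for x y
    using \<kappa>(2)[OF that] by (auto simp: \<psi>p_def \<psi>m_def)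
  have nn: "0 \<le> \<psi>p x" "0 \<le> \<psi>m x" for x by (auto simp: \<psi>p_def \<psi>m_def)
  have "integral {0..1} \<psi> = integral {0..1} (\<lambda>x. \<psi>p x - \<psi>m x)"
    by (rule arg_cong[where f = "integral {0..1}"]) (auto simp: \<psi>p_def \<psi>m_def)
  also have "\<dots> = integral {0..1} \<psi>p - integral {0..1} \<psi>m"
    by (intro Henstock_Kurzweil_Integration.integral_diff pcont_integrable pp)
  finally have eq: "integral {0..1} \<psi>m = integral {0..1} \<psi>p" using \<psi>(2) by simp
  have "l1 \<psi> = integral {0..1} (\<lambda>x. \<psi>p x + \<psi>m x)"
    unfolding l1_def by (rule arg_cong[where f = "integral {0..1}"]) (auto simp: \<psi>p_def \<psi>m_def)
  also have "\<dots> = integral {0..1} \<psi>p + integral {0..1} \<psi>m"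
    by (intro Henstock_Kurzweil_Integration.integral_add pcont_integrable pp)
  finally have half: "integral {0..1} \<psi>p = l1 \<psi> / 2" "integral {0..1} \<psi>m = l1 \<psi> / 2" using eq by simp_all
  \<comment> \<open>\<beta> vanishes when \<open>l1 \<psi>\<close> is so small that the error term
    \<epsilon> absorbs the missing gain.\<close>
  define \<beta> where "\<beta> = max 0 ((l1 \<psi> / 2 - 24 * \<eta>) / 3)"
  have "\<beta> = 0 \<or> \<beta> = (l1 \<psi> / 2 - 24 * \<eta>) / 3" unfolding \<beta>_def max_def by presburger
  moreover have "3 * ((l1 \<psi> / 2 - 24 * \<eta>) / 3) + 24 * \<eta> \<le> l1 \<psi> / 2" by (simp add: diff_divide_distrib)
  ultimately have \<beta>: "0 \<le> \<beta>" "3 * \<beta> + 24 * \<eta> \<le> l1 \<psi> / 2 \<or> \<beta> = 0"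
    by (metis \<beta>_def max.cobounded1, metis)
  have \<beta>': "3 * \<beta> + 24 * \<eta> \<le> integral {0..1} \<psi>p \<or> \<beta> = 0"
    "3 * \<beta> + 24 * \<eta> \<le> integral {0..1} \<psi>m \<or> \<beta> = 0"
    unfolding half by (rule \<beta>(2))+
  define c where "c = exp (- 4 * V) / 2"
  let ?w = "\<lambda>i. transfer (inv (F ^^ i)) \<omega>"
  obtain a where a: "\<And>i. 0 \<le> a i" "(\<Sum>i<N + q. a i) = c * \<beta> / l" "\<And>x. (\<Sum>i<N + q. a i * ?w i x) \<le> \<psi>p x"
    using packing[OF cr l_def short \<omega>(1-4) pp(1) nn(1) osc(1) \<beta>(1) \<beta>'(1)]
    unfolding c_def by blast
  obtain b where b: "\<And>i. 0 \<le> b i" "(\<Sum>i<N + q. b i) = c * \<beta> / l" "\<And>x. (\<Sum>i<N + q. b i * ?w i x) \<le> \<psi>m x"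
    using packing[OF cr l_def short \<omega>(1-4) pp(2) nn(2) osc(2) \<beta>(1) \<beta>'(2)]
    unfolding c_def by blast
  have w: "pcont (?w i)" for i by (intro pcont_transfer diffeo_lift_inv Fn \<omega>)
  have w0: "0 \<le> ?w i x" for i x
    unfolding transfer_def using \<omega>(2) diffeo_lift_pos[OF diffeo_lift_inv(1)[OF Fn], of i] by (simp add: less_imp_le)
  define A where "A x = (\<Sum>i<N + q. a i * ?w i x)" for x
  define B where "B x = (\<Sum>i<N + q. b i * ?w i x)" for x
  have AB: "pcont A" "pcont B" unfolding A_def[abs_def] B_def[abs_def] by (intro pcont_intros w)+
  have AB0: "0 \<le> A x" "0 \<le> B x" for x
    unfolding A_def B_def by (intro sum_nonneg mult_nonneg_nonneg a b w0)+
  define r where "r x = \<psi> x - (A x - B x)" for x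
  have r: "pcont r" unfolding r_def[abs_def] by (intro pcont_intros AB \<psi>)
  have abs_r: "\<bar>r x\<bar> \<le> \<bar>\<psi> x\<bar> - A x - B x" for x
    using a(3)[of x] b(3)[of x] AB0[of x] unfolding A_def[symmetric] B_def[symmetric] r_def \<psi>p_def \<psi>m_def
    by (auto simp: max_def split: if_splits)
  have int_comb: "c * \<beta> / 2 \<le> integral {0..1} (\<lambda>x. \<Sum>i<N + q. a i * ?w i x)"
    if "(\<Sum>i<N + q. a i) = c * \<beta> / l" "\<And>i. 0 \<le> a i" for a
  proof -
    have "c * \<beta> / 2 = c * \<beta> / l * (l / 2)" using l0 by simp
    also have "\<dots> \<le> c * \<beta> / l * integral {0..1} \<omega>"
      using int\<omega> \<beta>(1) l0 by (intro mult_left_mono) (auto simp: c_def)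
    also have "\<dots> = (\<Sum>i<N + q. a i * integral {0..1} (?w i))"
      unfolding that(1)[symmetric] sum_distrib_right
      by (simp add: integral_transfer[OF diffeo_lift_inv(1)[OF Fn] \<omega>(1)])
    also have "\<dots> = (\<Sum>i<N + q. integral {0..1} (\<lambda>x. a i * ?w i x))" by simp
    also have "\<dots> = integral {0..1} (\<lambda>x. \<Sum>i<N + q. a i * ?w i x)"
      by (rule integral_sum[symmetric]) (auto intro!: pcont_integrable pcont_intros w)
    finally show ?thesis .
  qed
  have "l1 r \<le> integral {0..1} (\<lambda>x. \<bar>\<psi> x\<bar> - A x - B x)"
    unfolding l1_def by (intro integral_le pcont_integrable pcont_intros r AB \<psi> abs_r)
  also have "\<dots> = l1 \<psi> - integral {0..1} A - integral {0..1} B"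
    unfolding l1_def
    by (subst Henstock_Kurzweil_Integration.integral_diff, intro pcont_integrable pcont_intros \<psi> AB, intro pcont_integrable AB,
        subst Henstock_Kurzweil_Integration.integral_diff, intro pcont_integrable pcont_intros \<psi>, intro pcont_integrable AB, rule refl)
  also have "\<dots> \<le> l1 \<psi> - c * \<beta>"
    using int_comb[OF a(2,1)] int_comb[OF b(2,1)] unfolding A_def[symmetric] B_def[symmetric] by simp
  also have "\<dots> \<le> l1 \<psi> - c * ((l1 \<psi> / 2 - 24 * \<eta>) / 3)"
    by (intro diff_left_mono mult_left_mono) (auto simp: c_def \<beta>_def)
  also have "\<dots> = (1 - exp (- 4 * V) / 12) * l1 \<psi> + c * \<epsilon>"
    by (simp add: c_def \<eta>_def algebra_simps diff_divide_distrib)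
  also have "c * \<epsilon> \<le> 1 * \<epsilon>"
    using V0 \<epsilon> by (intro mult_right_mono) (auto simp: c_def intro: order.trans[of _ 1])
  finally have l1r: "l1 r \<le> (1 - exp (- 4 * V) / 12) * l1 \<psi> + \<epsilon>" by simp
  define C where "C = (\<Sum>i<N + q. \<bar>a i - b i\<bar> * (2 * real i * l1 (?w i)))"
  have "l1 (birkhoff F n (\<lambda>x. \<psi> x - r x)) \<le> C" for n
  proof -
    \<comment> \<open>Transfer by \<open>F ^^ i\<close> turns \<open>?w i\<close> back into
      \<omega>, so both differ by a coboundary; as \<open>a\<close> and \<open>b\<close> have equal
      sums, \<omega> itself drops out.\<close>
    have tr: "transfer (F ^^ i) (?w i) = \<omega>" for i
      unfolding transfer_transfer[OF Fn diffeo_lift_inv(1)[OF Fn]] diffeo_lift_inv_apply[OF Fn]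
      by (rule transfer_id)
    have "birkhoff F n (\<lambda>x. \<psi> x - r x) x =
       (\<Sum>i<N + q. (a i - b i) * (birkhoff F n (?w i) x - birkhoff F n \<omega> x))" for x
    proof -
      have "(\<lambda>x. \<psi> x - r x) = (\<lambda>x. \<Sum>i<N + q. (a i - b i) * ?w i x)"
        unfolding r_def A_def B_def by (simp add: sum_subtractf left_diff_distrib)
      then have "birkhoff F n (\<lambda>x. \<psi> x - r x) x = (\<Sum>i<N + q. (a i - b i) * birkhoff F n (?w i) x)"
        by (simp only: birkhoff_sum birkhoff_linear(3))
      moreover have "(\<Sum>i<N + q. (a i - b i) * birkhoff F n \<omega> x) = 0"
        unfolding sum_distrib_right[symmetric] sum_subtractf a(2) b(2) by simp
      ultimately show ?thesis by (simp add: right_diff_distrib sum_subtractf)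
    qed
    then have "l1 (birkhoff F n (\<lambda>x. \<psi> x - r x)) =
       l1 (\<lambda>x. \<Sum>i<N + q. (a i - b i) * (birkhoff F n (?w i) x - birkhoff F n \<omega> x))" by presburger
    also have "\<dots> \<le> (\<Sum>i<N + q. l1 (\<lambda>x. (a i - b i) * (birkhoff F n (?w i) x - birkhoff F n \<omega> x)))"
      by (intro l1_sum pcont_intros pcont_birkhoff F w \<omega>) auto
    also have "\<dots> \<le> C"
      unfolding C_def l1_scale
    proof (intro sum_mono mult_left_mono)
      show "l1 (\<lambda>x. birkhoff F n (?w i) x - birkhoff F n \<omega> x) \<le> 2 * real i * l1 (?w i)" for i
        using l1_birkhoff_coboundary[OF F w, of n i i] unfolding tr .
    qed auto
    finally show ?thesis .
  qed
  then show ?thesis using r l1r by blast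
qed

text \<open>The average over time \<open>m\<close> differs from \<psi> by a coboundary, so
  contracting it bounds the upper limit of \<open>f\<close> by \<open>(1 - c) * f m\<close>, up to
  small errors. With \<open>f m\<close> near the infimum \<open>L\<close> this gives
  \<open>L \<le> (1 - c) * L\<close>, hence \<open>L = 0\<close>.\<close>

lemma birkhoff_sublinear:
  assumes inf: "\<And>q0. \<exists>q>q0. \<exists>N p. closest_return \<tau> q N p"
    and \<psi>: "pcont \<psi>" "integral {0..1} \<psi> = 0" and e: "e > 0"
  shows "\<exists>n0. \<forall>n\<ge>n0. l1 (birkhoff F n \<psi>) \<le> e * real n"
proof -
  define c where "c = exp (- 4 * V) / 12"
  have c: "0 < c" "c < 1" using V0 by (auto simp: c_def intro: le_less_trans[of _ 1])
  define f where "f n = l1 (birkhoff F n \<psi>) / real n" for n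
  have f0: "0 \<le> f n" for n unfolding f_def by (intro divide_nonneg_nonneg l1_nonneg pcont_birkhoff F \<psi>) auto
  have key: "\<exists>n0. \<forall>n\<ge>n0. f n \<le> (1 - c) * f m + 2 * \<epsilon>" if m: "m > 0" and \<epsilon>: "\<epsilon> > 0" for m \<epsilon>
  proof -
    define \<psi>' where "\<psi>' x = 1 / real m * birkhoff F m \<psi> x" for x
    have \<psi>': "pcont \<psi>'" "integral {0..1} \<psi>' = 0"
      unfolding \<psi>'_def[abs_def]
      by (intro pcont_intros pcont_birkhoff F \<psi>(1)) (simp add: integral_birkhoff[OF F \<psi>(1)] \<psi>(2))
    have l1\<psi>': "l1 \<psi>' = f m" using m unfolding \<psi>'_def[abs_def] l1_scale f_def by simp
    obtain r C where r: "pcont r" "l1 r \<le> (1 - c) * l1 \<psi>' + \<epsilon>"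
      "\<And>n. l1 (birkhoff F n (\<lambda>x. \<psi>' x - r x)) \<le> C"
      using contraction[OF inf \<psi>' \<epsilon>] unfolding c_def by blast
    \<comment> \<open>Bounds the coboundary between \<psi> and its average: transfer by
      \<open>F ^^ i\<close> with \<open>i < m\<close> costs at most
      \<open>2 * real i * l1 \<psi>\<close>.\<close>
    define D where "D = 2 * real m * l1 \<psi>"
    have diff: "l1 (\<lambda>x. birkhoff F n \<psi> x - birkhoff F n \<psi>' x) \<le> D" for n
    proof -
      have "\<psi>' = (\<lambda>x. \<Sum>i<m. 1 / real m * transfer (F ^^ i) \<psi> x)"
        by (simp add: \<psi>'_def[abs_def] birkhoff_def sum_divide_distrib)
      then have "birkhoff F n \<psi>' x = (\<Sum>i<m. 1 / real m * birkhoff F n (transfer (F ^^ i) \<psi>) x)" for x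
        by (simp only: birkhoff_sum birkhoff_linear(3))
      moreover have "birkhoff F n \<psi> x = (\<Sum>i<m. 1 / real m * birkhoff F n \<psi> x)" for x
        using m by simp
      ultimately have "birkhoff F n \<psi> x - birkhoff F n \<psi>' x =
        (\<Sum>i<m. 1 / real m * (birkhoff F n \<psi> x - birkhoff F n (transfer (F ^^ i) \<psi>) x))" for x
        by (simp only: right_diff_distrib sum_subtractf)
      then have "l1 (\<lambda>x. birkhoff F n \<psi> x - birkhoff F n \<psi>' x) =
        l1 (\<lambda>x. \<Sum>i<m. 1 / real m * (birkhoff F n \<psi> x - birkhoff F n (transfer (F ^^ i) \<psi>) x))" by presburger
      also have "\<dots> \<le> (\<Sum>i<m. l1 (\<lambda>x. 1 / real m * (birkhoff F n \<psi> x - birkhoff F n (transfer (F ^^ i) \<psi>) x)))"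
        by (intro l1_sum pcont_intros pcont_birkhoff pcont_transfer F Fn \<psi>) auto
      also have "\<dots> \<le> (\<Sum>i<m. 1 / real m * D)"
        unfolding l1_scale
      proof (intro sum_mono mult_mono)
        fix i assume "i \<in> {..<m}"
        have "l1 (\<lambda>x. birkhoff F n \<psi> x - birkhoff F n (transfer (F ^^ i) \<psi>) x) \<le> 2 * real i * l1 \<psi>"
          by (rule l1_birkhoff_coboundary[OF F \<psi>(1)])
        also have "\<dots> \<le> D" unfolding D_def using \<open>i \<in> {..<m}\<close> l1_nonneg[OF \<psi>(1)] by (intro mult_mono) auto
        finally show "l1 (\<lambda>x. birkhoff F n \<psi> x - birkhoff F n (transfer (F ^^ i) \<psi>) x) \<le> D" .
      qed (auto intro!: l1_nonneg pcont_intros pcont_birkhoff pcont_transfer F Fn \<psi>)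
      also have "\<dots> = D" using m by simp
      finally show ?thesis .
    qed
    have bound: "l1 (birkhoff F n \<psi>) \<le> real n * ((1 - c) * f m + \<epsilon>) + (C + D)" for n
    proof -
      have eq: "birkhoff F n \<psi> = (\<lambda>x. (birkhoff F n \<psi> x - birkhoff F n \<psi>' x)
          + (birkhoff F n (\<lambda>x. \<psi>' x - r x) x + birkhoff F n r x))"
        by (simp add: birkhoff_linear(2))
      have "l1 (birkhoff F n \<psi>) \<le> l1 (\<lambda>x. birkhoff F n \<psi> x - birkhoff F n \<psi>' x)
          + l1 (\<lambda>x. birkhoff F n (\<lambda>x. \<psi>' x - r x) x + birkhoff F n r x)"
        by (subst eq) (intro l1_add pcont_intros pcont_birkhoff F \<psi> \<psi>' r)
      also have "\<dots> \<le> D + (C + real n * l1 r)"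
        by (intro add_mono diff order.trans[OF l1_add] r l1_birkhoff_le pcont_intros pcont_birkhoff F \<psi>')
      also have "\<dots> \<le> D + (C + real n * ((1 - c) * f m + \<epsilon>))"
        using r(2) unfolding l1\<psi>' by (intro add_mono mult_left_mono) auto
      finally show ?thesis by simp
    qed
    obtain n1 :: nat where n1: "(C + D) / \<epsilon> < real n1" using reals_Archimedean2 by blast
    show ?thesis
    proof (intro exI[of _ "Suc n1"] allI impI)
      fix n assume n: "Suc n1 \<le> n"
      then have "(C + D) / \<epsilon> < real n" using n1 by (simp add: less_le_trans)
      then have "C + D < \<epsilon> * real n" using \<epsilon> by (simp add: field_simps)
      then have "l1 (birkhoff F n \<psi>) \<le> ((1 - c) * f m + 2 * \<epsilon>) * real n"
        using bound[of n] by (simp add: algebra_simps)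
      then show "f n \<le> (1 - c) * f m + 2 * \<epsilon>" using n unfolding f_def[of n] by (simp add: divide_le_eq)
    qed
  qed
  define L where "L = Inf (f ` {1..})"
  have bdd: "bdd_below (f ` {1..})" using f0 by (intro bdd_belowI[of _ 0]) auto
  have L0: "0 \<le> L" unfolding L_def using f0 by (intro cInf_greatest) auto
  have Lle: "L \<le> f n" if "n \<ge> 1" for n unfolding L_def using that by (intro cInf_lower bdd) auto
  have near: "\<exists>m>0. f m < L + \<epsilon>" if "\<epsilon> > 0" for \<epsilon>
  proof -
    have ne: "f ` {1..} \<noteq> {}" by simp
    have "Inf (f ` {1..}) < L + \<epsilon>" using that by (simp add: L_def)
    from cInf_lessD[OF ne this] obtain m where "m \<in> {1..}" "f m < L + \<epsilon>" by blast
    then show ?thesis by (intro exI[of _ m]) simp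
  qed
  have ev: "\<exists>n0. \<forall>n\<ge>n0. f n \<le> (1 - c) * L + 3 * \<epsilon>" if \<epsilon>: "\<epsilon> > 0" for \<epsilon>
  proof -
    obtain m where m: "m > 0" "f m < L + \<epsilon>" using near[OF \<epsilon>] by blast
    have "(1 - c) * f m \<le> (1 - c) * (L + \<epsilon>)" using m c by (intro mult_left_mono) auto
    also have "\<dots> \<le> (1 - c) * L + 1 * \<epsilon>" unfolding distrib_left using c \<epsilon> by (intro add_left_mono mult_right_mono) auto
    finally have le: "(1 - c) * f m + 2 * \<epsilon> \<le> (1 - c) * L + 3 * \<epsilon>" by simp
    obtain n0 where "\<forall>n\<ge>n0. f n \<le> (1 - c) * f m + 2 * \<epsilon>" using key[OF m(1) \<epsilon>] by blast
    then have "\<forall>n\<ge>n0. f n \<le> (1 - c) * L + 3 * \<epsilon>" using le order.trans by blast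
    then show ?thesis ..
  qed
  have "L \<le> 0"
  proof (rule ccontr)
    assume "\<not> L \<le> 0"
    then have "c * L / 4 > 0" using c by simp
    from ev[OF this] obtain n0 where n0: "\<And>n. n \<ge> n0 \<Longrightarrow> f n \<le> (1 - c) * L + 3 * (c * L / 4)" by blast
    have "L \<le> (1 - c) * L + 3 * (c * L / 4)"
      using n0[of "Suc n0"] Lle[of "Suc n0"] by simp
    then have "c * L \<le> 0" by (simp add: algebra_simps)
    then show False using \<open>c * L / 4 > 0\<close> by simp
  qed
  then have "L = 0" using L0 by simp
  then obtain n0 where n0: "\<And>n. n \<ge> n0 \<Longrightarrow> f n \<le> e" using ev[of "e / 3"] e by auto
  show ?thesis
  proof (intro exI[of _ "Suc n0"] allI impI)
    fix n assume "Suc n0 \<le> n"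
    then show "l1 (birkhoff F n \<psi>) \<le> e * real n" using n0[of n] unfolding f_def by (simp add: divide_le_eq)
  qed
qed

end

section \<open>Approximation of absolutely continuous functions in variation\<close>

lemma sum_abs_coarser_le:
  fixes h :: "nat \<Rightarrow> real"
  assumes "\<And>i. i < n \<Longrightarrow> a i \<le> a (Suc i)"
  shows "(\<Sum>i<n. \<bar>h (a (Suc i)) - h (a i)\<bar>) \<le> (\<Sum>j\<in>{a 0..<a n}. \<bar>h (Suc j) - h j\<bar>) \<and> a 0 \<le> a n"
  using assms
proof (induction n)
  case (Suc n)
  have le: "a 0 \<le> a n" "a n \<le> a (Suc n)" using Suc by auto
  have "h (a (Suc n)) - h (a n) = (\<Sum>j\<in>{a n..<a (Suc n)}. h (Suc j) - h j)"
    using le by (simp add: sum_Suc_diff')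
  then have "\<bar>h (a (Suc n)) - h (a n)\<bar> \<le> (\<Sum>j\<in>{a n..<a (Suc n)}. \<bar>h (Suc j) - h j\<bar>)"
    by (simp only:) (rule sum_abs)
  then show ?case using Suc le order.trans[OF le] by (simp add: sum.atLeastLessThan_concat[OF le, symmetric])
qed simp

text \<open>By continuity the points of a partition may be rounded down to ever finer grids.
  Restricting to multiples of \<open>N\<close> makes every grid a refinement of one fixed coarse
  grid.\<close>

lemma total_variation_le_grid:
  assumes cont: "continuous_on UNIV g" and N: "N > 0"
    and B: "\<And>d. d > 0 \<Longrightarrow> (\<Sum>j<N * d. \<bar>g (real (Suc j) / real (N * d)) - g (real j / real (N * d))\<bar>) \<le> B"
  shows "cvar g \<le> ennreal B"
proof (rule total_variation_leI_real)
  fix n :: nat and x :: "nat \<Rightarrow> real"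
  assume x: "0 \<le> x 0" "x n \<le> 1" "\<And>i. i < n \<Longrightarrow> x i \<le> x (Suc i)"
  have x01: "0 \<le> x i" "x i \<le> 1" if "i \<le> n" for i
    using monotone_chain[where x = x and n = n and i = 0 and j = i, OF x(3)]
      monotone_chain[where x = x and n = n and i = i and j = n, OF x(3)] that x by auto
  define K where "K d = N * Suc d" for d
  have K0: "K d > 0" for d using N by (simp add: K_def)
  define a where "a d i = nat \<lfloor>real (K d) * x i\<rfloor>" for d i
  have ra: "real (a d i) = of_int \<lfloor>real (K d) * x i\<rfloor>" if "i \<le> n" for d i
    unfolding a_def using x01[OF that] by simp
  have sum_le: "(\<Sum>i<n. \<bar>g (real (a d (Suc i)) / real (K d)) - g (real (a d i) / real (K d))\<bar>) \<le> B" for d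
  proof -
    have mono: "a d i \<le> a d (Suc i)" if "i < n" for i
      unfolding a_def using x(3)[OF that] by (intro nat_mono floor_mono mult_left_mono) auto
    have "real (K d) * x n \<le> real (K d)" using x01[of n] by (simp add: mult_left_le)
    then have "\<lfloor>real (K d) * x n\<rfloor> \<le> int (K d)" by linarith
    then have an: "a d n \<le> K d" by (simp add: a_def)
    have "(\<Sum>i<n. \<bar>g (real (a d (Suc i)) / real (K d)) - g (real (a d i) / real (K d))\<bar>)
      \<le> (\<Sum>j\<in>{a d 0..<a d n}. \<bar>g (real (Suc j) / real (K d)) - g (real j / real (K d))\<bar>)"
      using sum_abs_coarser_le[of n "a d" "\<lambda>j. g (real j / real (K d))"] mono by blast
    also have "\<dots> \<le> (\<Sum>j<K d. \<bar>g (real (Suc j) / real (K d)) - g (real j / real (K d))\<bar>)"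
      by (rule sum_mono2) (use an in auto)
    also have "\<dots> \<le> B" unfolding K_def by (rule B) simp
    finally show ?thesis .
  qed
  have lim: "(\<lambda>d. g (real (a d i) / real (K d))) \<longlonglongrightarrow> g (x i)" if i: "i \<le> n" for i
  proof -
    have "(\<lambda>d. real (a d i) / real (K d)) \<longlonglongrightarrow> x i"
    proof (rule tendsto_sandwich[of "\<lambda>d. x i - 1 / real (Suc d)" _ _ "\<lambda>d. x i"])
      have "x i - 1 / real (Suc d) \<le> real (a d i) / real (K d)" for d
      proof -
        have "Suc d \<le> K d" using N unfolding K_def by (cases N) auto
        then have "x i - 1 / real (Suc d) \<le> x i - 1 / real (K d)"
          by (intro diff_left_mono frac_le of_nat_mono) auto
        also have "\<dots> = (real (K d) * x i - 1) / real (K d)"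
          using K0[of d] by (simp add: field_simps)
        also have "\<dots> \<le> real (a d i) / real (K d)"
          unfolding ra[OF i] by (intro divide_right_mono) linarith+
        finally show ?thesis .
      qed
      then show "\<forall>\<^sub>F d in sequentially. x i - 1 / real (Suc d) \<le> real (a d i) / real (K d)" by simp
      have "real (a d i) / real (K d) \<le> x i" for d
        unfolding ra[OF i] using K0[of d] by (simp add: divide_le_eq mult.commute)
      then show "\<forall>\<^sub>F d in sequentially. real (a d i) / real (K d) \<le> x i" by simp
      have "(\<lambda>d. x i - 1 / real (Suc d)) \<longlonglongrightarrow> x i - 0"
        by (intro tendsto_intros LIMSEQ_Suc[OF lim_1_over_n])
      then show "(\<lambda>d. x i - 1 / real (Suc d)) \<longlonglongrightarrow> x i" by simp
    qed simp
    moreover have "isCont g (x i)" using cont by (simp add: continuous_on_eq_continuous_at)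
    ultimately show ?thesis by (rule isCont_tendsto_compose[rotated])
  qed
  have "(\<lambda>d. \<Sum>i<n. \<bar>g (real (a d (Suc i)) / real (K d)) - g (real (a d i) / real (K d))\<bar>)
      \<longlonglongrightarrow> (\<Sum>i<n. \<bar>g (x (Suc i)) - g (x i)\<bar>)"
    by (intro tendsto_intros lim) auto
  then show "(\<Sum>i<n. \<bar>g (x (Suc i)) - g (x i)\<bar>) \<le> B"
    by (rule LIMSEQ_le_const2) (use sum_le in auto)
qed

section \<open>Increments and slopes on uniform grids\<close>

definition grid_step :: "(real \<Rightarrow> real) \<Rightarrow> nat \<Rightarrow> nat \<Rightarrow> real" where
  "grid_step \<phi> K j = \<phi> (real (Suc j) / real K) - \<phi> (real j / real K)"

lemma sum_grid_step_le_variation: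
  assumes "cvar \<phi> \<le> ennreal V" "0 \<le> V" "K > 0"
  shows "(\<Sum>j<K. \<bar>grid_step \<phi> K j\<bar>) \<le> V"
proof -
  have "(\<Sum>j<K. ennreal \<bar>\<phi> (real (Suc j) / real K) - \<phi> (real j / real K)\<bar>) \<le> cvar \<phi>"
    by (rule total_variation_upper[where x = "\<lambda>j. real j / real K"])
      (use assms in \<open>auto intro!: divide_right_mono\<close>)
  also have "\<dots> \<le> ennreal V" by fact
  finally show ?thesis using assms(2) by (simp add: grid_step_def)
qed

lemma sum_grid_step_small:
  assumes \<delta>: "\<And>(n::nat) u v. (\<forall>i<n. 0 \<le> u i \<and> u i \<le> v i \<and> v i \<le> 1) \<Longrightarrow>
      disjoint_family_on (\<lambda>i. {u i<..<v i}) {..<n} \<Longrightarrow> (\<Sum>i<n. v i - u i) < \<delta> \<Longrightarrow>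
      (\<Sum>i<n::nat. \<bar>\<phi> (v i) - \<phi> (u i)\<bar>) < \<epsilon>"
    and K: "K > 0" and A: "A \<subseteq> {..<K}" "real (card A) / real K < \<delta>"
  shows "(\<Sum>j\<in>A. \<bar>grid_step \<phi> K j\<bar>) < \<epsilon>"
proof -
  define u where "u j = real j / real K" for j
  \<comment> \<open>Cells outside \<open>A\<close> become degenerate, which keeps the family indexed
    by an initial segment as the definition of absolute continuity demands.\<close>
  define v where "v j = (if j \<in> A then real (Suc j) / real K else real j / real K)" for j
  have "finite A" using A(1) finite_subset by blast
  have "(\<Sum>j<K. \<bar>\<phi> (v j) - \<phi> (u j)\<bar>) < \<epsilon>"
  proof (rule \<delta>)
    show "\<forall>i<K. 0 \<le> u i \<and> u i \<le> v i \<and> v i \<le> 1"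
      using K by (auto simp: u_def v_def intro!: divide_right_mono)
    show "disjoint_family_on (\<lambda>i. {u i<..<v i}) {..<K}"
    proof (unfold disjoint_family_on_def, intro ballI impI)
      have *: "{u i<..<v i} \<inter> {u j<..<v j} = {}" if "i < j" for i j :: nat
      proof -
        have "v i \<le> real (Suc i) / real K" by (auto simp: v_def intro!: divide_right_mono)
        also have "\<dots> \<le> u j" unfolding u_def using that by (intro divide_right_mono) auto
        finally show ?thesis by auto
      qed
      fix i j :: nat assume "i \<noteq> j"
      then show "{u i<..<v i} \<inter> {u j<..<v j} = {}" using *[of i j] *[of j i] by (cases "i < j") auto
    qed
    have "(\<Sum>i<K. v i - u i) = (\<Sum>i\<in>A. 1 / real K)"
      by (rule sum.mono_neutral_cong_right) (use A in \<open>auto simp: u_def v_def diff_divide_distrib[symmetric]\<close>)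
    then show "(\<Sum>i<K. v i - u i) < \<delta>" using A(2) by simp
  qed
  moreover have "(\<Sum>j<K. \<bar>\<phi> (v j) - \<phi> (u j)\<bar>) = (\<Sum>j\<in>A. \<bar>grid_step \<phi> K j\<bar>)"
    by (rule sum.mono_neutral_cong_right) (use A in \<open>auto simp: u_def v_def grid_step_def\<close>)
  ultimately show ?thesis by simp
qed

text \<open>Chebyshev's inequality for the slopes.\<close>

lemma card_large_slopes:
  assumes "(\<Sum>j<K. \<bar>grid_step \<phi> K j\<bar>) \<le> V" "K > 0" "M > 0"
  shows "real (card {j. j < K \<and> M < real K * \<bar>grid_step \<phi> K j\<bar>}) / real K \<le> V / M"
proof -
  define A where "A = {j. j < K \<and> M < real K * \<bar>grid_step \<phi> K j\<bar>}"
  have A: "A \<subseteq> {..<K}" by (auto simp: A_def)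
  have "real (card A) * (M / real K) = (\<Sum>j\<in>A. M / real K)" by simp
  also have "\<dots> \<le> (\<Sum>j\<in>A. \<bar>grid_step \<phi> K j\<bar>)"
    using assms by (intro sum_mono) (auto simp: A_def field_simps)
  also have "\<dots> \<le> (\<Sum>j<K. \<bar>grid_step \<phi> K j\<bar>)" by (rule sum_mono2) (use A in auto)
  also have "\<dots> \<le> V" by fact
  finally show ?thesis using assms unfolding A_def[symmetric] by (simp add: field_simps)
qed

text \<open>The Huber function is convex, has linear growth, and is uniformly convex on \<open>[-M, M]\<close>.
  Its affine minorant touching at \<open>s\<close> has slope \<open>2 m\<close> with \<open>m\<close> the truncation of \<open>s\<close> to \<open>[-M, M]\<close>.\<close>

definition huber :: "real \<Rightarrow> real \<Rightarrow> real" where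
  "huber M t = (if \<bar>t\<bar> \<le> M then t\<^sup>2 else 2 * M * \<bar>t\<bar> - M\<^sup>2)"

definition truncate :: "real \<Rightarrow> real \<Rightarrow> real" where
  "truncate M s = max (- M) (min M s)"

lemma huber_le: "0 \<le> M \<Longrightarrow> huber M t \<le> 2 * M * \<bar>t\<bar>"
  unfolding huber_def
  by (auto simp: power2_eq_square abs_mult[symmetric] intro: order.trans[OF _ mult_right_mono[of "\<bar>t\<bar>" "2 * M" "\<bar>t\<bar>"]])

lemma huber_ge: "\<bar>m\<bar> \<le> M \<Longrightarrow> 2 * m * t - m\<^sup>2 \<le> huber M t"
proof (cases "\<bar>t\<bar> \<le> M")
  case True
  then show ?thesis using zero_le_power2[of "t - m"] by (simp add: huber_def power2_diff algebra_simps)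
next
  case False
  assume m: "\<bar>m\<bar> \<le> M"
  have "0 \<le> (M - \<bar>m\<bar>) * (2 * \<bar>t\<bar> - M - \<bar>m\<bar>)" using m False by (intro mult_nonneg_nonneg) auto
  moreover have "m * t \<le> \<bar>m\<bar> * \<bar>t\<bar>" by (metis abs_ge_self abs_mult)
  moreover have "\<bar>m\<bar> * \<bar>m\<bar> = m\<^sup>2" by (simp add: power2_eq_square)
  ultimately show ?thesis using False by (simp add: huber_def power2_eq_square algebra_simps)
qed

lemma huber_truncate: "0 \<le> M \<Longrightarrow> huber M s = 2 * truncate M s * s - (truncate M s)\<^sup>2"
  by (auto simp: huber_def truncate_def max_def min_def power2_eq_square abs_if split: if_splits)

lemma abs_truncate_le: "0 \<le> M \<Longrightarrow> \<bar>truncate M s\<bar> \<le> M"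
  by (auto simp: truncate_def max_def min_def)

text \<open>Discrete form of the integral of the Huber function of the derivative of \<phi>. The
  variation bounds it, so nearly maximal grids exist.\<close>

definition huber_energy :: "real \<Rightarrow> (real \<Rightarrow> real) \<Rightarrow> nat \<Rightarrow> real" where
  "huber_energy M \<phi> K = (\<Sum>j<K. huber M (real K * grid_step \<phi> K j) / real K)"

lemma huber_energy_le:
  assumes "(\<Sum>j<K. \<bar>grid_step \<phi> K j\<bar>) \<le> V" "K > 0" "M \<ge> 0"
  shows "huber_energy M \<phi> K \<le> 2 * M * V"
proof -
  have "huber_energy M \<phi> K \<le> (\<Sum>j<K. 2 * M * \<bar>grid_step \<phi> K j\<bar>)"
    unfolding huber_energy_def
  proof (rule sum_mono)
    fix j
    have "huber M (real K * grid_step \<phi> K j) / real K \<le> 2 * M * \<bar>real K * grid_step \<phi> K j\<bar> / real K"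
      by (intro divide_right_mono huber_le assms) auto
    then show "huber M (real K * grid_step \<phi> K j) / real K \<le> 2 * M * \<bar>grid_step \<phi> K j\<bar>"
      using assms by (simp add: abs_mult)
  qed
  also have "\<dots> \<le> 2 * M * V"
    unfolding sum_distrib_left[symmetric] using assms by (intro mult_left_mono) auto
  finally show ?thesis .
qed

lemma sum_grid_refine:
  assumes N: "N > 0" and d: "d > 0"
  shows "(\<Sum>j\<in>{k * d..<k * d + d}. grid_step \<phi> (N * d) j) = grid_step \<phi> N k"
proof -
  define h where "h j = \<phi> (real j / real (N * d))" for j
  have "(\<Sum>j\<in>{k * d..<k * d + d}. grid_step \<phi> (N * d) j) = (\<Sum>j\<in>{k * d..<k * d + d}. h (Suc j) - h j)"
    by (simp add: grid_step_def h_def)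
  also have "\<dots> = h (k * d + d) - h (k * d)" by (rule sum_Suc_diff') simp
  also have "h (k * d + d) = h (Suc k * d)" by (simp add: add.commute)
  also have "h (Suc k * d) - h (k * d) = grid_step \<phi> N k"
    using d by (simp only: h_def grid_step_def of_nat_mult) simp
  finally show ?thesis .
qed

lemma sum_blocks:
  fixes f :: "nat \<Rightarrow> real"
  shows "(\<Sum>j<N * d. f j) = (\<Sum>k<N. \<Sum>j\<in>{k * d..<k * d + d}. f j)"
  by (rule sum.nat_group[symmetric])

lemma block_div: "j \<in> {k * d..<k * d + d} \<Longrightarrow> j div d = (k::nat)"
  by (auto intro!: div_nat_eqI simp: mult.commute)

text \<open>Passing to a finer grid, the increase of the energy controls the oscillation of the slopes
  within the coarse cells, except where a slope exceeds \<open>M\<close>.\<close>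

lemma sum_slope_oscillation_le:
  assumes N: "N > 0" and d: "d > 0" and M: "M > 0" and e: "e > 0"
    and \<gamma>: "huber_energy M \<phi> (N * d) \<le> huber_energy M \<phi> N + \<gamma>"
    and s: "\<And>k. s k = real N * grid_step \<phi> N k"
    and small: "\<And>K A. K > 0 \<Longrightarrow> A \<subseteq> {..<K} \<Longrightarrow> real (card A) / real K < \<delta> \<Longrightarrow>
      (\<Sum>j\<in>A. \<bar>grid_step \<phi> K j\<bar>) \<le> \<epsilon>"
    and card: "\<And>K. K > 0 \<Longrightarrow> real (card {j. j < K \<and> M < real K * \<bar>grid_step \<phi> K j\<bar>}) / real K < \<delta>"
  shows "(\<Sum>j<N * d. \<bar>grid_step \<phi> (N * d) j - s (j div d) / real (N * d)\<bar>) \<le> e + \<gamma> / (4 * e) + 4 * \<epsilon>"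
proof -
  define K where "K = N * d"
  have K: "K > 0" using N d by (simp add: K_def)
  define D where "D j = grid_step \<phi> K j" for j
  define t where "t j = real K * D j" for j
  define m where "m k = truncate M (s k)" for k
  \<comment> \<open>Gap between the Huber function at the fine slope and its affine minorant
    touching at the coarse slope. The affine parts sum to the coarse energy, so the gaps sum to the
    increase of energy.\<close>
  define q where "q j = (huber M (t j) - (2 * m (j div d) * t j - (m (j div d))\<^sup>2)) / real K" for j
  have q0: "0 \<le> q j" for j
    unfolding q_def m_def using M by (intro divide_nonneg_nonneg) (auto intro!: huber_ge abs_truncate_le)
  have q_sum: "(\<Sum>j<K. q j) \<le> \<gamma>"
  proof -
    have "(\<Sum>j\<in>{k * d..<k * d + d}. (2 * m (j div d) * t j - (m (j div d))\<^sup>2) / real K)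
        = huber M (s k) / real N" for k
    proof -
      have "(\<Sum>j\<in>{k * d..<k * d + d}. (2 * m (j div d) * t j - (m (j div d))\<^sup>2) / real K)
        = (\<Sum>j\<in>{k * d..<k * d + d}. 2 * m k * D j - (m k)\<^sup>2 / real K)"
      proof (rule sum.cong[OF refl])
        fix j assume "j \<in> {k * d..<k * d + d}"
        from block_div[OF this] show "(2 * m (j div d) * t j - (m (j div d))\<^sup>2) / real K = 2 * m k * D j - (m k)\<^sup>2 / real K"
          using K by (simp add: t_def diff_divide_distrib)
      qed
      also have "\<dots> = 2 * m k * (\<Sum>j\<in>{k * d..<k * d + d}. D j) - real d * ((m k)\<^sup>2 / real K)"
        by (simp add: sum_subtractf sum_distrib_left)
      also have "(\<Sum>j\<in>{k * d..<k * d + d}. D j) = grid_step \<phi> N k"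
        unfolding D_def K_def by (rule sum_grid_refine[OF N d])
      also have "2 * m k * grid_step \<phi> N k - real d * ((m k)\<^sup>2 / real K) = huber M (s k) / real N"
        using N d M by (simp add: huber_truncate m_def s K_def field_simps)
      finally show ?thesis .
    qed
    then have "(\<Sum>j<K. (2 * m (j div d) * t j - (m (j div d))\<^sup>2) / real K) = huber_energy M \<phi> N"
      unfolding K_def sum_blocks huber_energy_def s by simp
    then show ?thesis
      using \<gamma> unfolding q_def diff_divide_distrib[of "huber _ _"] sum_subtractf
      by (simp add: huber_energy_def K_def[symmetric] t_def D_def)
  qed
  \<comment> \<open>Exceptional cells: \<open>A\<close> the steep coarse ones, \<open>A'\<close> the
    steep fine ones, \<open>A''\<close> the fine ones inside steep coarse ones. Each set fills a
    fraction below \<delta>, hence carries little variation.\<close>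
  define A where "A = {k. k < N \<and> M < real N * \<bar>grid_step \<phi> N k\<bar>}"
  define A' where "A' = {j. j < K \<and> M < real K * \<bar>grid_step \<phi> K j\<bar>}"
  define A'' where "A'' = {j. j < K \<and> j div d \<in> A}"
  have sA: "k \<in> A \<longleftrightarrow> k < N \<and> M < \<bar>s k\<bar>" for k by (auto simp: A_def s abs_mult)
  have tA: "j \<in> A' \<longleftrightarrow> j < K \<and> M < \<bar>t j\<bar>" for j by (auto simp: A'_def t_def D_def abs_mult)
  have divN: "j div d < N" if "j < K" for j
    using that d unfolding K_def by (simp add: less_mult_imp_div_less)
  define w where "w j = (if j \<in> A'' then \<bar>D j\<bar> + \<bar>s (j div d)\<bar> / real K else 0)" for j
  define z where "z j = (if j \<in> A' then 2 * \<bar>D j\<bar> else 0)" for j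
  have wz: "0 \<le> w j" "0 \<le> z j" for j by (auto simp: w_def z_def)
  have pw: "\<bar>D j - s (j div d) / real K\<bar> \<le> e / real K + q j / (4 * e) + w j + z j" if j: "j < K" for j
  proof -
    have Dt: "D j = t j / real K" using K by (simp add: t_def)
    have eq: "0 \<le> e / real K" "0 \<le> q j / (4 * e)" using q0[of j] e by auto
    consider "j \<in> A''" | "j \<notin> A''" "j \<in> A'" | "j \<notin> A''" "j \<notin> A'" by blast
    then show ?thesis
    proof cases
      case 1
      then have "w j = \<bar>D j\<bar> + \<bar>s (j div d) / real K\<bar>" by (simp add: w_def)
      then show ?thesis using eq wz(2)[of j] by linarith
    next
      case 2
      \<comment> \<open>A moderate coarse slope is dominated by the steep fine one, so twice the
        fine increment bounds the difference.\<close>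
      have "\<bar>s (j div d)\<bar> \<le> M" using 2(1) j divN[OF j] by (auto simp: A''_def sA)
      also have "M \<le> \<bar>t j\<bar>" using 2(2) by (simp add: tA)
      finally have "\<bar>s (j div d) / real K\<bar> \<le> \<bar>D j\<bar>" unfolding Dt abs_divide by (simp add: divide_right_mono)
      moreover have "z j = 2 * \<bar>D j\<bar>" using 2 by (simp add: z_def)
      ultimately show ?thesis using eq wz(1)[of j] by linarith
    next
      case 3
      have sM: "\<bar>s (j div d)\<bar> \<le> M" using 3(1) j divN[OF j] by (auto simp: A''_def sA)
      have tM: "\<bar>t j\<bar> \<le> M" using 3(2) j by (auto simp: tA)
      have "m (j div d) = s (j div d)" using sM by (auto simp: m_def truncate_def)
      then have q: "q j = (t j - s (j div d))\<^sup>2 / real K"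
        using tM by (simp add: q_def huber_def power2_diff algebra_simps)
      define y where "y = \<bar>t j - s (j div d)\<bar>"
      \<comment> \<open>Arithmetic-geometric mean inequality: it converts the quadratic gap into a
        bound linear in the slope difference, at the price of \<open>e\<close>.\<close>
      have "0 \<le> (y - 2 * e)\<^sup>2" by simp
      then have "y \<le> e + y\<^sup>2 / (4 * e)" using e by (simp add: power2_eq_square field_simps)
      then have "y / real K \<le> (e + y\<^sup>2 / (4 * e)) / real K" by (rule divide_right_mono) simp
      then have "\<bar>D j - s (j div d) / real K\<bar> \<le> e / real K + q j / (4 * e)"
        unfolding q Dt y_def by (simp add: diff_divide_distrib[symmetric] add_divide_distrib mult.commute)
      then show ?thesis using wz[of j] by linarith
    qed
  qed
  have "(\<Sum>j<K. \<bar>D j - s (j div d) / real K\<bar>) \<le> (\<Sum>j<K. e / real K + q j / (4 * e) + w j + z j)"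
    by (intro sum_mono pw) simp
  also have "\<dots> = e + (\<Sum>j<K. q j) / (4 * e) + (\<Sum>j<K. w j) + (\<Sum>j<K. z j)"
    using K by (simp add: sum.distrib sum_divide_distrib)
  \<comment> \<open>Steep coarse cells cost \<epsilon> for the fine and \<epsilon> for the coarse
    increments; \<open>A'\<close> costs another \<open>2 * \<epsilon>\<close>.\<close>
  also have "\<dots> \<le> e + \<gamma> / (4 * e) + 2 * \<epsilon> + 2 * \<epsilon>"
  proof (intro add_mono order.refl divide_right_mono q_sum)
    show "0 \<le> 4 * e" using e by simp
    have "(\<Sum>j<K. z j) = 2 * (\<Sum>j\<in>A'. \<bar>D j\<bar>)"
      unfolding sum_distrib_left
      by (rule sum.mono_neutral_cong_right) (auto simp: z_def A'_def)
    also have "\<dots> \<le> 2 * \<epsilon>"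
      using small[OF K, of A'] card[OF K] unfolding A'_def D_def by fastforce
    finally show "(\<Sum>j<K. z j) \<le> 2 * \<epsilon>" .
    have A: "A \<subseteq> {..<N}" by (auto simp: A_def)
    then have finA: "finite A" using finite_subset by blast
    have A''_eq: "A'' = (\<Union>k\<in>A. {k * d..<k * d + d})"
    proof (intro equalityI subsetI)
      fix j assume "j \<in> A''"
      moreover have "j \<in> {(j div d) * d..<(j div d) * d + d}"
        using dividend_less_times_div[OF d, of j] times_div_less_eq_dividend[of d j]
        by (simp add: mult.commute add.commute)
      ultimately show "j \<in> (\<Union>k\<in>A. {k * d..<k * d + d})" unfolding A''_def by blast
    next
      fix j assume "j \<in> (\<Union>k\<in>A. {k * d..<k * d + d})"
      then obtain k where k: "k \<in> A" "j \<in> {k * d..<k * d + d}" by blast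
      have "Suc k \<le> N" using k A by auto
      then have "Suc k * d \<le> K" unfolding K_def by (rule mult_le_mono1)
      then show "j \<in> A''" using k block_div[OF k(2)] by (auto simp: A''_def)
    qed
    have sumA'': "(\<Sum>j\<in>A''. f j) = (\<Sum>k\<in>A. \<Sum>j\<in>{k * d..<k * d + d}. f j)" for f :: "nat \<Rightarrow> real"
      unfolding A''_eq
    proof (rule sum.UNION_disjoint[OF finA])
      show "\<forall>i\<in>A. \<forall>j\<in>A. i \<noteq> j \<longrightarrow> {i * d..<i * d + d} \<inter> {j * d..<j * d + d} = {}"
        using block_div by blast
    qed simp
    have "real (card A'') = (\<Sum>j\<in>A''. 1)" by simp
    also have "\<dots> = real (card A) * real d" unfolding sumA'' by simp
    finally have "real (card A'') / real K = real (card A) / real N" using d by (simp add: K_def)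
    then have "real (card A'') / real K < \<delta>" using card[OF N] by (simp add: A_def)
    then have 1: "(\<Sum>j\<in>A''. \<bar>D j\<bar>) \<le> \<epsilon>" unfolding D_def by (intro small[OF K]) (auto simp: A''_def)
    have "(\<Sum>j\<in>A''. \<bar>s (j div d)\<bar> / real K) = (\<Sum>k\<in>A. \<Sum>j\<in>{k * d..<k * d + d}. \<bar>s k\<bar> / real K)"
      unfolding sumA'' using block_div by (intro sum.cong refl) auto
    also have "\<dots> = (\<Sum>k\<in>A. \<bar>grid_step \<phi> N k\<bar>)"
      using N d by (intro sum.cong) (auto simp: s K_def abs_mult)
    also have "\<dots> \<le> \<epsilon>" using card[OF N] by (intro small[OF N A]) (simp add: A_def)
    finally have 2: "(\<Sum>j\<in>A''. \<bar>s (j div d)\<bar> / real K) \<le> \<epsilon>" .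
    have "(\<Sum>j<K. w j) = (\<Sum>j\<in>A''. \<bar>D j\<bar> + \<bar>s (j div d)\<bar> / real K)"
      by (rule sum.mono_neutral_cong_right) (auto simp: w_def A''_def)
    also have "\<dots> \<le> 2 * \<epsilon>" using 1 2 by (simp add: sum.distrib)
    finally show "(\<Sum>j<K. w j) \<le> 2 * \<epsilon>" .
  qed
  finally show ?thesis unfolding K_def D_def by simp
qed

lemma absolutely_continuous_slopes_small:
  assumes ac: "absolutely_continuous_on_interval \<phi> 0 1" and \<epsilon>: "\<epsilon> > 0"
  obtains \<delta> where "\<delta> > 0" "\<And>K A. K > 0 \<Longrightarrow> A \<subseteq> {..<K} \<Longrightarrow> real (card A) / real K < \<delta> \<Longrightarrow>
      (\<Sum>j\<in>A. \<bar>grid_step \<phi> K j\<bar>) < \<epsilon>"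
proof -
  obtain \<delta> where \<delta>: "\<delta> > 0" "\<And>(n::nat) u v. (\<forall>i<n. 0 \<le> u i \<and> u i \<le> v i \<and> v i \<le> 1) \<and>
      disjoint_family_on (\<lambda>i. {u i<..<v i}) {..<n} \<and> (\<Sum>i<n. v i - u i) < \<delta>
      \<Longrightarrow> (\<Sum>i<n. \<bar>\<phi> (v i) - \<phi> (u i)\<bar>) < \<epsilon>"
    using ac \<epsilon> unfolding absolutely_continuous_on_interval_def by meson
  show thesis
    by (rule that[OF \<delta>(1)], rule sum_grid_step_small) (use \<delta>(2) in blast)+
qed

text \<open>The derivative of the approximation is a trapezoidal version of the step function formed by
  the slopes on a nearly energy-maximizing grid.\<close>

lemma absolutely_continuous_C1_approx:
  assumes cont: "continuous_on UNIV \<phi>" and per: "\<And>x. \<phi> (x + 1) = \<phi> x"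
    and V: "cvar \<phi> \<le> ennreal V" "0 \<le> V"
    and ac: "absolutely_continuous_on_interval \<phi> 0 1" and \<epsilon>: "\<epsilon> > 0"
  shows "\<exists>\<psi> v. pcont \<psi> \<and> integral {0..1} \<psi> = 0 \<and> (\<forall>x. (v has_real_derivative \<psi> x) (at x)) \<and>
    cvar (\<lambda>x. \<phi> x - v x) \<le> ennreal \<epsilon>"
proof -
  \<comment> \<open>Slope oscillation costs \<open>6 * \<epsilon>'\<close>, smoothing one more, and
    the correction of the mean another \<open>7 * \<epsilon>'\<close>.\<close>
  define \<epsilon>' where "\<epsilon>' = \<epsilon> / 20"
  have \<epsilon>': "\<epsilon>' > 0" using \<epsilon> by (simp add: \<epsilon>'_def)
  obtain \<delta> where \<delta>: "\<delta> > 0" "\<And>K A. K > 0 \<Longrightarrow> A \<subseteq> {..<K} \<Longrightarrow> real (card A) / real K < \<delta> \<Longrightarrow>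
      (\<Sum>j\<in>A. \<bar>grid_step \<phi> K j\<bar>) < \<epsilon>'"
    using absolutely_continuous_slopes_small[OF ac \<epsilon>'] by metis
  \<comment> \<open>By Chebyshev's inequality the cells of slope above \<open>M\<close> then fill a
    fraction less than \<delta>.\<close>
  define M where "M = (V + 1) / \<delta>"
  have M: "M > 0" "V / M < \<delta>" using V(2) \<delta>(1) by (auto simp: M_def field_simps)
  have Vsum: "(\<Sum>j<K. \<bar>grid_step \<phi> K j\<bar>) \<le> V" if "K > 0" for K
    by (rule sum_grid_step_le_variation[OF V that])
  have card: "real (card {j. j < K \<and> M < real K * \<bar>grid_step \<phi> K j\<bar>}) / real K < \<delta>" if "K > 0" for K
    using card_large_slopes[OF Vsum[OF that] that M(1)] M(2) by linarith
  define S where "S = huber_energy M \<phi> ` {0<..}"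
  have bdd: "bdd_above S"
    unfolding S_def using huber_energy_le[OF Vsum] M(1) by (intro bdd_aboveI[of _ "2 * M * V"]) auto
  have ne: "S \<noteq> {}" unfolding S_def by blast
  \<comment> \<open>Makes the term \<open>\<gamma> / (4 * \<epsilon>')\<close> of the oscillation
    bound equal to \<open>\<epsilon>'\<close>.\<close>
  define \<gamma> where "\<gamma> = 4 * \<epsilon>' * \<epsilon>'"
  have "Sup S - \<gamma> < Sup S" using \<epsilon>' by (simp add: \<gamma>_def)
  from less_cSupD[OF ne this] obtain N where N: "N > 0" "Sup S - \<gamma> < huber_energy M \<phi> N"
    unfolding S_def by auto
  have en: "huber_energy M \<phi> (N * d) \<le> huber_energy M \<phi> N + \<gamma>" if "d > 0" for d
  proof -
    have "huber_energy M \<phi> (N * d) \<le> Sup S"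
      by (rule cSup_upper[OF _ bdd]) (use N that in \<open>auto simp: S_def\<close>)
    then show ?thesis using N(2) by simp
  qed
  define s where "s k = real N * grid_step \<phi> N k" for k
  have osc: "(\<Sum>j<N * d. \<bar>grid_step \<phi> (N * d) j - s (j div d) / real (N * d)\<bar>) \<le> 6 * \<epsilon>'" if "d > 0" for d
  proof -
    have "(\<Sum>j<N * d. \<bar>grid_step \<phi> (N * d) j - s (j div d) / real (N * d)\<bar>) \<le> \<epsilon>' + \<gamma> / (4 * \<epsilon>') + 4 * \<epsilon>'"
      by (rule sum_slope_oscillation_le[OF N(1) that M(1) \<epsilon>' en[OF that] s_def _ card])
        (auto intro!: less_imp_le[OF \<delta>(2)])
    then show ?thesis using \<epsilon>' by (simp add: \<gamma>_def)
  qed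
  define T where "T = (\<Sum>k<N. \<bar>s k\<bar>)"
  have T0: "0 \<le> T" unfolding T_def by (intro sum_nonneg) auto
  \<comment> \<open>A trapezoid has two ramps of width \<eta>, so cell \<open>k\<close> loses at
    most \<open>2 * \<eta> * \<bar>s k\<bar>\<close>, and all cells together at most
    \<open>\<epsilon>'\<close>.\<close>
  define \<eta> where "\<eta> = \<epsilon>' / (2 * (T + 1))"
  have \<eta>: "\<eta> > 0" using \<epsilon>' T0 by (simp add: \<eta>_def)
  define a where "a k = real k / real N" for k
  have "\<forall>k. \<exists>\<omega>. pcont \<omega> \<and> (\<forall>x. 0 \<le> \<omega> x) \<and> (\<forall>x. \<omega> x \<le> 1) \<and>
      (\<forall>x. \<omega> x \<noteq> 0 \<longrightarrow> (\<exists>m::int. a k < x + of_int m \<and> x + of_int m < a (Suc k))) \<and>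
      (\<forall>x. a k + \<eta> \<le> x \<longrightarrow> x \<le> a (Suc k) - \<eta> \<longrightarrow> \<omega> x = 1)"
    by (meson periodic_bump[OF \<eta>])
  then obtain \<omega> where \<omega>: "\<And>k. pcont (\<omega> k)" "\<And>k x. 0 \<le> \<omega> k x" "\<And>k x. \<omega> k x \<le> 1"
    "\<And>k x. \<omega> k x \<noteq> 0 \<Longrightarrow> \<exists>m::int. a k < x + of_int m \<and> x + of_int m < a (Suc k)"
    "\<And>k x. a k + \<eta> \<le> x \<Longrightarrow> x \<le> a (Suc k) - \<eta> \<Longrightarrow> \<omega> k x = 1"
    by metis
  have "\<forall>k. \<exists>W. \<forall>x. (W has_real_derivative \<omega> k x) (at x)"
    using antiderivative_exists pcontD(1)[OF \<omega>(1)] by blast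
  then obtain W where W: "\<And>k x. (W k has_real_derivative \<omega> k x) (at x)" by metis
  have W_mono: "W k x \<le> W k y" if "x \<le> y" for k x y
    by (rule DERIV_nonneg_imp_nondecreasing[OF that]) (use W \<omega>(2) in blast)
  have W_lip: "W k y - W k x \<le> y - x" if "x \<le> y" for k x y
  proof -
    have "(\<lambda>x. x - W k x) x \<le> (\<lambda>x. x - W k x) y"
      by (rule DERIV_nonneg_imp_nondecreasing[OF that])
        (use \<omega>(3) in \<open>auto intro!: exI derivative_eq_intros W\<close>)
    then show ?thesis by simp
  qed
  have W_mid: "1 / real N - (W k (a (Suc k)) - W k (a k)) \<le> 2 * \<eta>" for k
  proof -
    have len: "a (Suc k) - a k = 1 / real N" by (simp add: a_def diff_divide_distrib[symmetric])
    show ?thesis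
    proof (cases "a k + \<eta> < a (Suc k) - \<eta>")
      case True
      obtain x where x: "a k + \<eta> < x" "x < a (Suc k) - \<eta>"
        "W k (a (Suc k) - \<eta>) - W k (a k + \<eta>) = (a (Suc k) - \<eta> - (a k + \<eta>)) * \<omega> k x"
        using MVT2[OF True, of "W k" "\<omega> k"] W by blast
      then have "W k (a (Suc k) - \<eta>) - W k (a k + \<eta>) = a (Suc k) - a k - 2 * \<eta>"
        using \<omega>(5)[of k x] by simp
      then show ?thesis
        using W_mono[of "a k" "a k + \<eta>" k] W_mono[of "a (Suc k) - \<eta>" "a (Suc k)" k] \<eta> len by auto
    next
      case False
      have "a k \<le> a (Suc k)" using len by (simp add: field_simps a_def)
      from W_mono[OF this, of k] False len show ?thesis by simp
    qed
  qed
  define v0 where "v0 x = (\<Sum>k<N. s k * W k x)" for x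
  define \<psi>0 where "\<psi>0 x = (\<Sum>k<N. s k * \<omega> k x)" for x
  have v0: "(v0 has_real_derivative \<psi>0 x) (at x)" for x
    unfolding v0_def[abs_def] \<psi>0_def by (auto intro!: derivative_eq_intros W sum.cong)
  have \<psi>0: "pcont \<psi>0" unfolding \<psi>0_def[abs_def] by (intro pcont_intros \<omega>)
  have v0_grid: "(\<Sum>j<N * d. \<bar>grid_step \<phi> (N * d) j - grid_step v0 (N * d) j\<bar>) \<le> 7 * \<epsilon>'" if d: "d > 0" for d
  proof -
    define K where "K = N * d"
    have K: "K > 0" using N d by (simp add: K_def)
    define b where "b j = real j / real K" for j
    have ab: "a k = b (k * d)" for k using d by (simp add: a_def b_def K_def)
    have in_cell: "a (j div d) \<le> b j" "b (Suc j) \<le> a (Suc (j div d))" for j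
    proof -
      have "j div d * d \<le> j" by simp
      then show "a (j div d) \<le> b j"
        unfolding ab b_def by (intro divide_right_mono of_nat_mono) auto
      have "Suc j \<le> Suc (j div d) * d" using dividend_less_div_times[OF d, of j] by simp
      then show "b (Suc j) \<le> a (Suc (j div d))"
        unfolding ab b_def by (intro divide_right_mono of_nat_mono) auto
    qed
    \<comment> \<open>The bump of cell \<open>k\<close> vanishes inside the other coarse cells, so
      each fine increment of \<open>v0\<close> involves a single bump.\<close>
    have step: "grid_step (W k) K j = 0" if k: "k < N" "j < K" "k \<noteq> j div d" for k j
    proof -
      have jN: "j div d < N" using k d unfolding K_def by (simp add: less_mult_imp_div_less)
      have lt: "b j < b (Suc j)" using K by (simp add: b_def divide_strict_right_mono)
      have a_le: "a m \<le> a n" if "m \<le> n" for m n using that by (simp add: a_def divide_right_mono)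
      have aN: "a 0 = 0" "a N = 1" using N by (auto simp: a_def)
      have "\<omega> k x = 0" if x: "b j < x" "x < b (Suc j)" for x
      proof (rule ccontr)
        assume "\<omega> k x \<noteq> 0"
        then obtain m :: int where m: "a k < x + of_int m" "x + of_int m < a (Suc k)" using \<omega>(4) by blast
        have xj: "a (j div d) < x" "x < a (Suc (j div d))" using x in_cell[of j] by linarith+
        have "0 \<le> a (j div d)" "a (Suc (j div d)) \<le> 1" "0 \<le> a k" "a (Suc k) \<le> 1"
          using a_le[of 0 "j div d"] a_le[of "Suc (j div d)" N] a_le[of 0 k] a_le[of "Suc k" N] aN jN k by auto
        then have "of_int m < (1::real)" "(-1::real) < of_int m" using m xj by linarith+
        then have "m = 0" by linarith
        then have "a k < a (Suc (j div d))" "a (j div d) < a (Suc k)" using m xj by auto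
        then have "k < Suc (j div d)" "j div d < Suc k" using N by (simp_all add: a_def divide_less_cancel)
        then show False using k(3) by simp
      qed
      moreover obtain x where "b j < x" "x < b (Suc j)" "W k (b (Suc j)) - W k (b j) = (b (Suc j) - b j) * \<omega> k x"
        using MVT2[OF lt, of "W k" "\<omega> k"] W by blast
      ultimately show ?thesis by (simp add: grid_step_def b_def)
    qed
    have v0_step: "grid_step v0 K j = s (j div d) * grid_step (W (j div d)) K j" if "j < K" for j
    proof -
      have jN: "j div d < N" using that d unfolding K_def by (simp add: less_mult_imp_div_less)
      have "grid_step v0 K j = (\<Sum>k<N. s k * grid_step (W k) K j)"
        by (simp add: v0_def grid_step_def sum_subtractf right_diff_distrib)
      also have "\<dots> = (\<Sum>k\<in>{j div d}. s k * grid_step (W k) K j)"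
        by (rule sum.mono_neutral_right) (use jN step that in auto)
      finally show ?thesis by simp
    qed
    have Wstep: "0 \<le> 1 / real K - grid_step (W k) K j" for k j
      using W_lip[of "b j" "b (Suc j)" k] K unfolding grid_step_def b_def
      by (simp add: divide_right_mono diff_divide_distrib[symmetric])
    have "(\<Sum>j<K. \<bar>grid_step \<phi> K j - grid_step v0 K j\<bar>)
      \<le> (\<Sum>j<K. \<bar>grid_step \<phi> K j - s (j div d) / real K\<bar> + \<bar>s (j div d)\<bar> * (1 / real K - grid_step (W (j div d)) K j))"
    proof (rule sum_mono)
      fix j assume "j \<in> {..<K}"
      then have "grid_step \<phi> K j - grid_step v0 K j = (grid_step \<phi> K j - s (j div d) / real K) +
          s (j div d) * (1 / real K - grid_step (W (j div d)) K j)"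
        by (simp add: v0_step right_diff_distrib)
      then show "\<bar>grid_step \<phi> K j - grid_step v0 K j\<bar>
        \<le> \<bar>grid_step \<phi> K j - s (j div d) / real K\<bar> + \<bar>s (j div d)\<bar> * (1 / real K - grid_step (W (j div d)) K j)"
        using abs_triangle_ineq[of "grid_step \<phi> K j - s (j div d) / real K"
            "s (j div d) * (1 / real K - grid_step (W (j div d)) K j)"] Wstep[of "j div d" j]
        by (simp add: abs_mult)
    qed
    also have "\<dots> \<le> 6 * \<epsilon>' + (\<Sum>j<K. \<bar>s (j div d)\<bar> * (1 / real K - grid_step (W (j div d)) K j))"
      using osc[OF d] unfolding sum.distrib K_def by simp
    also have "(\<Sum>j<K. \<bar>s (j div d)\<bar> * (1 / real K - grid_step (W (j div d)) K j))
      = (\<Sum>k<N. \<Sum>j\<in>{k * d..<k * d + d}. \<bar>s k\<bar> * (1 / real K - grid_step (W k) K j))"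
      unfolding K_def sum_blocks using block_div by (intro sum.cong refl) auto
    also have "\<dots> = (\<Sum>k<N. \<bar>s k\<bar> * (1 / real N - grid_step (W k) N k))"
    proof (intro sum.cong refl)
      fix k
      have "(\<Sum>j\<in>{k * d..<k * d + d}. \<bar>s k\<bar> * (1 / real K - grid_step (W k) K j))
         = \<bar>s k\<bar> * (real d * (1 / real K) - (\<Sum>j\<in>{k * d..<k * d + d}. grid_step (W k) K j))"
        by (simp add: sum_distrib_left[symmetric] sum_subtractf)
      also have "(\<Sum>j\<in>{k * d..<k * d + d}. grid_step (W k) K j) = grid_step (W k) N k"
        unfolding K_def by (rule sum_grid_refine[OF N(1) d])
      also have "real d * (1 / real K) = 1 / real N" using d by (simp add: K_def)
      finally show "(\<Sum>j\<in>{k * d..<k * d + d}. \<bar>s k\<bar> * (1 / real K - grid_step (W k) K j))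
         = \<bar>s k\<bar> * (1 / real N - grid_step (W k) N k)" .
    qed
    also have "\<dots> \<le> (\<Sum>k<N. \<bar>s k\<bar> * (2 * \<eta>))"
      using W_mid unfolding grid_step_def a_def by (intro sum_mono mult_left_mono) auto
    also have "\<dots> = 2 * \<eta> * T" by (simp add: T_def sum_distrib_left mult.commute)
    also have "\<dots> \<le> \<epsilon>'"
      using \<epsilon>' T0 unfolding \<eta>_def by (simp add: field_simps)
    finally show ?thesis unfolding K_def by simp
  qed
  \<comment> \<open>The mean of \<open>\<psi>0\<close>, to be subtracted; it is bounded by the
    approximation error because \<phi> is periodic.\<close>
  define \<mu> where "\<mu> = v0 1 - v0 0"
  have \<mu>: "\<bar>\<mu>\<bar> \<le> 7 * \<epsilon>'"
  proof -
    have tele: "(\<Sum>j<N * 1. grid_step f (N * 1) j) = f 1 - f 0" for f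
      using sum_lessThan_telescope[of "\<lambda>j. f (real j / real N)" N] N by (simp add: grid_step_def)
    have "\<mu> = - (\<Sum>j<N * 1. grid_step \<phi> (N * 1) j - grid_step v0 (N * 1) j)"
      unfolding sum_subtractf tele \<mu>_def using per[of 0] by simp
    then have "\<bar>\<mu>\<bar> \<le> (\<Sum>j<N * 1. \<bar>grid_step \<phi> (N * 1) j - grid_step v0 (N * 1) j\<bar>)"
      by (simp only: abs_minus_cancel) (rule sum_abs)
    also have "\<dots> \<le> 7 * \<epsilon>'" by (rule v0_grid) simp
    finally show ?thesis .
  qed
  define \<psi> where "\<psi> x = \<psi>0 x - \<mu>" for x
  define v where "v x = v0 x - \<mu> * x" for x
  have v: "(v has_real_derivative \<psi> x) (at x)" for x
    unfolding v_def[abs_def] \<psi>_def by (auto intro!: derivative_eq_intros v0)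
  have "pcont \<psi>" unfolding \<psi>_def[abs_def] by (intro pcont_intros \<psi>0)
  moreover have "integral {0..1} \<psi> = 0"
    using integral_unique[OF integral_antiderivative[OF v, of 0 1]] by (simp add: v_def \<mu>_def)
  moreover have "cvar (\<lambda>x. \<phi> x - v x) \<le> ennreal \<epsilon>"
  proof (rule total_variation_le_grid[OF _ N(1)])
    have "continuous_on UNIV v"
      by (meson DERIV_continuous_on has_field_derivative_at_within v)
    then show "continuous_on UNIV (\<lambda>x. \<phi> x - v x)" by (intro continuous_intros cont)
    fix d :: nat assume d: "d > 0"
    have K: "real (N * d) > 0" using N d by simp
    have "(\<Sum>j<N * d. \<bar>(\<phi> (real (Suc j) / real (N * d)) - v (real (Suc j) / real (N * d)))
        - (\<phi> (real j / real (N * d)) - v (real j / real (N * d)))\<bar>)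
      \<le> (\<Sum>j<N * d. \<bar>grid_step \<phi> (N * d) j - grid_step v0 (N * d) j\<bar> + \<bar>\<mu>\<bar> / real (N * d))"
    proof (rule sum_mono)
      fix j
      have "(\<phi> (real (Suc j) / real (N * d)) - v (real (Suc j) / real (N * d)))
        - (\<phi> (real j / real (N * d)) - v (real j / real (N * d)))
        = (grid_step \<phi> (N * d) j - grid_step v0 (N * d) j) + \<mu> * (real (Suc j) / real (N * d) - real j / real (N * d))"
        by (simp only: grid_step_def v_def) (simp add: algebra_simps)
      also have "real (Suc j) / real (N * d) - real j / real (N * d) = 1 / real (N * d)"
        by (simp only: diff_divide_distrib[symmetric]) simp
      finally show "\<bar>(\<phi> (real (Suc j) / real (N * d)) - v (real (Suc j) / real (N * d)))
        - (\<phi> (real j / real (N * d)) - v (real j / real (N * d)))\<bar>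
        \<le> \<bar>grid_step \<phi> (N * d) j - grid_step v0 (N * d) j\<bar> + \<bar>\<mu>\<bar> / real (N * d)"
        using abs_triangle_ineq[of "grid_step \<phi> (N * d) j - grid_step v0 (N * d) j" "\<mu> / real (N * d)"]
        by (simp add: abs_divide abs_mult)
    qed
    also have "\<dots> \<le> 7 * \<epsilon>' + \<bar>\<mu>\<bar>"
      using v0_grid[OF d] N d by (simp add: sum.distrib)
    also have "\<dots> \<le> \<epsilon>" using \<mu> \<epsilon> by (simp add: \<epsilon>'_def)
    finally show "(\<Sum>j<N * d. \<bar>(\<phi> (real (Suc j) / real (N * d)) - v (real (Suc j) / real (N * d)))
        - (\<phi> (real j / real (N * d)) - v (real j / real (N * d)))\<bar>) \<le> \<epsilon>" .
  qed
  ultimately show ?thesis using v by blast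
qed

section \<open>Vanishing asymptotic distortion\<close>

text \<open>Closure in variation of the periodic C^1 functions; mean zero of \<psi> makes
  \<open>v\<close> periodic. It replaces absolute continuity from here on, since it passes directly
  to linear combinations and to compositions with C^1 diffeomorphisms.\<close>

definition C1_approximable :: "(real \<Rightarrow> real) \<Rightarrow> bool" where
  "C1_approximable h \<longleftrightarrow> (\<forall>x. h (x + 1) = h x) \<and>
    (\<forall>\<epsilon>>0. \<exists>\<psi> v. pcont \<psi> \<and> integral {0..1} \<psi> = 0 \<and> (\<forall>x. (v has_real_derivative \<psi> x) (at x)) \<and>
      cvar (\<lambda>x. h x - v x) \<le> ennreal \<epsilon>)"

lemma C1_approximable_period: "C1_approximable h \<Longrightarrow> h (x + 1) = h x"
  by (simp add: C1_approximable_def)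

lemma antiderivative_periodic:
  assumes "pcont \<psi>" "integral {0..1} \<psi> = 0" "\<And>x. (v has_real_derivative \<psi> x) (at x)"
  shows "v (x + 1) = v x"
proof -
  have "v 1 - v 0 = 0"
    using integral_unique[OF integral_antiderivative[OF assms(3), of 0 1]] assms(2) by simp
  then show ?thesis using antiderivative_period[OF assms(3) pcontD(2)[OF assms(1)], of x 0] by simp
qed

lemma C1_approximableE:
  assumes "C1_approximable h" "\<epsilon> > 0"
  obtains \<psi> v where "pcont \<psi>" "integral {0..1} \<psi> = 0" "\<And>x. (v has_real_derivative \<psi> x) (at x)"
    "cvar (\<lambda>x. h x - v x) \<le> ennreal \<epsilon>" "\<And>x. v (x + 1) = v x"
  using assms antiderivative_periodic unfolding C1_approximable_def by metis

lemma cvar_C1_le: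
  assumes "pcont \<psi>" "\<And>x. (v has_real_derivative \<psi> x) (at x)"
  shows "cvar v \<le> ennreal (l1 \<psi>)"
  unfolding l1_def by (rule total_variation_C1) (use assms in \<open>auto simp: pcont_def\<close>)

lemma C1_approximable_finite_variation:
  assumes "C1_approximable h" shows "cvar h < \<infinity>"
proof -
  obtain \<psi> v where v: "pcont \<psi>" "\<And>x. (v has_real_derivative \<psi> x) (at x)"
    "cvar (\<lambda>x. h x - v x) \<le> ennreal 1"
    using C1_approximableE[OF assms, of 1] by (metis zero_less_one)
  have "cvar (\<lambda>x. (h x - v x) + v x) \<le> cvar (\<lambda>x. h x - v x) + cvar v" by (rule total_variation_add)
  also have "\<dots> \<le> ennreal 1 + ennreal (l1 \<psi>)" by (intro add_mono v cvar_C1_le)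
  also have "\<dots> < \<infinity>" by simp
  finally show ?thesis by simp
qed

lemma C1_approximable_const: "C1_approximable (\<lambda>x. c)"
  unfolding C1_approximable_def
proof (intro conjI allI impI)
  fix \<epsilon> :: real
  show "\<exists>\<psi> v. pcont \<psi> \<and> integral {0..1} \<psi> = 0 \<and> (\<forall>x. (v has_real_derivative \<psi> x) (at x)) \<and>
      cvar (\<lambda>x. c - v x) \<le> ennreal \<epsilon>"
    by (rule exI[of _ "\<lambda>_. 0"], rule exI[of _ "\<lambda>_. c"]) (auto intro: pcont_intros)
qed simp

lemma C1_approximable_add:
  assumes "C1_approximable f" "C1_approximable g"
  shows "C1_approximable (\<lambda>x. f x + g x)"
  unfolding C1_approximable_def
proof (intro conjI allI impI)
  fix \<epsilon> :: real assume "\<epsilon> > 0"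
  then have \<epsilon>: "\<epsilon> / 2 > 0" by simp
  obtain \<psi> v where v: "pcont \<psi>" "integral {0..1} \<psi> = 0" "\<And>x. (v has_real_derivative \<psi> x) (at x)"
    "cvar (\<lambda>x. f x - v x) \<le> ennreal (\<epsilon> / 2)" using C1_approximableE[OF assms(1) \<epsilon>] by metis
  obtain \<theta> w where w: "pcont \<theta>" "integral {0..1} \<theta> = 0" "\<And>x. (w has_real_derivative \<theta> x) (at x)"
    "cvar (\<lambda>x. g x - w x) \<le> ennreal (\<epsilon> / 2)" using C1_approximableE[OF assms(2) \<epsilon>] by metis
  show "\<exists>\<psi> v. pcont \<psi> \<and> integral {0..1} \<psi> = 0 \<and> (\<forall>x. (v has_real_derivative \<psi> x) (at x)) \<and>
      cvar (\<lambda>x. f x + g x - v x) \<le> ennreal \<epsilon>"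
  proof (intro exI conjI allI)
    show "pcont (\<lambda>x. \<psi> x + \<theta> x)" by (intro pcont_intros v w)
    show "integral {0..1} (\<lambda>x. \<psi> x + \<theta> x) = 0"
      by (subst Henstock_Kurzweil_Integration.integral_add) (auto simp: v w intro: pcont_integrable)
    show "((\<lambda>x. v x + w x) has_real_derivative \<psi> x + \<theta> x) (at x)" for x by (intro DERIV_add v w)
    have "cvar (\<lambda>x. f x + g x - (v x + w x)) = cvar (\<lambda>x. (f x - v x) + (g x - w x))"
      by (simp add: algebra_simps)
    also have "\<dots> \<le> ennreal (\<epsilon> / 2) + ennreal (\<epsilon> / 2)"
      by (intro order.trans[OF total_variation_add] add_mono v w)
    also have "\<dots> = ennreal \<epsilon>" using \<epsilon> by (subst ennreal_plus[symmetric]) auto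
    finally show "cvar (\<lambda>x. f x + g x - (v x + w x)) \<le> ennreal \<epsilon>" .
  qed
qed (use assms in \<open>auto simp: C1_approximable_def\<close>)

lemma C1_approximable_scale:
  assumes "C1_approximable f"
  shows "C1_approximable (\<lambda>x. c * f x)"
  unfolding C1_approximable_def
proof (intro conjI allI impI)
  fix \<epsilon> :: real assume \<epsilon>: "\<epsilon> > 0"
  define \<epsilon>' where "\<epsilon>' = \<epsilon> / (1 + \<bar>c\<bar>)"
  have \<epsilon>': "\<epsilon>' > 0" using \<epsilon> by (simp add: \<epsilon>'_def add_pos_nonneg)
  obtain \<psi> v where v: "pcont \<psi>" "integral {0..1} \<psi> = 0" "\<And>x. (v has_real_derivative \<psi> x) (at x)"
    "cvar (\<lambda>x. f x - v x) \<le> ennreal \<epsilon>'" using C1_approximableE[OF assms(1) \<epsilon>'] by metis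
  show "\<exists>\<psi> v. pcont \<psi> \<and> integral {0..1} \<psi> = 0 \<and> (\<forall>x. (v has_real_derivative \<psi> x) (at x)) \<and>
      cvar (\<lambda>x. c * f x - v x) \<le> ennreal \<epsilon>"
  proof (intro exI conjI allI)
    show "pcont (\<lambda>x. c * \<psi> x)" by (intro pcont_intros v)
    show "integral {0..1} (\<lambda>x. c * \<psi> x) = 0" using v by simp
    show "((\<lambda>x. c * v x) has_real_derivative c * \<psi> x) (at x)" for x by (intro DERIV_cmult v)
    have "cvar (\<lambda>x. c * f x - c * v x) = cvar (\<lambda>x. c * (f x - v x))"
      by (simp add: right_diff_distrib)
    also have "\<dots> \<le> ennreal \<bar>c\<bar> * ennreal \<epsilon>'"
      by (intro order.trans[OF total_variation_scale] mult_left_mono v) auto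
    also have "\<dots> = ennreal (\<bar>c\<bar> * \<epsilon>')" using \<epsilon>' by (subst ennreal_mult) auto
    also have "\<dots> \<le> ennreal \<epsilon>"
      using \<epsilon> by (intro ennreal_leI) (simp add: \<epsilon>'_def field_simps add_pos_nonneg)
    finally show "cvar (\<lambda>x. c * f x - c * v x) \<le> ennreal \<epsilon>" .
  qed
qed (use assms in \<open>auto simp: C1_approximable_def\<close>)

lemma C1_approximable_sum:
  "finite I \<Longrightarrow> (\<And>i. i \<in> I \<Longrightarrow> C1_approximable (h i)) \<Longrightarrow> C1_approximable (\<lambda>x. \<Sum>i\<in>I. h i x)"
  by (induction I rule: finite_induct) (auto intro: C1_approximable_const C1_approximable_add)

lemma C1_approximable_compose:
  assumes F: "diffeo_lift F" and h: "C1_approximable h"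
  shows "C1_approximable (\<lambda>x. h (F x))"
  unfolding C1_approximable_def
proof (intro conjI allI impI)
  fix \<epsilon> :: real assume \<epsilon>: "\<epsilon> > 0"
  obtain \<psi> v where v: "pcont \<psi>" "integral {0..1} \<psi> = 0" "\<And>x. (v has_real_derivative \<psi> x) (at x)"
    "cvar (\<lambda>x. h x - v x) \<le> ennreal \<epsilon>" "\<And>x. v (x + 1) = v x"
    using C1_approximableE[OF h \<epsilon>] by metis
  show "\<exists>\<psi> v. pcont \<psi> \<and> integral {0..1} \<psi> = 0 \<and> (\<forall>x. (v has_real_derivative \<psi> x) (at x)) \<and>
      cvar (\<lambda>x. h (F x) - v x) \<le> ennreal \<epsilon>"
  proof (intro exI conjI allI)
    show "pcont (transfer F \<psi>)" by (intro pcont_transfer v F)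
    show "integral {0..1} (transfer F \<psi>) = 0" using v F by (simp add: integral_transfer)
    show "((\<lambda>x. v (F x)) has_real_derivative transfer F \<psi> x) (at x)" for x
      unfolding transfer_def by (rule DERIV_chain2[OF v(3) diffeo_lift_DERIV[OF F]])
    have "cvar (\<lambda>x. h (F x) - v (F x)) = cvar (\<lambda>x. h x - v x)"
      using cvar_compose[OF F, of "\<lambda>x. h x - v x"] v(5) C1_approximable_period[OF h] by simp
    then show "cvar (\<lambda>x. h (F x) - v (F x)) \<le> ennreal \<epsilon>" using v(4) by simp
  qed
qed (simp add: diffeo_lift_add1[OF F] C1_approximable_period[OF h])

lemma C1_approximable_ln_deriv_funpow:
  assumes F: "diffeo_lift F" and "C1_approximable (\<lambda>x. ln (deriv F x))"
  shows "C1_approximable (\<lambda>x. ln (deriv (F ^^ n) x))"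
  unfolding ln_deriv_funpow[OF F]
  by (intro C1_approximable_sum C1_approximable_compose[OF diffeo_lift_funpow[OF F] assms(2)]) simp

text \<open>The sum of the C^1 parts has the Birkhoff sum of \<psi> as derivative, whose L^1 norm
  bounds the variation. Each iterate of the remainder contributes at most
  \<open>e / 2\<close>.\<close>

lemma (in irrational_lift) distortion_sublinear:
  assumes inf: "\<And>q0. \<exists>q>q0. \<exists>N p. closest_return \<tau> q N p"
    and ap: "C1_approximable (\<lambda>x. ln (deriv F x))" and e: "e > 0"
  shows "\<exists>n0. \<forall>n\<ge>n0. cvar (\<lambda>x. ln (deriv (F ^^ n) x)) \<le> ennreal (e * real n)"
proof -
  have e2: "e / 2 > 0" using e by simp
  obtain \<psi> v where v: "pcont \<psi>" "integral {0..1} \<psi> = 0" "\<And>x. (v has_real_derivative \<psi> x) (at x)"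
    "cvar (\<lambda>x. ln (deriv F x) - v x) \<le> ennreal (e / 2)" "\<And>x. v (x + 1) = v x"
    using C1_approximableE[OF ap e2] by metis
  obtain n0 where n0: "\<And>n. n \<ge> n0 \<Longrightarrow> l1 (birkhoff F n \<psi>) \<le> e / 2 * real n"
    using birkhoff_sublinear[OF inf v(1,2) e2] by blast
  show ?thesis
  proof (intro exI[of _ n0] allI impI)
    fix n assume n: "n \<ge> n0"
    let ?h = "\<lambda>x. ln (deriv F x) - v x"
    have "(\<lambda>x. ln (deriv (F ^^ n) x)) = (\<lambda>x. (\<Sum>i<n. ?h ((F ^^ i) x)) + (\<Sum>i<n. v ((F ^^ i) x)))"
      by (simp add: ln_deriv_funpow[OF F] sum_subtractf)
    then have "cvar (\<lambda>x. ln (deriv (F ^^ n) x)) \<le> cvar (\<lambda>x. \<Sum>i<n. ?h ((F ^^ i) x)) + cvar (\<lambda>x. \<Sum>i<n. v ((F ^^ i) x))"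
      using total_variation_add by presburger
    also have "\<dots> \<le> ennreal (e / 2 * real n) + ennreal (e / 2 * real n)"
    proof (rule add_mono)
      have "cvar (\<lambda>x. \<Sum>i<n. ?h ((F ^^ i) x)) \<le> (\<Sum>i<n. cvar (\<lambda>x. ?h ((F ^^ i) x)))"
        by (rule total_variation_sum) simp
      also have "\<dots> = (\<Sum>i<n. cvar ?h)"
        by (intro sum.cong refl cvar_compose[OF Fn]) (simp add: v(5) diffeo_lift_deriv_add1[OF F])
      also have "\<dots> \<le> (\<Sum>i<n. ennreal (e / 2))" by (intro sum_mono v(4))
      also have "\<dots> = ennreal (e / 2 * real n)"
        using e by (subst sum_ennreal) (auto simp: mult.commute)
      finally show "cvar (\<lambda>x. \<Sum>i<n. ?h ((F ^^ i) x)) \<le> ennreal (e / 2 * real n)" .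
      have "((\<lambda>x. \<Sum>i<n. v ((F ^^ i) x)) has_real_derivative birkhoff F n \<psi> x) (at x)" for x
        unfolding birkhoff_def transfer_def
        by (intro DERIV_sum DERIV_chain2[OF v(3) diffeo_lift_DERIV[OF Fn]])
      from cvar_C1_le[OF pcont_birkhoff[OF F v(1)] this]
      show "cvar (\<lambda>x. \<Sum>i<n. v ((F ^^ i) x)) \<le> ennreal (e / 2 * real n)"
        using n0[OF n] by (meson ennreal_leI order.trans)
    qed
    also have "\<dots> = ennreal (e * real n)"
      using e by (subst ennreal_plus[symmetric]) (auto simp: algebra_simps)
    finally show "cvar (\<lambda>x. ln (deriv (F ^^ n) x)) \<le> ennreal (e * real n)" .
  qed
qed

text \<open>In the periodic case, powers by multiples of \<open>q\<close> are translations, without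
  distortion. Otherwise the previous estimate applies to \<open>F\<close> or to its inverse;
  log-derivatives of a power and of its inverse have equal variation.\<close>

lemma distortion_sublinear_or_periodic:
  assumes F: "diffeo_lift F" and ap: "C1_approximable (\<lambda>x. ln (deriv F x))"
    and free: "(\<exists>q>0. \<exists>p::int. \<forall>y. (F ^^ q) y = y + of_int p) \<or> (\<forall>q>0. \<forall>p::int. \<forall>y. (F ^^ q) y \<noteq> y + of_int p)"
    and e: "e > 0"
  shows "\<exists>n>n0. cvar (\<lambda>x. ln (deriv (F ^^ n) x)) \<le> ennreal (e * real n)"
  using free
proof
  assume "\<exists>q>0. \<exists>p::int. \<forall>y. (F ^^ q) y = y + of_int p"
  then obtain q p where q: "q > 0" "\<And>y. (F ^^ q) y = y + of_int (p::int)" by blast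
  define n where "n = q * Suc n0"
  have "(F ^^ (q * m)) y = y + of_int (int m * p)" for m y
  proof (induction m)
    case (Suc m)
    then show ?case by (simp add: funpow_add q(2) algebra_simps)
  qed simp
  then have "F ^^ n = (\<lambda>y. y + of_int (int (Suc n0) * p))" unfolding n_def by blast
  then have "deriv (F ^^ n) = (\<lambda>_. 1)"
    using diffeo_lift_add_const(2)[OF diffeo_lift_id(1)] by simp
  then have "cvar (\<lambda>x. ln (deriv (F ^^ n) x)) = 0" by simp
  moreover have "n > n0" using q(1) unfolding n_def by (cases q) auto
  ultimately show ?thesis using e by (intro exI[of _ n]) auto
next
  assume nofix: "\<forall>q>0. \<forall>p::int. \<forall>y. (F ^^ q) y \<noteq> y + of_int p"
  let ?\<tau> = "translation_number F"
  have irr: "real q * ?\<tau> \<noteq> of_int p" if "q > 0" for q p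
    using translation_number_irrational[OF F that] nofix that by blast
  obtain V where V: "0 \<le> V" "cvar (\<lambda>x. ln (deriv F x)) = ennreal V"
    using C1_approximable_finite_variation[OF ap]
    by (cases "cvar (\<lambda>x. ln (deriv F x))" rule: ennreal_cases) auto
  have big: "\<exists>n>n0. P n" if ev: "\<exists>n1. \<forall>n\<ge>n1. P n" for P :: "nat \<Rightarrow> bool"
  proof -
    obtain n1 where "\<forall>n\<ge>n1. P n" using ev by blast
    then show ?thesis by (intro exI[of _ "max n1 (Suc n0)"]) auto
  qed
  show ?thesis
    using closest_returns_infinitely_often[OF irr]
  proof
    assume inf: "\<forall>q0. \<exists>q>q0. \<exists>N p. closest_return ?\<tau> q N p"
    interpret irrational_lift F V
      by unfold_locales (use F irr V in auto)
    show ?thesis by (rule big, rule distortion_sublinear[OF _ ap e]) (use inf in blast)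
  next
    assume inf: "\<forall>q0. \<exists>q>q0. \<exists>N p. closest_return (- ?\<tau>) q N p"
    have ap': "C1_approximable (\<lambda>x. ln (deriv (inv F) x))"
    proof -
      have "(\<lambda>x. ln (deriv (inv F) x)) = (\<lambda>x. (-1) * ln (deriv F (inv F x)))"
        unfolding diffeo_lift_inv(2)[OF F] using diffeo_lift_nz[OF F] by (simp add: ln_div)
      then show ?thesis
        by (simp only:) (intro C1_approximable_scale C1_approximable_compose[OF diffeo_lift_inv(1)[OF F] ap])
    qed
    interpret I: irrational_lift "inv F" V
    proof
      show "real q * translation_number (inv F) \<noteq> of_int p" if "q > 0" for q p
        using irr[OF that, of "- p"] unfolding translation_number_inv[OF F] by auto
    qed (use F V in \<open>auto simp: diffeo_lift_inv(1) cvar_ln_deriv_inv[OF F]\<close>)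
    have "\<exists>n1. \<forall>n\<ge>n1. cvar (\<lambda>x. ln (deriv (inv F ^^ n) x)) \<le> ennreal (e * real n)"
      by (rule I.distortion_sublinear[OF _ ap' e]) (use inf in \<open>auto simp: translation_number_inv[OF F]\<close>)
    then have "\<exists>n1. \<forall>n\<ge>n1. cvar (\<lambda>x. ln (deriv (F ^^ n) x)) \<le> ennreal (e * real n)"
      by (simp only: inv_funpow[OF F] cvar_ln_deriv_inv[OF diffeo_lift_funpow[OF F]])
    then show ?thesis by (rule big)
  qed
qed

section \<open>Approximate fixed points by averaging\<close>

text \<open>If \<open>g\<close> has a lift with logarithmic derivative \<open>u\<close> up to a constant, then \<open>defect u F\<close> is
  the variation of the logarithmic derivative of the conjugate of \<open>F\<close> by \<open>g\<close>.\<close>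

definition defect :: "(real \<Rightarrow> real) \<Rightarrow> (real \<Rightarrow> real) \<Rightarrow> ennreal" where
  "defect u F = cvar (\<lambda>x. u (F x) + ln (deriv F x) - u x)"

text \<open>Lifts of commuting circle maps need not commute, but their two composites lift the same
  map.\<close>

definition commute_mod1 :: "(real \<Rightarrow> real) \<Rightarrow> (real \<Rightarrow> real) \<Rightarrow> bool" where
  "commute_mod1 F G \<longleftrightarrow> (\<exists>k::int. \<forall>x. F (G x) = G (F x) + of_int k)"

lemma commute_mod1_funpow:
  assumes F: "diffeo_lift F" and "commute_mod1 F G"
  shows "commute_mod1 (F ^^ n) G"
proof -
  obtain k :: int where k: "\<And>x. F (G x) = G (F x) + of_int k" using assms(2) by (auto simp: commute_mod1_def)
  have "(F ^^ n) (G x) = G ((F ^^ n) x) + of_int (int n * k)" for x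
  proof (induction n)
    case (Suc n)
    have "F (G ((F ^^ n) x) + of_int (int n * k)) = F (G ((F ^^ n) x)) + of_int (int n * k)"
      by (rule diffeo_lift_add_int[OF F])
    then show ?case by (simp add: Suc k algebra_simps)
  qed simp
  then show ?thesis unfolding commute_mod1_def by blast
qed

text \<open>Mean of the first \<open>n\<close> images of \<open>u\<close> under the affine action of
  \<open>F\<close>.\<close>

definition average :: "(real \<Rightarrow> real) \<Rightarrow> nat \<Rightarrow> (real \<Rightarrow> real) \<Rightarrow> real \<Rightarrow> real" where
  "average F n u x = (\<Sum>i<n. u ((F ^^ i) x) + ln (deriv (F ^^ i) x)) / real n"

text \<open>Commutation turns the defect function of the average into the mean of \<open>w\<close>
  composed with the powers \<open>F ^^ i\<close>, where \<open>w\<close> is the defect function of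
  \<open>u\<close>; every term has the variation of \<open>w\<close>.\<close>

lemma defect_average_commuting:
  assumes F: "diffeo_lift F" and G: "diffeo_lift G" and FG: "commute_mod1 F G"
    and per: "\<And>x. u (x + 1) = u x" and n: "n > 0"
  shows "defect (average F n u) G \<le> defect u G"
proof -
  define w where "w x = u (G x) + ln (deriv G x) - u x" for x
  have w: "w (x + 1) = w x" for x
    by (simp add: w_def diffeo_lift_add1[OF G] diffeo_lift_deriv_add1[OF G] per)
  \<comment> \<open>Logarithm of the chain rule for both sides of the commutation relation; the
    integer \<open>k\<close> has no derivative.\<close>
  have orbit: "u ((F ^^ i) (G x)) + ln (deriv (F ^^ i) (G x)) + ln (deriv G x)
      - (u ((F ^^ i) x) + ln (deriv (F ^^ i) x)) = w ((F ^^ i) x)" for i x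
  proof -
    note Fi = diffeo_lift_funpow[OF F, of i]
    obtain k :: int where k: "\<And>x. (F ^^ i) (G x) = G ((F ^^ i) x) + of_int k"
      using commute_mod1_funpow[OF F FG, of i] by (auto simp: commute_mod1_def)
    have "deriv (F ^^ i) (G x) * deriv G x = deriv (\<lambda>x. (F ^^ i) (G x)) x"
      by (simp add: diffeo_lift_comp(2)[OF Fi G])
    also have "\<dots> = deriv (\<lambda>x. G ((F ^^ i) x) + of_int k) x" by (simp only: k)
    also have "\<dots> = deriv G ((F ^^ i) x) * deriv (F ^^ i) x"
      by (simp add: diffeo_lift_add_const(2)[OF diffeo_lift_comp(1)[OF G Fi]] diffeo_lift_comp(2)[OF G Fi])
    finally have "ln (deriv (F ^^ i) (G x) * deriv G x) = ln (deriv G ((F ^^ i) x) * deriv (F ^^ i) x)" by simp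
    then have "ln (deriv (F ^^ i) (G x)) + ln (deriv G x) = ln (deriv G ((F ^^ i) x)) + ln (deriv (F ^^ i) x)"
      using diffeo_lift_nz[OF Fi] diffeo_lift_nz[OF G] by (simp add: ln_mult)
    moreover have "u ((F ^^ i) (G x)) = u (G ((F ^^ i) x))"
      unfolding k by (rule periodic_int) (rule per)
    ultimately show ?thesis by (simp add: w_def)
  qed
  have eq: "average F n u (G x) + ln (deriv G x) - average F n u x = (1 / real n) * (\<Sum>i<n. w ((F ^^ i) x))" for x
  proof -
    have "ln (deriv G x) = (\<Sum>i<n. ln (deriv G x)) / real n" using n by simp
    then have "average F n u (G x) + ln (deriv G x) - average F n u x
      = ((\<Sum>i<n. u ((F ^^ i) (G x)) + ln (deriv (F ^^ i) (G x))) + (\<Sum>i<n. ln (deriv G x))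
          - (\<Sum>i<n. u ((F ^^ i) x) + ln (deriv (F ^^ i) x))) / real n"
      unfolding average_def by (simp add: diff_divide_distrib add_divide_distrib)
    also have "\<dots> = (\<Sum>i<n. w ((F ^^ i) x)) / real n"
      unfolding sum.distrib[symmetric] sum_subtractf[symmetric] orbit ..
    finally show ?thesis by simp
  qed
  have "defect (average F n u) G = cvar (\<lambda>x. (1 / real n) * (\<Sum>i<n. w ((F ^^ i) x)))"
    unfolding defect_def eq ..
  also have "\<dots> \<le> ennreal \<bar>1 / real n\<bar> * (\<Sum>i<n. cvar (\<lambda>x. w ((F ^^ i) x)))"
    by (intro order.trans[OF total_variation_scale] mult_left_mono total_variation_sum) auto
  also have "\<dots> = ennreal (1 / real n) * (of_nat n * cvar w)"
    by (simp add: cvar_compose[OF diffeo_lift_funpow[OF F], of w, OF w])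
  also have "\<dots> = cvar w"
    using n by (simp add: mult.assoc[symmetric] ennreal_of_nat_eq_real_of_nat ennreal_mult[symmetric])
  also have "\<dots> = defect u G" unfolding defect_def w_def[abs_def] ..
  finally show ?thesis .
qed

text \<open>Acting by \<open>F\<close> shifts the summation index, so the defect telescopes to the
  terms of index \<open>n\<close> and \<open>0\<close>, divided by \<open>n\<close>.\<close>

lemma defect_average_self:
  assumes F: "diffeo_lift F" and per: "\<And>x. u (x + 1) = u x" and n: "n > 0"
    and V: "cvar u \<le> ennreal V" "0 \<le> V" and D: "cvar (\<lambda>x. ln (deriv (F ^^ n) x)) \<le> ennreal D" "0 \<le> D"
  shows "defect (average F n u) F \<le> ennreal ((2 * V + D) / real n)"
proof -
  define b where "b i x = u ((F ^^ i) x) + ln (deriv (F ^^ i) x)" for i x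
  have shift: "b i (F x) + ln (deriv F x) = b (Suc i) x" for i x
  proof -
    have "ln (deriv (F ^^ Suc i) x) = ln (deriv (F ^^ i) (F x)) + ln (deriv F x)"
      unfolding deriv_funpow_Suc(2)[OF F]
      using diffeo_lift_nz[OF F] diffeo_lift_nz[OF diffeo_lift_funpow[OF F]] by (simp add: ln_mult)
    then show ?thesis by (simp add: b_def funpow_swap1)
  qed
  have eq: "average F n u (F x) + ln (deriv F x) - average F n u x =
      (1 / real n) * (u ((F ^^ n) x) + ln (deriv (F ^^ n) x) - u x)" for x
  proof -
    have "ln (deriv F x) = (\<Sum>i<n. ln (deriv F x)) / real n" using n by simp
    then have "average F n u (F x) + ln (deriv F x) - average F n u x
      = ((\<Sum>i<n. b i (F x)) + (\<Sum>i<n. ln (deriv F x)) - (\<Sum>i<n. b i x)) / real n"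
      unfolding average_def b_def by (simp add: diff_divide_distrib add_divide_distrib)
    also have "\<dots> = (\<Sum>i<n. b (Suc i) x - b i x) / real n"
      unfolding sum.distrib[symmetric] sum_subtractf[symmetric] shift ..
    also have "(\<Sum>i<n. b (Suc i) x - b i x) = b n x - b 0 x" by (rule sum_lessThan_telescope)
    finally show ?thesis by (simp add: b_def id_def)
  qed
  have "cvar (\<lambda>x. u ((F ^^ n) x) + ln (deriv (F ^^ n) x) - u x)
      \<le> cvar (\<lambda>x. u ((F ^^ n) x)) + cvar (\<lambda>x. ln (deriv (F ^^ n) x)) + cvar u"
    by (intro order.trans[OF total_variation_diff] add_right_mono total_variation_add)
  also have "\<dots> \<le> ennreal V + ennreal D + ennreal V"
    using V D cvar_compose[OF diffeo_lift_funpow[OF F], of u n, OF per] by (intro add_mono) auto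
  also have "\<dots> = ennreal (2 * V + D)" using V D by (simp add: ennreal_plus[symmetric] del: ennreal_plus)
  finally have le: "cvar (\<lambda>x. u ((F ^^ n) x) + ln (deriv (F ^^ n) x) - u x) \<le> ennreal (2 * V + D)" .
  have "defect (average F n u) F \<le> ennreal \<bar>1 / real n\<bar> * ennreal (2 * V + D)"
    unfolding defect_def eq by (intro order.trans[OF total_variation_scale] mult_left_mono le) auto
  also have "\<dots> = ennreal ((2 * V + D) / real n)"
    using V D by (subst ennreal_mult[symmetric]) auto
  finally show ?thesis .
qed

lemma C1_approximable_average:
  assumes F: "diffeo_lift F" and ap: "C1_approximable (\<lambda>x. ln (deriv F x))" and u: "C1_approximable u"
  shows "C1_approximable (average F n u)"
proof -
  have "average F n u = (\<lambda>x. (1 / real n) * (\<Sum>i<n. u ((F ^^ i) x) + ln (deriv (F ^^ i) x)))"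
    by (simp add: average_def[abs_def])
  then show ?thesis
    by (simp only:) (intro C1_approximable_scale C1_approximable_sum C1_approximable_add finite_lessThan
        C1_approximable_compose[OF diffeo_lift_funpow[OF F] u] C1_approximable_ln_deriv_funpow[OF F ap])
qed

lemma approximate_fixed_point:
  assumes "\<And>F. F \<in> set Fs \<Longrightarrow> diffeo_lift F \<and> C1_approximable (\<lambda>x. ln (deriv F x)) \<and>
      ((\<exists>q>0. \<exists>p::int. \<forall>y. (F ^^ q) y = y + of_int p) \<or> (\<forall>q>0. \<forall>p::int. \<forall>y. (F ^^ q) y \<noteq> y + of_int p))"
    and "\<And>F G. F \<in> set Fs \<Longrightarrow> G \<in> set Fs \<Longrightarrow> commute_mod1 F G" and \<epsilon>: "\<epsilon> > 0"
  shows "\<exists>u. C1_approximable u \<and> (\<forall>F\<in>set Fs. defect u F \<le> ennreal \<epsilon>)"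
  using assms(1,2)
proof (induction Fs)
  case Nil
  show ?case using C1_approximable_const by (intro exI[of _ "\<lambda>_. 0"]) simp
next
  case (Cons F Fs)
  have Fprops: "diffeo_lift F" "C1_approximable (\<lambda>x. ln (deriv F x))"
    "(\<exists>q>0. \<exists>p::int. \<forall>y. (F ^^ q) y = y + of_int p) \<or> (\<forall>q>0. \<forall>p::int. \<forall>y. (F ^^ q) y \<noteq> y + of_int p)"
    using Cons.prems(1)[of F] by auto
  have "\<exists>u. C1_approximable u \<and> (\<forall>F\<in>set Fs. defect u F \<le> ennreal \<epsilon>)"
    by (rule Cons.IH) (use Cons.prems in auto)
  then obtain u where u: "C1_approximable u" "\<And>G. G \<in> set Fs \<Longrightarrow> defect u G \<le> ennreal \<epsilon>" by blast
  note per = C1_approximable_period[OF u(1)]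
  obtain V where V: "0 \<le> V" "cvar u = ennreal V"
    using C1_approximable_finite_variation[OF u(1)] by (cases "cvar u" rule: ennreal_cases) auto
  \<comment> \<open>Keeps the boundary term \<open>2 * V / n\<close> below
    \<open>\<epsilon> / 2\<close>; the other half is spent on the distortion of
    \<open>F ^^ n\<close>.\<close>
  obtain n0 :: nat where n0: "4 * V / \<epsilon> < real n0" using reals_Archimedean2 by blast
  have "\<epsilon> / 2 > 0" using \<epsilon> by simp
  from distortion_sublinear_or_periodic[OF Fprops this, of n0] obtain n where
    n: "n > n0" "cvar (\<lambda>x. ln (deriv (F ^^ n) x)) \<le> ennreal (\<epsilon> / 2 * real n)" by blast
  have npos: "n > 0" using n by simp
  have "defect (average F n u) F \<le> ennreal ((2 * V + \<epsilon> / 2 * real n) / real n)"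
    using V n \<epsilon> by (intro defect_average_self[where u = u, OF Fprops(1) per npos]) auto
  also have "\<dots> \<le> ennreal \<epsilon>"
  proof (rule ennreal_leI)
    have "4 * V / \<epsilon> < real n" using n0 n(1) by linarith
    then show "(2 * V + \<epsilon> / 2 * real n) / real n \<le> \<epsilon>"
      using \<epsilon> npos by (simp add: field_simps)
  qed
  finally have 1: "defect (average F n u) F \<le> ennreal \<epsilon>" .
  have 2: "defect (average F n u) G \<le> ennreal \<epsilon>" if G: "G \<in> set Fs" for G
  proof -
    have "defect (average F n u) G \<le> defect u G"
      using Cons.prems G by (intro defect_average_commuting[where u = u, OF Fprops(1) _ _ per npos]) auto
    then show ?thesis using u(2)[OF G] by simp
  qed
  show ?case
    using 1 2 C1_approximable_average[OF Fprops(1,2) u(1), of n] by (intro exI[of _ "average F n u"]) auto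
qed

text \<open>The path below needs C^1 functions. Replacing \<open>u\<close> by \<open>v\<close> costs
  the variation of \<open>u - v\<close> twice, once composed with \<open>F\<close>, whence the
  thirds.\<close>

lemma C1_approximate_fixed_point:
  assumes "\<And>F. F \<in> set Fs \<Longrightarrow> diffeo_lift F \<and> C1_approximable (\<lambda>x. ln (deriv F x)) \<and>
      ((\<exists>q>0. \<exists>p::int. \<forall>y. (F ^^ q) y = y + of_int p) \<or> (\<forall>q>0. \<forall>p::int. \<forall>y. (F ^^ q) y \<noteq> y + of_int p))"
    and "\<And>F G. F \<in> set Fs \<Longrightarrow> G \<in> set Fs \<Longrightarrow> commute_mod1 F G" and \<epsilon>: "\<epsilon> > 0"
  shows "\<exists>\<psi> v. pcont \<psi> \<and> (\<forall>x. (v has_real_derivative \<psi> x) (at x)) \<and> (\<forall>x. v (x + 1) = v x) \<and>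
    (\<forall>F\<in>set Fs. defect v F \<le> ennreal \<epsilon>)"
proof -
  have \<epsilon>3: "\<epsilon> / 3 > 0" using \<epsilon> by simp
  obtain u where u: "C1_approximable u" "\<And>F. F \<in> set Fs \<Longrightarrow> defect u F \<le> ennreal (\<epsilon> / 3)"
    using approximate_fixed_point[OF assms(1,2) \<epsilon>3] by blast
  obtain \<psi> v where v: "pcont \<psi>" "\<And>x. (v has_real_derivative \<psi> x) (at x)"
    "cvar (\<lambda>x. u x - v x) \<le> ennreal (\<epsilon> / 3)" "\<And>x. v (x + 1) = v x"
    using C1_approximableE[OF u(1) \<epsilon>3] by metis
  have "defect v F \<le> ennreal \<epsilon>" if F: "F \<in> set Fs" for F
  proof -
    have dF: "diffeo_lift F" using assms(1)[OF F] by blast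
    let ?h = "\<lambda>x. u x - v x"
    have "defect v F = cvar (\<lambda>x. (u (F x) + ln (deriv F x) - u x) - (?h (F x) - ?h x))"
      unfolding defect_def by (simp add: algebra_simps)
    also have "\<dots> \<le> defect u F + (cvar (\<lambda>x. ?h (F x)) + cvar ?h)"
      unfolding defect_def by (intro order.trans[OF total_variation_diff] add_left_mono total_variation_diff)
    also have "cvar (\<lambda>x. ?h (F x)) = cvar ?h"
      by (rule cvar_compose[OF dF]) (simp add: v(4) C1_approximable_period[OF u(1)])
    also have "defect u F + (cvar ?h + cvar ?h) \<le> ennreal (\<epsilon> / 3) + (ennreal (\<epsilon> / 3) + ennreal (\<epsilon> / 3))"
      by (intro add_mono u(2) F v(3))
    also have "\<dots> = ennreal \<epsilon>"
      using \<epsilon> by (simp add: ennreal_plus[symmetric] del: ennreal_plus)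
    finally show ?thesis .
  qed
  then show ?thesis using v by blast
qed

section \<open>Diffeomorphisms with prescribed logarithmic derivative\<close>

definition C1_periodic :: "(real \<Rightarrow> real) \<Rightarrow> (real \<Rightarrow> real) \<Rightarrow> bool" where
  "C1_periodic w \<theta> \<longleftrightarrow> pcont w \<and> pcont \<theta> \<and> (\<forall>x. (w has_real_derivative \<theta> x) (at x))"

lemma C1_periodicI:
  assumes "pcont \<theta>" "\<And>x. (w has_real_derivative \<theta> x) (at x)" "\<And>x. w (x + 1) = w x"
  shows "C1_periodic w \<theta>"
proof -
  have "continuous_on UNIV w" by (meson DERIV_continuous_on assms(2) has_field_derivative_at_within)
  then show ?thesis using assms unfolding C1_periodic_def pcont_def by auto
qed

definition exp_integral :: "(real \<Rightarrow> real) \<Rightarrow> real \<Rightarrow> real" where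
  "exp_integral w = (SOME H. \<forall>x. (H has_real_derivative exp (w x)) (at x))"

definition exp_mass :: "(real \<Rightarrow> real) \<Rightarrow> real" where
  "exp_mass w = exp_integral w 1 - exp_integral w 0"

text \<open>The diffeomorphism fixing \<open>0\<close> whose logarithmic derivative is
  \<open>w\<close> up to a constant; division by the mass produces degree one.\<close>

definition lift_of_log_deriv :: "(real \<Rightarrow> real) \<Rightarrow> real \<Rightarrow> real" where
  "lift_of_log_deriv w x = (exp_integral w x - exp_integral w 0) / exp_mass w"

context
  fixes w assumes w: "pcont w"
begin

lemma exp_integral_DERIV: "(exp_integral w has_real_derivative exp (w x)) (at x)"
proof -
  have "continuous_on UNIV (\<lambda>x. exp (w x))" using pcontD(1)[OF w] by (intro continuous_intros)
  then have "\<exists>H. \<forall>x. (H has_real_derivative exp (w x)) (at x)" by (rule antiderivative_exists)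
  from someI_ex[OF this] show ?thesis unfolding exp_integral_def by blast
qed

lemma exp_mass_eq: "((\<lambda>x. exp (w x)) has_integral exp_mass w) {0..1}"
  unfolding exp_mass_def by (rule integral_antiderivative[OF exp_integral_DERIV]) simp

lemma exp_mass_pos: "exp_mass w > 0"
  unfolding exp_mass_def
  using DERIV_pos_imp_increasing[of 0 1 "exp_integral w"] exp_integral_DERIV by force

lemma lift_of_log_deriv:
  "diffeo_lift (lift_of_log_deriv w)"
  "deriv (lift_of_log_deriv w) = (\<lambda>x. exp (w x) / exp_mass w)"
  "lift_of_log_deriv w 0 = 0"
proof -
  have D: "(lift_of_log_deriv w has_real_derivative exp (w x) / exp_mass w) (at x)" for x
    unfolding lift_of_log_deriv_def[abs_def]
    using exp_integral_DERIV[of x] exp_mass_pos by (auto intro!: derivative_eq_intros)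
  have C: "continuous_on UNIV (\<lambda>x. exp (w x) / exp_mass w)"
    using pcontD(1)[OF w] exp_mass_pos by (intro continuous_intros) auto
  have P: "0 < exp (w x) / exp_mass w" for x using exp_mass_pos by simp
  have A: "lift_of_log_deriv w (x + 1) = lift_of_log_deriv w x + 1" for x
  proof -
    have "exp_integral w (x + 1) - exp_integral w x = exp_mass w"
      unfolding exp_mass_def
      using antiderivative_period[OF exp_integral_DERIV, of x 0] pcontD(2)[OF w] by simp
    then have eq: "exp_integral w (x + 1) - exp_integral w 0 = (exp_integral w x - exp_integral w 0) + exp_mass w"
      by simp
    show ?thesis unfolding lift_of_log_deriv_def eq add_divide_distrib using exp_mass_pos by simp
  qed
  show "diffeo_lift (lift_of_log_deriv w)" "deriv (lift_of_log_deriv w) = (\<lambda>x. exp (w x) / exp_mass w)"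
    using diffeo_liftI[OF D C P A] by blast+
  show "lift_of_log_deriv w 0 = 0" by (simp add: lift_of_log_deriv_def)
qed

lemma ln_deriv_lift_of_log_deriv: "ln (deriv (lift_of_log_deriv w) x) = w x - ln (exp_mass w)"
  unfolding lift_of_log_deriv(2) using exp_mass_pos by (simp add: ln_div)

end

lemma lift_of_log_deriv_zero: "lift_of_log_deriv (\<lambda>_. 0) = (\<lambda>x. x)"
proof -
  have w: "pcont (\<lambda>_. 0)" by (rule pcont_intros)
  have "exp_mass (\<lambda>_. 0) = 1" using has_integral_unique[OF exp_mass_eq[OF w]] has_integral_const_real[of 1 0 1] by fastforce
  then have D: "(lift_of_log_deriv (\<lambda>_. 0) has_real_derivative 1) (at x)" for x
    using diffeo_lift_DERIV[OF lift_of_log_deriv(1)[OF w], of x] by (simp add: lift_of_log_deriv(2)[OF w])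
  have "((\<lambda>x. lift_of_log_deriv (\<lambda>_. 0) x - x) has_real_derivative 0) (at x)" for x
    using DERIV_diff[OF D DERIV_ident] by simp
  then have "lift_of_log_deriv (\<lambda>_. 0) x - x = lift_of_log_deriv (\<lambda>_. 0) 0 - 0" for x
    using DERIV_isconst_all[of "\<lambda>x. lift_of_log_deriv (\<lambda>_. 0) x - x" x 0] by blast
  then show ?thesis by (auto simp: lift_of_log_deriv(3)[OF w])
qed

section \<open>Dependence of the diffeomorphism on its logarithmic derivative\<close>

lemma pcont_bounded:
  assumes "pcont f" obtains B where "B \<ge> 0" "\<And>x. \<bar>f x\<bar> \<le> B"
proof -
  have "bounded (f ` {0..1})"
    by (intro compact_imp_bounded compact_continuous_image pcont_cont assms) auto
  then obtain B where B: "\<And>x. x \<in> {0..1} \<Longrightarrow> \<bar>f x\<bar> \<le> B" unfolding bounded_real by blast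
  have "\<bar>f x\<bar> \<le> B" for x
  proof -
    have "f x = f (frac x)"
      using pcont_int[OF assms, of "frac x" "\<lfloor>x\<rfloor>"] by (simp add: frac_def)
    then show ?thesis using B[of "frac x"] by (simp add: frac_lt_1 less_imp_le)
  qed
  moreover have "B \<ge> 0" using B[of 0] by simp
  ultimately show thesis using that by blast
qed

lemma pcont_ln_deriv: "diffeo_lift F \<Longrightarrow> pcont (\<lambda>x. ln (deriv F x))"
  unfolding pcont_def
  by (auto intro!: continuous_intros diffeo_lift_cont_deriv simp: diffeo_lift_nz diffeo_lift_deriv_add1)

lemma abs_exp_diff_one_le: "\<bar>z\<bar> \<le> r \<Longrightarrow> \<bar>exp z - 1\<bar> \<le> exp r - (1::real)"
proof -
  assume z: "\<bar>z\<bar> \<le> r"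
  have "exp z \<le> exp r" "exp (- r) \<le> exp z" using z by auto
  moreover have "2 \<le> exp r + exp (- r)"
  proof -
    have "0 \<le> (exp (r / 2) - exp (- (r / 2)))\<^sup>2" by simp
    also have "\<dots> = exp r + exp (- r) - 2"
      by (simp add: power2_diff exp_double[symmetric] mult_exp_exp)
    finally show ?thesis by simp
  qed
  ultimately show ?thesis by linarith
qed

lemma small_exp:
  assumes "a > 0" "M \<ge> (0::real)" obtains r where "r > 0" "M * (exp r - 1) \<le> a"
proof
  show "ln (1 + a / (M + 1)) > 0" using assms by (intro ln_gt_zero) simp
  have "1 + a / (M + 1) > 0" using assms by (simp add: add_pos_pos)
  then have "M * (exp (ln (1 + a / (M + 1))) - 1) = M * (a / (M + 1))" by simp
  also have "\<dots> \<le> a" using assms by (simp add: field_simps)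
  finally show "M * (exp (ln (1 + a / (M + 1))) - 1) \<le> a" .
qed

lemma l1_le_bound:
  assumes "pcont f" "\<And>x. \<bar>f x\<bar> \<le> B" shows "l1 f \<le> B"
proof -
  have "integral {0..1} (\<lambda>x. \<bar>f x\<bar>) \<le> integral {0..1} (\<lambda>x::real. B)"
    by (intro integral_le pcont_integrable pcont_intros assms)
  then show ?thesis by (simp add: l1_def)
qed

text \<open>Changing \<open>w\<close> by \<delta> changes the mass by a factor of at most
  \<open>exp \<delta>\<close>; the logarithmic derivative therefore moves by \<delta> through
  \<open>w\<close> and by \<delta> through the normalization.\<close>

lemma lift_of_log_deriv_close:
  assumes w: "pcont w" and w': "pcont w'" and close: "\<And>x. \<bar>w' x - w x\<bar> \<le> \<delta>"
  shows "\<bar>ln (exp_mass w') - ln (exp_mass w)\<bar> \<le> \<delta>"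
    "\<bar>deriv (lift_of_log_deriv w') x - deriv (lift_of_log_deriv w) x\<bar>
      \<le> deriv (lift_of_log_deriv w) x * (exp (2 * \<delta>) - 1)"
proof -
  have mass: "exp_mass w' \<le> exp \<delta> * exp_mass w"
    if "pcont w" "pcont w'" "\<And>x. \<bar>w' x - w x\<bar> \<le> \<delta>" for w w'
  proof (rule has_integral_le[OF exp_mass_eq[OF that(2)] has_integral_mult_right[OF exp_mass_eq[OF that(1)]]])
    fix x show "exp (w' x) \<le> exp \<delta> * exp (w x)"
      using that(3)[of x] unfolding exp_add[symmetric] by simp
  qed
  have pos: "exp_mass w > 0" "exp_mass w' > 0" using exp_mass_pos w w' by auto
  have "ln (exp_mass w') \<le> ln (exp \<delta> * exp_mass w)"
    using mass[OF w w' close] pos by (subst ln_le_cancel_iff) auto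
  moreover have "ln (exp_mass w) \<le> ln (exp \<delta> * exp_mass w')"
    using mass[OF w' w] close pos by (subst ln_le_cancel_iff) (auto simp: abs_minus_commute)
  ultimately show 1: "\<bar>ln (exp_mass w') - ln (exp_mass w)\<bar> \<le> \<delta>"
    using pos by (simp add: ln_mult abs_le_iff)
  let ?G = "lift_of_log_deriv w" and ?G' = "lift_of_log_deriv w'"
  have p: "deriv ?G x > 0" "deriv ?G' x > 0" using diffeo_lift_pos lift_of_log_deriv(1) w w' by blast+
  define z where "z = ln (deriv ?G' x) - ln (deriv ?G x)"
  have z: "\<bar>z\<bar> \<le> 2 * \<delta>"
    using 1 close[of x] unfolding z_def ln_deriv_lift_of_log_deriv[OF w] ln_deriv_lift_of_log_deriv[OF w'] by linarith
  have "deriv ?G' x = deriv ?G x * exp z" using p by (simp add: z_def exp_diff)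
  then have "deriv ?G' x - deriv ?G x = deriv ?G x * (exp z - 1)" by (simp add: algebra_simps)
  then show "\<bar>deriv ?G' x - deriv ?G x\<bar> \<le> deriv ?G x * (exp (2 * \<delta>) - 1)"
    using abs_exp_diff_one_le[OF z] p by (simp add: abs_mult)
qed

lemma lift_close_of_deriv_close:
  assumes F: "diffeo_lift F" and G: "diffeo_lift G" and "F 0 = G 0"
    and close: "\<And>x. \<bar>deriv F x - deriv G x\<bar> \<le> \<epsilon>"
  shows "\<bar>F x - G x\<bar> \<le> \<epsilon>"
proof -
  define D where "D x = F x - G x" for x
  have D: "D (x + 1) = D x" for x by (simp add: D_def diffeo_lift_add1[OF F] diffeo_lift_add1[OF G])
  have red: "D x = D (frac x)"
    using periodic_int[of D "frac x" "\<lfloor>x\<rfloor>", OF D] by (simp add: frac_def)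
  have \<epsilon>: "\<epsilon> \<ge> 0" using close[of 0] by linarith
  have der: "(D has_real_derivative deriv F x - deriv G x) (at x)" for x
    unfolding D_def[abs_def] by (intro DERIV_diff diffeo_lift_DERIV F G)
  have "\<bar>D (frac x) - D 0\<bar> \<le> \<epsilon>"
  proof (cases "frac x = 0")
    case False
    then have "0 < frac x" by (simp add: frac_gt_0_iff)
    from MVT2[OF this der] obtain z where "D (frac x) - D 0 = (frac x - 0) * (deriv F z - deriv G z)" by blast
    then have "\<bar>D (frac x) - D 0\<bar> = frac x * \<bar>deriv F z - deriv G z\<bar>" by (simp add: abs_mult)
    also have "\<dots> \<le> 1 * \<epsilon>" using frac_lt_1[of x] by (intro mult_mono close) (auto simp: less_imp_le)
    finally show ?thesis by simp
  next
    case True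
    then have "D (frac x) = D 0" by (simp only:)
    then show ?thesis using \<epsilon> by simp
  qed
  moreover have "D 0 = 0" using assms(3) by (simp add: D_def)
  ultimately show ?thesis using red by (simp add: D_def)
qed

text \<open>The logarithmic derivative of \<open>K\<close>, which is \<open>inv G\<close> after
  \<open>G'\<close>, is \<open>w' x - w (K x)\<close> up to a constant. Its variation is at most the
  L^1 norm of its derivative, which is small because \<theta> is uniformly continuous and
  \<open>K\<close> is C^1-close to the identity.\<close>

lemma lift_of_log_deriv_continuity:
  assumes w: "C1_periodic w \<theta>" and \<epsilon>: "\<epsilon> > 0"
  shows "\<exists>\<delta>>0. \<forall>w' \<theta>'. C1_periodic w' \<theta>' \<and> (\<forall>x. \<bar>w' x - w x\<bar> \<le> \<delta>) \<and> (\<forall>x. \<bar>\<theta>' x - \<theta> x\<bar> \<le> \<delta>) \<longrightarrow>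
    (\<forall>x. \<bar>lift_of_log_deriv w' x - lift_of_log_deriv w x\<bar> \<le> \<epsilon>) \<and>
    (\<forall>x. \<bar>deriv (lift_of_log_deriv w') x - deriv (lift_of_log_deriv w) x\<bar> \<le> \<epsilon>) \<and>
    cvar (\<lambda>x. ln (deriv (\<lambda>x. inv (lift_of_log_deriv w) (lift_of_log_deriv w' x)) x)) \<le> ennreal \<epsilon> \<and>
    cvar (\<lambda>x. ln (deriv (\<lambda>x. lift_of_log_deriv w' (inv (lift_of_log_deriv w) x)) x)) \<le> ennreal \<epsilon>"
proof -
  have pw: "pcont w" "pcont \<theta>" and dw: "\<And>x. (w has_real_derivative \<theta> x) (at x)"
    using w by (auto simp: C1_periodic_def)
  define G where "G = lift_of_log_deriv w"
  have G: "diffeo_lift G" unfolding G_def by (rule lift_of_log_deriv[OF pw(1)])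
  have "pcont (deriv G)" unfolding pcont_def by (simp add: diffeo_lift_cont_deriv diffeo_lift_deriv_add1 G)
  then obtain A where A: "A \<ge> 0" "\<And>x. \<bar>deriv G x\<bar> \<le> A" using pcont_bounded by blast
  have "pcont (deriv (inv G))" unfolding pcont_def
    by (simp add: diffeo_lift_cont_deriv diffeo_lift_deriv_add1 diffeo_lift_inv(1)[OF G])
  then obtain L where L: "L \<ge> 0" "\<And>x. \<bar>deriv (inv G) x\<bar> \<le> L" using pcont_bounded by blast
  obtain M where M: "M \<ge> 0" "\<And>x. \<bar>\<theta> x\<bar> \<le> M" using pcont_bounded[OF pw(2)] by blast
  have \<epsilon>3: "\<epsilon> / 3 > 0" using \<epsilon> by simp
  \<comment> \<open>\<open>r\<close> will bound the logarithm of \<open>deriv K\<close>;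
    \<open>d1\<close> and \<open>d2\<close> are moduli of continuity of \<theta> and
    \<open>w\<close>. As \<open>inv G\<close> is Lipschitz with constant \<open>L\<close>, the
    choice of \<open>e\<close> below keeps \<open>K\<close> within both of the identity.\<close>
  obtain r where r: "r > 0" "M * (exp r - 1) \<le> \<epsilon> / 3" using small_exp[OF \<epsilon>3 M(1)] by blast
  obtain d1 where d1: "d1 > 0" "\<And>x y. \<bar>x - y\<bar> < d1 \<Longrightarrow> \<bar>\<theta> x - \<theta> y\<bar> < \<epsilon> / 3"
    using pcont_uniform[OF pw(2) \<epsilon>3] by metis
  have r2: "r / 2 > 0" using r by simp
  obtain d2 where d2: "d2 > 0" "\<And>x y. \<bar>x - y\<bar> < d2 \<Longrightarrow> \<bar>w x - w y\<bar> < r / 2"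
    using pcont_uniform[OF pw(1) r2] by metis
  define e where "e = min \<epsilon> (min d1 d2 / (2 * (L + 1)))"
  have e: "e > 0" "e \<le> \<epsilon>" using \<epsilon> d1(1) d2(1) L(1) by (auto simp: e_def)
  have eL: "L * e < min d1 d2"
  proof -
    have "L * e \<le> L * (min d1 d2 / (2 * (L + 1)))" unfolding e_def using L(1) by (intro mult_left_mono) auto
    also have "\<dots> < min d1 d2"
    proof -
      have "L / (2 * (L + 1)) < 1" using L(1) by simp
      then have "min d1 d2 * (L / (2 * (L + 1))) < min d1 d2 * 1"
        using d1(1) d2(1) by (intro mult_strict_left_mono) auto
      then show ?thesis by (simp add: mult.commute)
    qed
    finally show ?thesis .
  qed
  obtain r' where r': "r' > 0" "A * (exp r' - 1) \<le> e" using small_exp[OF e(1) A(1)] by blast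
  define \<delta> where "\<delta> = min (r' / 2) (min (r / 4) (\<epsilon> / 3))"
  have \<delta>: "\<delta> > 0" "2 * \<delta> \<le> r'" "2 * \<delta> \<le> r / 2" "\<delta> \<le> \<epsilon> / 3" using r' r \<epsilon> by (auto simp: \<delta>_def)
  show ?thesis
  proof (intro exI[of _ \<delta>] conjI allI impI; (elim conjE)?)
    show "\<delta> > 0" by (rule \<delta>)
  next
    fix w' \<theta>'
    assume w'\<theta>': "C1_periodic w' \<theta>'" and cw: "\<forall>x. \<bar>w' x - w x\<bar> \<le> \<delta>" and c\<theta>: "\<forall>x. \<bar>\<theta>' x - \<theta> x\<bar> \<le> \<delta>"
    have pw': "pcont w'" "pcont \<theta>'" and dw': "\<And>x. (w' has_real_derivative \<theta>' x) (at x)"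
      using w'\<theta>' by (auto simp: C1_periodic_def)
    define G' where "G' = lift_of_log_deriv w'"
    have G': "diffeo_lift G'" unfolding G'_def by (rule lift_of_log_deriv[OF pw'(1)])
    have D: "\<bar>deriv G' x - deriv G x\<bar> \<le> e" for x
    proof -
      have "\<bar>deriv G' x - deriv G x\<bar> \<le> deriv G x * (exp (2 * \<delta>) - 1)"
        unfolding G_def G'_def using cw by (intro lift_of_log_deriv_close pw pw') auto
      also have "\<dots> \<le> A * (exp r' - 1)"
        using A(2)[of x] \<delta> A(1) by (intro mult_mono) auto
      finally show ?thesis using r'(2) by linarith
    qed
    have G0: "G' 0 = G 0" unfolding G_def G'_def using lift_of_log_deriv(3) pw pw' by simp
    have C: "\<bar>G' x - G x\<bar> \<le> e" for x by (rule lift_close_of_deriv_close[OF G' G G0 D])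
    show "\<bar>lift_of_log_deriv w' x - lift_of_log_deriv w x\<bar> \<le> \<epsilon>"
      and "\<bar>deriv (lift_of_log_deriv w') x - deriv (lift_of_log_deriv w) x\<bar> \<le> \<epsilon>" for x
      using C[of x] D[of x] e unfolding G_def G'_def by linarith+
    define K where "K x = inv G (G' x)" for x
    have K: "diffeo_lift K" "deriv K = (\<lambda>x. deriv (inv G) (G' x) * deriv G' x)"
      unfolding K_def[abs_def] by (rule diffeo_lift_comp[OF diffeo_lift_inv(1)[OF G] G'])+
    have GK: "G (K x) = G' x" for x by (simp add: K_def diffeo_lift_inv_apply[OF G])
    have Kx: "\<bar>K x - x\<bar> < min d1 d2" for x
    proof -
      have lip: "\<bar>inv G a - inv G b\<bar> \<le> L * \<bar>a - b\<bar>" for a b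
        using field_differentiable_bound[of UNIV "inv G" "deriv (inv G)" L a b]
          diffeo_lift_DERIV[OF diffeo_lift_inv(1)[OF G]] L(2) by auto
      have "\<bar>K x - x\<bar> = \<bar>inv G (G' x) - inv G (G x)\<bar>" by (simp add: K_def diffeo_lift_inv_apply[OF G])
      also have "\<dots> \<le> L * \<bar>G' x - G x\<bar>" by (rule lip)
      also have "\<dots> \<le> L * e" using L(1) C by (intro mult_left_mono)
      finally show ?thesis using eL by linarith
    qed
    have lnK: "ln (deriv K x) = w' x - w (K x) + (ln (exp_mass w) - ln (exp_mass w'))" for x
    proof -
      have "deriv K x = deriv G' x / deriv G (K x)"
        unfolding K(2) diffeo_lift_inv(2)[OF G] by (simp add: K_def)
      then have "ln (deriv K x) = ln (deriv G' x) - ln (deriv G (K x))"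
        using diffeo_lift_nz[OF G] diffeo_lift_nz[OF G'] by (simp add: ln_div)
      then show ?thesis unfolding G_def G'_def
        by (simp add: ln_deriv_lift_of_log_deriv pw pw')
    qed
    have dK: "\<bar>1 - deriv K x\<bar> \<le> exp r - 1" for x
    proof -
      have "\<bar>ln (exp_mass w') - ln (exp_mass w)\<bar> \<le> \<delta>"
        by (rule lift_of_log_deriv_close[OF pw(1) pw'(1)]) (use cw in auto)
      moreover have "\<bar>w' x - w x\<bar> \<le> \<delta>" using cw by blast
      moreover have "\<bar>w (K x) - w x\<bar> < r / 2" using Kx[of x] by (intro d2(2)) auto
      ultimately have "\<bar>ln (deriv K x)\<bar> \<le> r" unfolding lnK using \<delta>(3) by linarith
      from abs_exp_diff_one_le[OF this] show ?thesis
        using diffeo_lift_pos[OF K(1)] by (simp add: abs_minus_commute)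
    qed
    have bound: "\<bar>\<theta>' x - transfer K \<theta> x\<bar> \<le> \<epsilon>" for x
    proof -
      \<comment> \<open>Three errors of at most \<open>\<epsilon> / 3\<close>: change of density,
        displacement by \<open>K\<close>, and the factor \<open>deriv K\<close>.\<close>
      have "\<theta>' x - transfer K \<theta> x = (\<theta>' x - \<theta> x) + (\<theta> x - \<theta> (K x)) + \<theta> (K x) * (1 - deriv K x)"
        by (simp add: transfer_def algebra_simps)
      moreover have "\<bar>\<theta>' x - \<theta> x\<bar> \<le> \<epsilon> / 3" using c\<theta> \<delta>(4) by (meson order.trans)
      moreover have "\<bar>\<theta> x - \<theta> (K x)\<bar> < \<epsilon> / 3" using Kx[of x] by (intro d1(2)) (auto simp: abs_minus_commute)
      moreover have "\<bar>\<theta> (K x) * (1 - deriv K x)\<bar> \<le> \<epsilon> / 3"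
      proof -
        have "\<bar>\<theta> (K x) * (1 - deriv K x)\<bar> \<le> M * (exp r - 1)"
          unfolding abs_mult by (intro mult_mono M dK) auto
        then show ?thesis using r(2) by linarith
      qed
      ultimately show ?thesis by linarith
    qed
    have "cvar (\<lambda>x. ln (deriv K x)) = cvar (\<lambda>x. w' x - w (K x))" unfolding lnK by simp
    also have "\<dots> \<le> ennreal (l1 (\<lambda>x. \<theta>' x - transfer K \<theta> x))"
    proof (rule cvar_C1_le)
      show "pcont (\<lambda>x. \<theta>' x - transfer K \<theta> x)" by (intro pcont_intros pcont_transfer K pw pw')
      show "((\<lambda>x. w' x - w (K x)) has_real_derivative \<theta>' x - transfer K \<theta> x) (at x)" for x
        unfolding transfer_def by (intro DERIV_diff dw' DERIV_chain2[OF dw diffeo_lift_DERIV[OF K(1)]])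
    qed
    also have "\<dots> \<le> ennreal \<epsilon>"
      by (intro ennreal_leI l1_le_bound bound pcont_intros pcont_transfer K pw pw')
    finally show "cvar (\<lambda>x. ln (deriv (\<lambda>x. inv (lift_of_log_deriv w) (lift_of_log_deriv w' x)) x)) \<le> ennreal \<epsilon>"
      unfolding K_def[abs_def] G_def G'_def .
    have ln2: "ln (deriv (\<lambda>x. G' (inv G x)) x) = (w' (inv G x) - w (inv G x)) + (ln (exp_mass w) - ln (exp_mass w'))" for x
    proof -
      have "deriv (\<lambda>x. G' (inv G x)) x = deriv G' (inv G x) / deriv G (inv G x)"
        by (simp add: diffeo_lift_comp(2)[OF G' diffeo_lift_inv(1)[OF G]] diffeo_lift_inv(2)[OF G])
      then have "ln (deriv (\<lambda>x. G' (inv G x)) x) = ln (deriv G' (inv G x)) - ln (deriv G (inv G x))"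
        using diffeo_lift_nz[OF G] diffeo_lift_nz[OF G'] by (simp add: ln_div)
      then show ?thesis unfolding G_def G'_def
        by (simp add: ln_deriv_lift_of_log_deriv pw pw')
    qed
    have "cvar (\<lambda>x. ln (deriv (\<lambda>x. G' (inv G x)) x)) = cvar (\<lambda>x. w' (inv G x) - w (inv G x))"
      unfolding ln2 by simp
    also have "\<dots> = cvar (\<lambda>x. w' x - w x)"
      using cvar_compose[OF diffeo_lift_inv(1)[OF G], of "\<lambda>x. w' x - w x"] pcontD(2)[OF pw(1)] pcontD(2)[OF pw'(1)] by simp
    also have "\<dots> \<le> ennreal (l1 (\<lambda>x. \<theta>' x - \<theta> x))"
      by (rule cvar_C1_le) (intro pcont_intros pw pw' DERIV_diff dw dw')+
    also have "\<dots> \<le> ennreal \<epsilon>"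
    proof (intro ennreal_leI l1_le_bound pcont_intros pw pw')
      show "\<bar>\<theta>' x - \<theta> x\<bar> \<le> \<epsilon>" for x using c\<theta>[rule_format, of x] \<delta>(4) \<epsilon> by linarith
    qed
    finally show "cvar (\<lambda>x. ln (deriv (\<lambda>x. lift_of_log_deriv w' (inv (lift_of_log_deriv w) x)) x)) \<le> ennreal \<epsilon>"
      unfolding G_def G'_def .
  qed
qed

section \<open>Closeness to rotations\<close>

text \<open>The derivative has mean one and so equals one somewhere; the variation then bounds its
  logarithm by \<open>r\<close>. Hence the displacement oscillates by at most
  \<open>exp r - 1\<close>, and the translation number lies between its extreme values.\<close>

lemma close_to_rotation:
  assumes C: "diffeo_lift C" and r: "cvar (\<lambda>x. ln (deriv C x)) \<le> ennreal r" "0 \<le> r"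
  shows "\<bar>deriv C x - 1\<bar> \<le> exp r - 1" "\<bar>C x - (x + translation_number C)\<bar> \<le> exp r - 1"
proof -
  have D: "\<bar>deriv C x - 1\<bar> \<le> exp r - 1" for x
  proof -
    obtain \<xi> where \<xi>: "0 < \<xi>" "\<xi> < 1" "C 1 - C 0 = (1 - 0) * deriv C \<xi>"
      using MVT2[of 0 1 C "deriv C"] diffeo_lift_DERIV[OF C] by auto
    then have one: "deriv C \<xi> = 1" using diffeo_lift_add1[OF C, of 0] by simp
    have var: "\<bar>ln (deriv C b) - ln (deriv C a)\<bar> \<le> r" if "0 \<le> a" "a \<le> b" "b \<le> 1" for a b
    proof -
      have "ennreal \<bar>ln (deriv C b) - ln (deriv C a)\<bar> \<le> cvar (\<lambda>x. ln (deriv C x))"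
        using total_variation_upper[of 0 "\<lambda>i. if i = 0 then a else b" 1 1 "\<lambda>x. ln (deriv C x)"] that by auto
      then have "ennreal \<bar>ln (deriv C b) - ln (deriv C a)\<bar> \<le> ennreal r" using r(1) by (rule order.trans)
      then show ?thesis using r(2) by (subst (asm) ennreal_le_iff) auto
    qed
    define y where "y = frac x"
    have y: "0 \<le> y" "y \<le> 1" unfolding y_def by (auto simp: frac_lt_1 less_imp_le)
    have "deriv C x = deriv C y"
      using periodic_int[of "deriv C" y "\<lfloor>x\<rfloor>", OF diffeo_lift_deriv_add1[OF C]] by (simp add: y_def frac_def)
    moreover have "\<bar>ln (deriv C y)\<bar> \<le> r"
      using var[of y \<xi>] var[of \<xi> y] \<xi> y one by (cases "y \<le> \<xi>") auto
    from abs_exp_diff_one_le[OF this] have "\<bar>deriv C y - 1\<bar> \<le> exp r - 1"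
      using diffeo_lift_pos[OF C] by simp
    ultimately show ?thesis by simp
  qed
  then show "\<bar>deriv C x - 1\<bar> \<le> exp r - 1" .
  have osc: "\<bar>(C y - y) - (C x - x)\<bar> \<le> exp r - 1" for y
  proof -
    \<comment> \<open>Recentring at \<open>x\<close> produces a lift fixing \<open>0\<close>, which
      can be compared with the identity.\<close>
    have *: "diffeo_lift (\<lambda>z. C (z + x) + (- C x))" "deriv (\<lambda>z. C (z + x) + (- C x)) = (\<lambda>z. deriv C (z + x))"
    proof -
      have id: "diffeo_lift (\<lambda>z. z + x)" "deriv (\<lambda>z. z + x) = (\<lambda>_. 1)"
        using diffeo_lift_add_const[OF diffeo_lift_id(1), of x] by auto
      show "diffeo_lift (\<lambda>z. C (z + x) + (- C x))" "deriv (\<lambda>z. C (z + x) + (- C x)) = (\<lambda>z. deriv C (z + x))"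
        using diffeo_lift_add_const[OF diffeo_lift_comp(1)[OF C id(1)], of "- C x"]
        by (simp_all add: diffeo_lift_comp(2)[OF C id(1)] id(2))
    qed
    have "\<bar>deriv (\<lambda>z. C (z + x) + (- C x)) z - deriv (\<lambda>x. x) z\<bar> \<le> exp r - 1" for z
      unfolding *(2) using D by simp
    then have "\<bar>(C ((y - x) + x) + (- C x)) - (y - x)\<bar> \<le> exp r - 1"
      by (intro lift_close_of_deriv_close[OF *(1) diffeo_lift_id(1)]) simp_all
    then show ?thesis by (simp add: algebra_simps)
  qed
  have up: "C y \<le> y + ((C x - x) + (exp r - 1))" and lo: "y + ((C x - x) - (exp r - 1)) \<le> C y" for y
    using osc[of y] by linarith+
  have "real 1 * translation_number C \<le> (C x - x) + (exp r - 1)"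
    by (rule translation_number_le_uniform[OF C]) (use up in simp)
  moreover have "(C x - x) - (exp r - 1) \<le> real 1 * translation_number C"
    by (rule translation_number_ge_uniform[OF C]) (use lo in simp)
  ultimately show "\<bar>C x - (x + translation_number C)\<bar> \<le> exp r - 1" by simp
qed

text \<open>The logarithmic derivative of the conjugate is the defect function composed with
  \<open>inv G\<close>; the normalizing constants of \<open>G\<close> cancel.\<close>

lemma cvar_conjugate:
  assumes F: "diffeo_lift F" and w: "pcont w" and G: "G = lift_of_log_deriv w"
  shows "diffeo_lift (\<lambda>x. G (F (inv G x)))" "cvar (\<lambda>x. ln (deriv (\<lambda>x. G (F (inv G x))) x)) = defect w F"
proof -
  have dG: "diffeo_lift G" unfolding G by (rule lift_of_log_deriv[OF w])
  note iG = diffeo_lift_inv(1)[OF dG]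
  note FG = diffeo_lift_comp[OF F iG]
  show "diffeo_lift (\<lambda>x. G (F (inv G x)))" by (rule diffeo_lift_comp[OF dG FG(1)])
  define h where "h y = w (F y) + ln (deriv F y) - w y" for y
  have "ln (deriv (\<lambda>x. G (F (inv G x))) x) = h (inv G x)" for x
  proof -
    have "deriv (\<lambda>x. G (F (inv G x))) x = deriv G (F (inv G x)) * deriv F (inv G x) / deriv G (inv G x)"
      by (simp add: diffeo_lift_comp(2)[OF dG FG(1)] FG(2) diffeo_lift_inv(2)[OF dG])
    then have "ln (deriv (\<lambda>x. G (F (inv G x))) x)
      = ln (deriv G (F (inv G x))) + ln (deriv F (inv G x)) - ln (deriv G (inv G x))"
      using diffeo_lift_nz[OF dG] diffeo_lift_nz[OF F] by (simp add: ln_div ln_mult)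
    then show ?thesis unfolding h_def G by (simp add: ln_deriv_lift_of_log_deriv[OF w])
  qed
  then have "cvar (\<lambda>x. ln (deriv (\<lambda>x. G (F (inv G x))) x)) = cvar (\<lambda>x. h (inv G x))" by simp
  also have "\<dots> = cvar h"
    by (rule cvar_compose[OF iG])
      (simp add: h_def diffeo_lift_add1[OF F] diffeo_lift_deriv_add1[OF F] pcontD(2)[OF w])
  finally show "cvar (\<lambda>x. ln (deriv (\<lambda>x. G (F (inv G x))) x)) = defect w F"
    unfolding defect_def h_def[abs_def] .
qed

section \<open>Interpolating a sequence of log-derivatives\<close>

definition hat :: "nat \<Rightarrow> real \<Rightarrow> real" where
  "hat n s = max 0 (1 - \<bar>s - real n\<bar>)"

text \<open>Piecewise linear in \<open>s\<close>. The range includes both indices adjacent to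
  \<open>s\<close>; beyond it the hats vanish.\<close>

definition interpolate :: "(nat \<Rightarrow> real \<Rightarrow> real) \<Rightarrow> real \<Rightarrow> real \<Rightarrow> real" where
  "interpolate v s x = (\<Sum>n\<le>nat \<lfloor>s\<rfloor> + 1. hat n s * v n x)"

lemma interpolate_eq_sum:
  assumes "0 \<le> s" "nat \<lfloor>s\<rfloor> + 1 \<le> m"
  shows "interpolate v s x = (\<Sum>n\<le>m. hat n s * v n x)"
  unfolding interpolate_def
proof (rule sum.mono_neutral_left)
  show "\<forall>n\<in>{..m} - {..nat \<lfloor>s\<rfloor> + 1}. hat n s * v n x = 0"
  proof
    fix n assume "n \<in> {..m} - {..nat \<lfloor>s\<rfloor> + 1}"
    then have "nat \<lfloor>s\<rfloor> + 2 \<le> n" by auto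
    then have "real n \<ge> s + 1" using assms(1) by linarith
    then show "hat n s * v n x = 0" by (simp add: hat_def)
  qed
qed (use assms in auto)

lemma interpolate_two_terms:
  assumes "0 \<le> s"
  shows "interpolate v s x = (1 - frac s) * v (nat \<lfloor>s\<rfloor>) x + frac s * v (nat \<lfloor>s\<rfloor> + 1) x"
proof -
  define k where "k = nat \<lfloor>s\<rfloor>"
  have k: "real k = of_int \<lfloor>s\<rfloor>" using assms by (simp add: k_def)
  have fr: "frac s = s - real k" by (simp add: frac_def k)
  have b: "real k \<le> s" "s < real k + 1" unfolding k by linarith+
  have "interpolate v s x = (\<Sum>n\<in>{k, k + 1}. hat n s * v n x)"
    unfolding interpolate_def k_def[symmetric]
  proof (rule sum.mono_neutral_right)
    show "\<forall>n\<in>{..k + 1} - {k, k + 1}. hat n s * v n x = 0"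
    proof
      fix n assume "n \<in> {..k + 1} - {k, k + 1}"
      then have "n + 1 \<le> k" by auto
      then have "real n + 1 \<le> s" using b by linarith
      then show "hat n s * v n x = 0" by (simp add: hat_def)
    qed
  qed auto
  also have "\<dots> = (1 - frac s) * v k x + frac s * v (k + 1) x"
    using b by (simp add: hat_def fr)
  finally show ?thesis unfolding k_def .
qed

lemma C1_periodic_interpolate:
  assumes "\<And>n. C1_periodic (v n) (\<psi> n)"
  shows "C1_periodic (interpolate v s) (interpolate \<psi> s)"
  unfolding C1_periodic_def
proof (intro conjI allI)
  have c: "pcont (v n)" "pcont (\<psi> n)" "(v n has_real_derivative \<psi> n x) (at x)" for n x
    using assms[of n] by (auto simp: C1_periodic_def)
  show "pcont (interpolate v s)" "pcont (interpolate \<psi> s)"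
    unfolding interpolate_def[abs_def] by (intro pcont_intros c)+
  show "(interpolate v s has_real_derivative interpolate \<psi> s x) (at x)" for x
    unfolding interpolate_def[abs_def] by (intro DERIV_sum DERIV_cmult c)
qed

lemma interpolate_continuous:
  assumes b: "\<And>n x. \<bar>v n x\<bar> \<le> b n" and s0: "0 \<le> s0" and \<delta>: "\<delta> > 0"
  shows "\<exists>r>0. \<forall>s\<ge>0. \<bar>s - s0\<bar> < r \<longrightarrow> (\<forall>x. \<bar>interpolate v s x - interpolate v s0 x\<bar> \<le> \<delta>)"
proof -
  \<comment> \<open>A summation range common to all \<open>s < s0 + 1\<close>.\<close>
  define m where "m = nat \<lfloor>s0\<rfloor> + 2"
  define B where "B = (\<Sum>n\<le>m. b n)"
  have b0: "0 \<le> b n" for n using b[of n 0] by linarith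
  have B: "B \<ge> 0" unfolding B_def by (intro sum_nonneg b0)
  define r where "r = min 1 (\<delta> / (B + 1))"
  have r: "r > 0" using \<delta> B by (simp add: r_def add_nonneg_pos)
  have "\<bar>interpolate v s x - interpolate v s0 x\<bar> \<le> \<delta>" if s: "s \<ge> 0" "\<bar>s - s0\<bar> < r" for s x
  proof -
    have "r \<le> 1" by (simp add: r_def)
    then have "s < s0 + 1" using s by linarith
    then have "\<lfloor>s\<rfloor> \<le> \<lfloor>s0\<rfloor> + 1" by linarith
    then have "nat \<lfloor>s\<rfloor> + 1 \<le> m" unfolding m_def using s0 by linarith
    then have "interpolate v s x - interpolate v s0 x = (\<Sum>n\<le>m. (hat n s - hat n s0) * v n x)"
      using s s0 by (simp add: interpolate_eq_sum[of _ m] m_def left_diff_distrib sum_subtractf)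
    also have "\<bar>\<dots>\<bar> \<le> (\<Sum>n\<le>m. \<bar>(hat n s - hat n s0) * v n x\<bar>)" by (rule sum_abs)
    also have "\<dots> \<le> (\<Sum>n\<le>m. \<bar>s - s0\<bar> * b n)"
      unfolding abs_mult
    proof (intro sum_mono mult_mono b)
      show "\<bar>hat n s - hat n s0\<bar> \<le> \<bar>s - s0\<bar>" for n by (auto simp: hat_def max_def)
    qed auto
    also have "\<dots> = \<bar>s - s0\<bar> * B" by (simp add: B_def sum_distrib_left)
    also have "\<dots> \<le> \<delta> / (B + 1) * B" using s B by (intro mult_right_mono) (auto simp: r_def)
    also have "\<dots> \<le> \<delta>" using \<delta> B by (simp add: field_simps)
    finally show ?thesis .
  qed
  then show ?thesis using r by blast
qed

text \<open>The two active weights add up to one, so the term ln DF is distributed consistently and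
  the defect behaves convexly.\<close>

lemma defect_interpolate:
  assumes s: "0 \<le> s" and K: "real K \<le> s" and v: "\<And>n. n \<ge> K \<Longrightarrow> defect (v n) F \<le> ennreal \<epsilon>" and \<epsilon>: "\<epsilon> \<ge> 0"
  shows "defect (interpolate v s) F \<le> ennreal \<epsilon>"
proof -
  define k where "k = nat \<lfloor>s\<rfloor>"
  define c where "c = frac s"
  have c: "0 \<le> c" "c \<le> 1" by (auto simp: c_def frac_lt_1 less_imp_le)
  have k: "K \<le> k" using K by (simp add: k_def le_nat_iff le_floor_iff)
  define h where "h n x = v n (F x) + ln (deriv F x) - v n x" for n x
  have "interpolate v s (F x) + ln (deriv F x) - interpolate v s x = (1 - c) * h k x + c * h (k + 1) x" for x
    unfolding interpolate_two_terms[OF s] k_def[symmetric] c_def[symmetric] h_def by (simp add: algebra_simps)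
  then have "defect (interpolate v s) F = cvar (\<lambda>x. (1 - c) * h k x + c * h (k + 1) x)"
    unfolding defect_def by simp
  also have "\<dots> \<le> ennreal \<bar>1 - c\<bar> * cvar (h k) + ennreal \<bar>c\<bar> * cvar (h (k + 1))"
    by (intro order.trans[OF total_variation_add] add_mono total_variation_scale)
  also have "\<dots> \<le> ennreal \<bar>1 - c\<bar> * ennreal \<epsilon> + ennreal \<bar>c\<bar> * ennreal \<epsilon>"
    using v[of k] v[of "k + 1"] k unfolding h_def[abs_def] defect_def by (intro add_mono mult_left_mono) auto
  also have "\<dots> = ennreal ((1 - c) * \<epsilon> + c * \<epsilon>)"
    using c \<epsilon> by (simp add: ennreal_mult ennreal_plus)
  also have "(1 - c) * \<epsilon> + c * \<epsilon> = \<epsilon>" by (simp add: algebra_simps)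
  finally show ?thesis .
qed

lemma ennreal_tendsto_0I:
  assumes "\<And>\<epsilon>. \<epsilon> > 0 \<Longrightarrow> \<forall>\<^sub>F t in T. f t \<le> ennreal \<epsilon>"
  shows "(f \<longlongrightarrow> 0) T"
proof (rule order_tendstoI)
  fix a :: ennreal assume "0 < a"
  then obtain b where b: "0 < b" "b < a" using dense by blast
  then obtain \<epsilon> where \<epsilon>: "b = ennreal \<epsilon>" "0 \<le> \<epsilon>" by (cases b rule: ennreal_cases) auto
  have "\<epsilon> > 0" using b(1) \<epsilon> by (cases "\<epsilon> = 0") auto
  from assms[OF this] show "\<forall>\<^sub>F t in T. f t < a"
    by eventually_elim (use b \<epsilon> in \<open>auto intro: le_less_trans\<close>)
qed simp

text \<open>The parameter \<open>t \<in> [0, 1)\<close> is sent to \<open>t / (1 - t) \<in> [0, \<infinity>)\<close>.\<close>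

lemma conjugating_path:
  fixes v \<psi> :: "nat \<Rightarrow> real \<Rightarrow> real"
  assumes v: "\<And>n. C1_periodic (v n) (\<psi> n)" and v0: "v 0 = (\<lambda>_. 0)"
  shows "\<exists>g. C1bv_path g {0..<1} \<and> g 0 = id \<and>
    (\<forall>F f. diffeo_lift F \<and> circle_lift F f \<and> (\<forall>\<epsilon>>0. \<exists>K. \<forall>n\<ge>K. defect (v n) F \<le> ennreal \<epsilon>) \<longrightarrow>
      C1bv_tendsto_rotation (\<lambda>t. g t \<circ> f \<circ> inv (g t)) (rotation_number f) (at 1 within {0..<1}))"
proof -
  define \<sigma> where "\<sigma> t = t / (1 - t)" for t :: real
  have \<sigma>0: "0 \<le> \<sigma> t" if "t \<in> {0..<1}" for t using that by (simp add: \<sigma>_def)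
  define w where "w t = interpolate v (\<sigma> t)" for t
  define \<theta> where "\<theta> t = interpolate \<psi> (\<sigma> t)" for t
  have w: "C1_periodic (w t) (\<theta> t)" for t unfolding w_def \<theta>_def by (rule C1_periodic_interpolate[OF v])
  then have pw: "pcont (w t)" "pcont (\<theta> t)" "(w t has_real_derivative \<theta> t x) (at x)" for t x
    by (auto simp: C1_periodic_def)
  define G where "G t = lift_of_log_deriv (w t)" for t
  have G: "diffeo_lift (G t)" for t unfolding G_def by (rule lift_of_log_deriv[OF pw(1)])
  have "\<forall>t. \<exists>f. circle_lift (G t) f" using circle_map_exists[OF G] by blast
  then obtain g where g: "\<And>t. circle_lift (G t) (g t)" by metis
  have inv_g: "circle_lift (inv (G t)) (inv (g t))" for t by (rule circle_lift_inverse[OF G g])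
  have bv: "C1bv_diffeo (g t)" for t
  proof -
    have "cvar (\<lambda>x. ln (deriv (G t) x)) = cvar (w t)"
      unfolding G_def by (simp add: ln_deriv_lift_of_log_deriv[OF pw(1)])
    also have "\<dots> \<le> ennreal (l1 (\<theta> t))" by (rule cvar_C1_le[OF pw(2,3)])
    also have "\<dots> < \<infinity>" by simp
    finally show ?thesis
      unfolding C1bv_diffeo_def using circle_C1_diffeoI[OF G g] circle_var_log_deriv[OF G g] by simp
  qed
  have g0: "g 0 = id"
  proof -
    have "w 0 = (\<lambda>_. 0)"
      by (rule ext) (simp add: w_def \<sigma>_def interpolate_two_terms v0)
    then have "circle_lift (\<lambda>x. x) (g 0)" using g[of 0] by (simp add: G_def lift_of_log_deriv_zero)
    then show ?thesis using circle_lift_id by (rule circle_lift_map_unique)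
  qed
  obtain b where b: "\<And>n x. \<bar>v n x\<bar> \<le> b n"
  proof -
    have "\<forall>n. \<exists>B. \<forall>x. \<bar>v n x\<bar> \<le> B" using pcont_bounded v unfolding C1_periodic_def by metis
    then show thesis using that by metis
  qed
  obtain b' where b': "\<And>n x. \<bar>\<psi> n x\<bar> \<le> b' n"
  proof -
    have "\<forall>n. \<exists>B. \<forall>x. \<bar>\<psi> n x\<bar> \<le> B" using pcont_bounded v unfolding C1_periodic_def by metis
    then show thesis using that by metis
  qed
  have path: "C1bv_tendsto g (g s) (at s within {0..<1})" if s: "s \<in> {0..<1}" for s
  proof -
    have ev: "\<forall>\<^sub>F t in at s within {0..<1}.
      (\<forall>x. \<bar>G t x - G s x\<bar> \<le> \<epsilon>) \<and> (\<forall>x. \<bar>deriv (G t) x - deriv (G s) x\<bar> \<le> \<epsilon>) \<and>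
      cvar (\<lambda>x. ln (deriv (\<lambda>x. inv (G s) (G t x)) x)) \<le> ennreal \<epsilon> \<and>
      cvar (\<lambda>x. ln (deriv (\<lambda>x. G t (inv (G s) x)) x)) \<le> ennreal \<epsilon>" if \<epsilon>: "\<epsilon> > 0" for \<epsilon>
    proof -
      obtain \<delta> where \<delta>: "\<delta> > 0" "\<And>w' \<theta>'. C1_periodic w' \<theta>' \<Longrightarrow> (\<forall>x. \<bar>w' x - w s x\<bar> \<le> \<delta>) \<Longrightarrow>
          (\<forall>x. \<bar>\<theta>' x - \<theta> s x\<bar> \<le> \<delta>) \<Longrightarrow>
        (\<forall>x. \<bar>lift_of_log_deriv w' x - lift_of_log_deriv (w s) x\<bar> \<le> \<epsilon>) \<and>
        (\<forall>x. \<bar>deriv (lift_of_log_deriv w') x - deriv (lift_of_log_deriv (w s)) x\<bar> \<le> \<epsilon>) \<and>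
        cvar (\<lambda>x. ln (deriv (\<lambda>x. inv (lift_of_log_deriv (w s)) (lift_of_log_deriv w' x)) x)) \<le> ennreal \<epsilon> \<and>
        cvar (\<lambda>x. ln (deriv (\<lambda>x. lift_of_log_deriv w' (inv (lift_of_log_deriv (w s)) x)) x)) \<le> ennreal \<epsilon>"
        using lift_of_log_deriv_continuity[OF w[of s] \<epsilon>] by blast
      obtain r where r: "r > 0" "\<And>t x. 0 \<le> \<sigma> t \<Longrightarrow> \<bar>\<sigma> t - \<sigma> s\<bar> < r \<Longrightarrow> \<bar>w t x - w s x\<bar> \<le> \<delta>"
        using interpolate_continuous[of v b, OF b \<sigma>0[OF s] \<delta>(1)] unfolding w_def by blast
      obtain r' where r': "r' > 0" "\<And>t x. 0 \<le> \<sigma> t \<Longrightarrow> \<bar>\<sigma> t - \<sigma> s\<bar> < r' \<Longrightarrow> \<bar>\<theta> t x - \<theta> s x\<bar> \<le> \<delta>"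
        using interpolate_continuous[of \<psi> b', OF b' \<sigma>0[OF s] \<delta>(1)] unfolding \<theta>_def by blast
      have "(\<sigma> \<longlongrightarrow> \<sigma> s) (at s within {0..<1})"
        unfolding \<sigma>_def[abs_def] using s by (intro tendsto_intros) auto
      then have "\<forall>\<^sub>F t in at s within {0..<1}. dist (\<sigma> t) (\<sigma> s) < min r r'"
        using r(1) r'(1) by (intro tendstoD) auto
      moreover have "\<forall>\<^sub>F t in at s within {0..<1}. t \<in> {0..<1}" by (auto simp: eventually_at_filter)
      ultimately show ?thesis
      proof eventually_elim
        case (elim t)
        then show ?case
          unfolding G_def using \<sigma>0[of t] r(2)[of t] r'(2)[of t] by (intro \<delta>(2)[OF w]) (auto simp: dist_real_def)
      qed
    qed
    note iG = diffeo_lift_inv(1)[OF G]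
    have var1: "circle_var (log_deriv (inv (g s) \<circ> g t)) = cvar (\<lambda>x. ln (deriv (\<lambda>x. inv (G s) (G t x)) x))" for t
      by (rule circle_var_log_deriv[OF diffeo_lift_comp(1)[OF iG G] circle_lift_comp[OF inv_g g]])
    have var2: "circle_var (log_deriv (g t \<circ> inv (g s))) = cvar (\<lambda>x. ln (deriv (\<lambda>x. G t (inv (G s) x)) x))" for t
      by (rule circle_var_log_deriv[OF diffeo_lift_comp(1)[OF G iG] circle_lift_comp[OF g inv_g]])
    show ?thesis
      unfolding C1bv_tendsto_def uniform_limit_iff
    proof (intro conjI allI impI)
      fix \<epsilon> :: real assume "\<epsilon> > 0"
      then have "\<epsilon> / 2 > 0" by simp
      note ev2 = ev[OF this]
      show "\<forall>\<^sub>F t in at s within {0..<1}. \<forall>p\<in>UNIV. dist (g t p) (g s p) < \<epsilon>"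
        using ev2
      proof eventually_elim
        case (elim t)
        show ?case
        proof
          fix p
          obtain x where p: "p = circle_of x" by (rule circle_of_cases)
          have "dist (g t p) (g s p) = dist (circle_of (G t x)) (circle_of (G s x))"
            using g[of t] g[of s] by (simp add: p circle_lift_def)
          also have "\<dots> \<le> \<bar>G t x - G s x\<bar>" by (rule dist_circle_of_le)
          also have "\<dots> \<le> \<epsilon> / 2" using elim by blast
          finally show "dist (g t p) (g s p) < \<epsilon>" using \<open>\<epsilon> > 0\<close> by simp
        qed
      qed
      show "\<forall>\<^sub>F t in at s within {0..<1}. \<forall>p\<in>UNIV. dist (circle_deriv (g t) p) (circle_deriv (g s) p) < \<epsilon>"
        using ev2
      proof eventually_elim
        case (elim t)
        show ?case
        proof
          fix p
          obtain x where p: "p = circle_of x" by (rule circle_of_cases)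
          have "\<bar>deriv (G t) x - deriv (G s) x\<bar> \<le> \<epsilon> / 2" using elim by blast
          then show "dist (circle_deriv (g t) p) (circle_deriv (g s) p) < \<epsilon>"
            using \<open>\<epsilon> > 0\<close> by (simp add: p circle_deriv_lift[OF G g] dist_real_def)
        qed
      qed
    next
      show "((\<lambda>t. circle_var (log_deriv (inv (g s) \<circ> g t))) \<longlongrightarrow> 0) (at s within {0..<1})"
        unfolding var1 by (rule ennreal_tendsto_0I, drule ev) (auto elim: eventually_mono)
      show "((\<lambda>t. circle_var (log_deriv (g t \<circ> inv (g s)))) \<longlongrightarrow> 0) (at s within {0..<1})"
        unfolding var2 by (rule ennreal_tendsto_0I, drule ev) (auto elim: eventually_mono)
    qed
  qed
  have conv: "C1bv_tendsto_rotation (\<lambda>t. g t \<circ> f \<circ> inv (g t)) (rotation_number f) (at 1 within {0..<1})"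
    if F: "diffeo_lift F" and f: "circle_lift F f" and small: "\<And>\<epsilon>. \<epsilon> > 0 \<Longrightarrow> \<exists>K. \<forall>n\<ge>K. defect (v n) F \<le> ennreal \<epsilon>" for F f
  proof -
    define C where "C t = (\<lambda>x. G t (F (inv (G t) x)))" for t
    have C: "diffeo_lift (C t)" "cvar (\<lambda>x. ln (deriv (C t) x)) = defect (w t) F" for t
      unfolding C_def by (rule cvar_conjugate[OF F pw(1) G_def])+
    have c: "circle_lift (C t) (g t \<circ> f \<circ> inv (g t))" for t
      unfolding C_def using circle_lift_comp[OF circle_lift_comp[OF g f] inv_g] by (simp add: o_def)
    have \<tau>: "translation_number (C t) = translation_number F" for t
      unfolding C_def by (rule translation_number_conj[OF F G])
    have ev: "\<forall>\<^sub>F t in at 1 within {0..<1}. defect (w t) F \<le> ennreal \<epsilon>" if \<epsilon>: "\<epsilon> > 0" for \<epsilon>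
    proof -
      obtain K where K: "\<And>n. n \<ge> K \<Longrightarrow> defect (v n) F \<le> ennreal \<epsilon>" using small[OF \<epsilon>] by blast
      show ?thesis
        unfolding eventually_at
      proof (intro exI[of _ "1 / (real K + 1)"] conjI ballI impI)
        fix t :: real assume t: "t \<in> {0..<1}" "t \<noteq> 1 \<and> dist t 1 < 1 / (real K + 1)"
        then have "1 - t < 1 / (real K + 1)" "1 - t > 0" by (auto simp: dist_real_def)
        then have "real K \<le> \<sigma> t" unfolding \<sigma>_def by (simp add: field_simps)
        then show "defect (w t) F \<le> ennreal \<epsilon>"
          unfolding w_def using \<epsilon> by (intro defect_interpolate[OF \<sigma>0[OF t(1)] _ K]) auto
      qed simp
    qed
    have evC: "\<forall>\<^sub>F t in at 1 within {0..<1}. \<forall>x. \<bar>deriv (C t) x - 1\<bar> \<le> \<epsilon> \<and> \<bar>C t x - (x + translation_number F)\<bar> \<le> \<epsilon>"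
      if \<epsilon>: "\<epsilon> > 0" for \<epsilon>
    proof -
      obtain r where r: "r > 0" "1 * (exp r - 1) \<le> \<epsilon>" using small_exp[OF \<epsilon>, of 1] by auto
      show ?thesis
        using ev[OF r(1)]
      proof eventually_elim
        case (elim t)
        have "cvar (\<lambda>x. ln (deriv (C t) x)) \<le> ennreal r" using elim by (simp add: C(2))
        from close_to_rotation[OF C(1) this] show ?case
          using r unfolding \<tau> by (auto intro: order.trans)
      qed
    qed
    show ?thesis
      unfolding C1bv_tendsto_rotation_def uniform_limit_iff
    proof (intro conjI allI impI)
      fix \<epsilon> :: real assume "\<epsilon> > 0"
      then have "\<epsilon> / 2 > 0" by simp
      note ev2 = evC[OF this]
      show "\<forall>\<^sub>F t in at 1 within {0..<1}. \<forall>p\<in>UNIV. dist ((g t \<circ> f \<circ> inv (g t)) p) (rotation (rotation_number f) p) < \<epsilon>"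
        using ev2
      proof eventually_elim
        case (elim t)
        show ?case
        proof
          fix p
          obtain x where p: "p = circle_of x" by (rule circle_of_cases)
          have "rotation (rotation_number f) p = circle_of (x + translation_number F)"
            unfolding rotation_def p rotation_number_lift[OF F f] by (rule plus_circle.abs_eq)
          then have "dist ((g t \<circ> f \<circ> inv (g t)) p) (rotation (rotation_number f) p)
              = dist (circle_of (C t x)) (circle_of (x + translation_number F))"
            using c[of t] by (simp add: p circle_lift_def)
          also have "\<dots> \<le> \<bar>C t x - (x + translation_number F)\<bar>" by (rule dist_circle_of_le)
          also have "\<dots> \<le> \<epsilon> / 2" using elim by blast
          finally show "dist ((g t \<circ> f \<circ> inv (g t)) p) (rotation (rotation_number f) p) < \<epsilon>"
            using \<open>\<epsilon> > 0\<close> by simp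
        qed
      qed
      show "\<forall>\<^sub>F t in at 1 within {0..<1}. \<forall>p\<in>UNIV. dist (circle_deriv (g t \<circ> f \<circ> inv (g t)) p) 1 < \<epsilon>"
        using ev2
      proof eventually_elim
        case (elim t)
        show ?case
        proof
          fix p
          obtain x where p: "p = circle_of x" by (rule circle_of_cases)
          have "\<bar>deriv (C t) x - 1\<bar> \<le> \<epsilon> / 2" using elim by blast
          then show "dist (circle_deriv (g t \<circ> f \<circ> inv (g t)) p) 1 < \<epsilon>"
            using \<open>\<epsilon> > 0\<close> by (simp add: p circle_deriv_lift[OF C(1) c] dist_real_def)
        qed
      qed
    next
      show "((\<lambda>t. circle_var (log_deriv (g t \<circ> f \<circ> inv (g t)))) \<longlongrightarrow> 0) (at 1 within {0..<1})"
        unfolding circle_var_log_deriv[OF C(1) c] C(2) by (rule ennreal_tendsto_0I) (rule ev)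
    qed
  qed
  show ?thesis
    using bv path g0 conv unfolding C1bv_path_def by (intro exI[of _ g]) blast
qed

section \<open>Free Abelian groups with absolutely continuous derivatives\<close>

text \<open>On \<open>[m, \<infinity>)\<close> the logarithm is Lipschitz with constant
  \<open>1 / m\<close>.\<close>

lemma absolutely_continuous_ln:
  assumes h: "absolutely_continuous_on_interval h a b" and m: "m > 0" "\<And>x. m \<le> h x"
  shows "absolutely_continuous_on_interval (\<lambda>x. ln (h x)) a b"
  unfolding absolutely_continuous_on_interval_def
proof (intro allI impI)
  fix \<epsilon> :: real assume \<epsilon>: "\<epsilon> > 0"
  have "\<epsilon> * m > 0" using \<epsilon> m by simp
  then obtain \<delta> where \<delta>: "\<delta> > 0" "\<And>(n::nat) u v. (\<forall>i<n. a \<le> u i \<and> u i \<le> v i \<and> v i \<le> b) \<and>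
      disjoint_family_on (\<lambda>i. {u i<..<v i}) {..<n} \<and> (\<Sum>i<n. v i - u i) < \<delta>
      \<Longrightarrow> (\<Sum>i<n. \<bar>h (v i) - h (u i)\<bar>) < \<epsilon> * m"
    using h unfolding absolutely_continuous_on_interval_def by meson
  have le: "ln x - ln y \<le> \<bar>x - y\<bar> / m" if "m \<le> x" "m \<le> y" for x y
  proof -
    have p: "x > 0" "y > 0" using that m by linarith+
    have "ln x - ln y = ln (x / y)" using p by (simp add: ln_div)
    also have "\<dots> \<le> x / y - 1" using p by (intro ln_le_minus_one) simp
    also have "\<dots> = (x - y) / y" using p by (simp add: field_simps)
    also have "\<dots> \<le> \<bar>x - y\<bar> / y" using p by (intro divide_right_mono) auto
    also have "\<dots> \<le> \<bar>x - y\<bar> / m" using that m(1) by (intro divide_left_mono) auto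
    finally show ?thesis .
  qed
  have lip: "\<bar>ln (h x) - ln (h y)\<bar> \<le> \<bar>h x - h y\<bar> / m" for x y
    using le[OF m(2) m(2), of x y] le[OF m(2) m(2), of y x] by (simp add: abs_le_iff abs_minus_commute)
  show "\<exists>\<delta>>0. \<forall>(n :: nat) u v. (\<forall>i<n. a \<le> u i \<and> u i \<le> v i \<and> v i \<le> b) \<and>
      disjoint_family_on (\<lambda>i. {u i<..<v i}) {..<n} \<and> (\<Sum>i<n. v i - u i) < \<delta>
      \<longrightarrow> (\<Sum>i<n. \<bar>ln (h (v i)) - ln (h (u i))\<bar>) < \<epsilon>"
  proof (intro exI[of _ \<delta>] conjI allI impI)
    fix n :: nat and u v
    assume "(\<forall>i<n. a \<le> u i \<and> u i \<le> v i \<and> v i \<le> b) \<and>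
      disjoint_family_on (\<lambda>i. {u i<..<v i}) {..<n} \<and> (\<Sum>i<n. v i - u i) < \<delta>"
    from \<delta>(2)[OF this] have "(\<Sum>i<n. \<bar>h (v i) - h (u i)\<bar>) / m < \<epsilon>" using m by (simp add: divide_less_eq)
    moreover have "(\<Sum>i<n. \<bar>ln (h (v i)) - ln (h (u i))\<bar>) \<le> (\<Sum>i<n. \<bar>h (v i) - h (u i)\<bar>) / m"
      unfolding sum_divide_distrib by (intro sum_mono lip)
    ultimately show "(\<Sum>i<n. \<bar>ln (h (v i)) - ln (h (u i))\<bar>) < \<epsilon>" by linarith
  qed (use \<delta> in auto)
qed

lemma C1_approximable_ln_deriv:
  assumes F: "diffeo_lift F" and f: "circle_lift F f" and bv: "C1bv_diffeo f"
    and ac: "circle_absolutely_continuous (circle_deriv f)"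
  shows "C1_approximable (\<lambda>x. ln (deriv F x))"
proof -
  have p: "pcont (\<lambda>x. ln (deriv F x))" by (rule pcont_ln_deriv[OF F])
  obtain B where B: "\<And>x. \<bar>ln (deriv F x)\<bar> \<le> B" using pcont_bounded[OF p] by blast
  have "exp (- B) \<le> deriv F x" for x
  proof -
    have "exp (- B) \<le> exp (ln (deriv F x))" using B[of x] by (simp only: exp_le_cancel_iff)
    then show ?thesis using diffeo_lift_pos[OF F] by simp
  qed
  moreover have "absolutely_continuous_on_interval (deriv F) 0 1"
    using ac unfolding circle_absolutely_continuous_def by (simp add: circle_deriv_lift[OF F f])
  ultimately have ac': "absolutely_continuous_on_interval (\<lambda>x. ln (deriv F x)) 0 1"
    by (intro absolutely_continuous_ln[where m = "exp (- B)"]) auto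
  have "cvar (\<lambda>x. ln (deriv F x)) < \<infinity>"
    using bv circle_var_log_deriv[OF F f] by (simp add: C1bv_diffeo_def)
  then obtain V where V: "0 \<le> V" "cvar (\<lambda>x. ln (deriv F x)) = ennreal V"
    by (cases "cvar (\<lambda>x. ln (deriv F x))" rule: ennreal_cases) auto
  show ?thesis
    unfolding C1_approximable_def
    using absolutely_continuous_C1_approx[OF pcontD(1)[OF p] pcontD(2)[OF p] _ V(1) ac'] V(2) pcontD(2)[OF p] by auto
qed

text \<open>Freeness applied to the powers of \<open>f\<close>: one of positive exponent is the
  identity, and its lift a translation by an integer, or none has a fixed point.\<close>

lemma periodic_or_no_periodic_points:
  assumes \<Gamma>: "C1bv_group \<Gamma>" "acts_freely \<Gamma>" and f: "f \<in> \<Gamma>" and F: "diffeo_lift F" "circle_lift F f"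
  shows "(\<exists>q>0. \<exists>p::int. \<forall>y. (F ^^ q) y = y + of_int p) \<or> (\<forall>q>0. \<forall>p::int. \<forall>y. (F ^^ q) y \<noteq> y + of_int p)"
proof (cases "\<exists>q>0. f ^^ q = id")
  case True
  then obtain q where q: "q > 0" "f ^^ q = id" by blast
  have "circle_lift (F ^^ q) id" using circle_lift_funpow[OF F(2), of q] q(2) by simp
  then obtain p where "\<And>x. (F ^^ q) x = x + of_int p" using circle_lift_unique[OF _ circle_lift_id] by metis
  then show ?thesis using q(1) by blast
next
  case False
  have pow: "f ^^ q \<in> \<Gamma>" for q
  proof (induction q)
    case 0
    then show ?case using \<Gamma>(1) by (simp add: C1bv_group_def id_def)
  next
    case (Suc q)
    have "f \<circ> f ^^ q \<in> \<Gamma>" using \<Gamma>(1) f Suc unfolding C1bv_group_def by blast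
    then show ?case by (simp only: funpow.simps)
  qed
  have "(F ^^ q) y \<noteq> y + of_int p" if "q > 0" for q p y
  proof
    assume eq: "(F ^^ q) y = y + of_int p"
    have "(f ^^ q) (circle_of y) = circle_of ((F ^^ q) y)"
      using circle_lift_funpow[OF F(2), of q] by (simp add: circle_lift_def)
    also have "\<dots> = circle_of y" by (simp add: eq)
    finally show False using \<Gamma>(2) pow[of q] False that unfolding acts_freely_def by blast
  qed
  then show ?thesis by blast
qed

theorem mainTheorem1:
  fixes \<Gamma> :: "(circle \<Rightarrow> circle) set"
  assumes "C1bv_group \<Gamma>"
    and "countable \<Gamma>"
    and "\<forall>f\<in>\<Gamma>. \<forall>h\<in>\<Gamma>. f \<circ> h = h \<circ> f"
    and "acts_freely \<Gamma>"
    and "\<forall>f\<in>\<Gamma>. circle_absolutely_continuous (circle_deriv f)"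
  shows "\<exists>g :: real \<Rightarrow> circle \<Rightarrow> circle.
    C1bv_path g {0..<1} \<and> g 0 = id \<and>
    (\<forall>f\<in>\<Gamma>. C1bv_tendsto_rotation (\<lambda>t. g t \<circ> f \<circ> inv (g t)) (rotation_number f)
      (at 1 within {0..<1}))"
proof -
  have ne: "\<Gamma> \<noteq> {}" using assms(1) by (auto simp: C1bv_group_def)
  have bv: "C1bv_diffeo f" if "f \<in> \<Gamma>" for f using assms(1) that by (auto simp: C1bv_group_def)
  have "\<forall>f\<in>\<Gamma>. \<exists>F. diffeo_lift F \<and> circle_lift F f"
    using bv circle_C1_diffeoE unfolding C1bv_diffeo_def by metis
  then obtain lift where lift: "\<And>f. f \<in> \<Gamma> \<Longrightarrow> diffeo_lift (lift f)" "\<And>f. f \<in> \<Gamma> \<Longrightarrow> circle_lift (lift f) f"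
    by metis
  have commute: "commute_mod1 (lift f) (lift h)" if "f \<in> \<Gamma>" "h \<in> \<Gamma>" for f h
  proof -
    have "circle_lift (\<lambda>x. lift f (lift h x)) (f \<circ> h)" "circle_lift (\<lambda>x. lift h (lift f x)) (f \<circ> h)"
      using circle_lift_comp lift that assms(3) by metis+
    from circle_lift_unique[OF this] show ?thesis unfolding commute_mod1_def by metis
  qed
  have props: "diffeo_lift (lift f) \<and> C1_approximable (\<lambda>x. ln (deriv (lift f) x)) \<and>
      ((\<exists>q>0. \<exists>p::int. \<forall>y. (lift f ^^ q) y = y + of_int p) \<or> (\<forall>q>0. \<forall>p::int. \<forall>y. (lift f ^^ q) y \<noteq> y + of_int p))"
    if f: "f \<in> \<Gamma>" for f
    using lift(1)[OF f] C1_approximable_ln_deriv[OF lift[OF f] bv[OF f]] assms(5) f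
      periodic_or_no_periodic_points[OF assms(1,4) f lift[OF f]] by blast
  \<comment> \<open>An enumeration with repetitions if \<Gamma> is finite.\<close>
  define e where "e = from_nat_into \<Gamma>"
  have e: "e n \<in> \<Gamma>" for n unfolding e_def by (rule from_nat_into[OF ne])
  \<comment> \<open>Index \<open>n\<close> serves the first \<open>n\<close> elements with precision
    \<open>1 / real (Suc n)\<close>, so each element is served by all but finitely many
    indices.\<close>
  define good where "good n \<psi> v \<longleftrightarrow> pcont \<psi> \<and> (\<forall>x. (v has_real_derivative \<psi> x) (at x)) \<and> (\<forall>x. v (x + 1) = v x) \<and>
    (\<forall>F\<in>set (map (\<lambda>i. lift (e i)) [0..<n]). defect v F \<le> ennreal (1 / real (Suc n)))" for n \<psi> v
  have "\<exists>\<psi> v. good n \<psi> v" for n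
    unfolding good_def by (intro C1_approximate_fixed_point) (use props commute e in auto)
  then obtain \<psi>' v' where good: "\<And>n. good n (\<psi>' n) (v' n)" by metis
  have v': "pcont (\<psi>' n)" "(v' n has_real_derivative \<psi>' n x) (at x)" "v' n (x + 1) = v' n x" for n x
    using good[of n] unfolding good_def by blast+
  have small: "defect (v' n) (lift (e i)) \<le> ennreal (1 / real (Suc n))" if "i < n" for n i
    using good[of n] that unfolding good_def by simp
  \<comment> \<open>The zero function at index \<open>0\<close> makes the path start at the
    identity.\<close>
  define v where "v n = (if n = 0 then (\<lambda>_. 0) else v' n)" for n
  define \<psi> where "\<psi> n = (if n = 0 then (\<lambda>_. 0) else \<psi>' n)" for n
  have v: "C1_periodic (v n) (\<psi> n)" for n
    by (cases "n = 0") (auto simp: v_def \<psi>_def v' intro!: C1_periodicI pcont_intros)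
  have v0: "v 0 = (\<lambda>_. 0)" by (simp add: v_def)
  obtain g where g: "C1bv_path g {0..<1}" "g 0 = id"
    "\<And>F f. diffeo_lift F \<Longrightarrow> circle_lift F f \<Longrightarrow> (\<And>\<epsilon>. \<epsilon> > 0 \<Longrightarrow> \<exists>K. \<forall>n\<ge>K. defect (v n) F \<le> ennreal \<epsilon>) \<Longrightarrow>
      C1bv_tendsto_rotation (\<lambda>t. g t \<circ> f \<circ> inv (g t)) (rotation_number f) (at 1 within {0..<1})"
    using conjugating_path[of v \<psi>, OF v v0] by blast
  have "C1bv_tendsto_rotation (\<lambda>t. g t \<circ> f \<circ> inv (g t)) (rotation_number f) (at 1 within {0..<1})"
    if f: "f \<in> \<Gamma>" for f
  proof (rule g(3)[OF lift(1)[OF f] lift(2)[OF f]])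
    fix \<epsilon> :: real assume \<epsilon>: "\<epsilon> > 0"
    obtain i where i: "f = e i" using from_nat_into_surj[OF assms(2) f] unfolding e_def by metis
    obtain N :: nat where N: "1 / \<epsilon> < real N" using reals_Archimedean2 by blast
    show "\<exists>K. \<forall>n\<ge>K. defect (v n) (lift f) \<le> ennreal \<epsilon>"
    proof (intro exI[of _ "max N (Suc i)"] allI impI)
      fix n assume n: "max N (Suc i) \<le> n"
      then have "v n = v' n" by (simp add: v_def)
      then have "defect (v n) (lift f) \<le> ennreal (1 / real (Suc n))" using small[of i n] n i by simp
      also have "\<dots> \<le> ennreal \<epsilon>"
      proof (rule ennreal_leI)
        have "1 / \<epsilon> < real (Suc n)" using N n by linarith
        then show "1 / real (Suc n) \<le> \<epsilon>" using \<epsilon> by (simp add: field_simps)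
      qed
      finally show "defect (v n) (lift f) \<le> ennreal \<epsilon>" .
    qed
  qed
  then show ?thesis using g(1,2) by blast
qed

end
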